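(* The subordination function $\Omega:\mathbb H_2^+\to\mathbb H_2^+$, characterized by $G_{X+Y}(B)=G_X(\Omega(B))$ for all $B\in\mathbb H_2^+$, has a left inverse $H$, i.e. $H(\Omega(B))=B$ for all $B\in\mathbb H_2^+$, which is given by the formula $$H(B)=B+p\,\bigl(J-G_X(B)\bigr)^{-1},\qquad B\in\mathbb H_2^+,$$ where $J=\begin{bmatrix}0&\mathrm i\\-\mathrm i&0\end{bmatrix}$.
   Context: $(\mathcal A,\varphi)$ is a $W^*$-probability space where $\varphi$ is a faithful trace. $x,y\in\mathcal A$ are selfadjoint and freely independent, and $y$ has free Poisson distribution with parameter $p\in(0,\infty)$, meaning that all free cumulants of $y$ are equal to $p$. In $M_2(\mathcal A)$ put $X=\begin{bmatrix}0 & x \\ x & 0\end{bmatrix}$ and $Y=\begin{bmatrix}0&\mathrm i y\\-\mathrm i y&0\end{bmatrix}$. Let $E:M_2(\mathcal A)\to M_2(\mathbb C)$ be the conditional expectation applying $\varphi$ entrywise; $X$ and $Y$ are free with amalgamation over $M_2(\mathbb C)$ with respect to $E$. Let $\mathbb H_2^+=\{B\in M_2(\mathbb C):\Im B\text{ is positive definite and invertible}\}$ with $\Im B=\frac{1}{2\mathrm i}(B-B^* )$, and $\mathbb H_2^-=-\mathbb H_2^+$. For $A=A^*\in M_2(\mathcal A)$ the Cauchy transform $G_A:\mathbb H_2^+\to\mathbb H_2^-$ is $G_A(B)=E((B-A)^{-1})$. The subordination function $\Omega:\mathbb H_2^+\to\mathbb H_2^+$ is the Fréchet-analytic map such that $\Im\Omega(B)\ge\Im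 B$ and $G_{X+Y}(B)=G_X(\Omega(B))$ for all $B\in\mathbb H_2^+$ (its existence is a known result of operator-valued free probability). *)

theory Defs
  imports "HOL-Analysis.Analysis"
begin

section \<open>W*-algebras\<close>

text \<open>Unital C*-algebras. The norm axiom \<open>norm 1 = 1\<close> of
  \<^class>\<open>real_normed_algebra_1\<close> only excludes the zero algebra, which carries no state.\<close>

class cstar_algebra = real_normed_algebra_1 + banach +
  fixes scaleC :: "complex \<Rightarrow> 'a \<Rightarrow> 'a"  (infixr \<open>*\<^sub>C\<close> 75)
    and star :: "'a \<Rightarrow> 'a"
  assumes scaleC_add_right: "c *\<^sub>C (a + b) = c *\<^sub>C a + c *\<^sub>C b"
    and scaleC_add_left: "(c + d) *\<^sub>C a = c *\<^sub>C a + d *\<^sub>C a"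
    and scaleC_scaleC: "c *\<^sub>C d *\<^sub>C a = (c * d) *\<^sub>C a"
    and scaleR_scaleC: "r *\<^sub>R a = complex_of_real r *\<^sub>C a"
    and norm_scaleC: "norm (c *\<^sub>C a) = cmod c * norm a"
    and mult_scaleC_left: "(c *\<^sub>C a) * b = c *\<^sub>C (a * b)"
    and mult_scaleC_right: "a * (c *\<^sub>C b) = c *\<^sub>C (a * b)"
    and star_star: "star (star a) = a"
    and star_add: "star (a + b) = star a + star b"
    and star_scaleC: "star (c *\<^sub>C a) = cnj c *\<^sub>C star a"
    and star_mult: "star (a * b) = star b * star a"
    and cstar_identity: "norm (star a * a) = (norm a)\<^sup>2"

text \<open>A predual of a C*-algebra, realised inside its dual: a norm-closed complex subspace \<open>V\<close> of
  the space of bounded complex-linear functionals such that evaluation identifies the algebra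
  isometrically with the space of bounded complex-linear functionals on \<open>V\<close>. (The norm of a
  complex-linear functional does not change when it is regarded as a real-linear one, as in
  the type of bounded linear functions.) By Sakai's theorem such a \<open>V\<close> is unique, and a
  functional is normal iff it belongs to \<open>V\<close>.\<close>

definition is_predual :: "('a::cstar_algebra \<Rightarrow>\<^sub>L complex) set \<Rightarrow> bool" where
  "is_predual V \<longleftrightarrow>
     (\<forall>f\<in>V. \<forall>c a. blinfun_apply f (c *\<^sub>C a) = c * blinfun_apply f a) \<and>
     0 \<in> V \<and> (\<forall>f\<in>V. \<forall>g\<in>V. f + g \<in> V) \<and>
     (\<forall>c. \<forall>f\<in>V. blinfun_mult_right c o\<^sub>L f \<in> V) \<and>
     closed V \<and>
     (\<forall>a. norm a = (SUP f\<in>{f\<in>V. norm f \<le> 1}. cmod (blinfun_apply f a))) \<and>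
     (\<forall>F :: ('a \<Rightarrow>\<^sub>L complex) \<Rightarrow> complex.
        (\<forall>f\<in>V. \<forall>g\<in>V. F (f + g) = F f + F g) \<and>
        (\<forall>c. \<forall>f\<in>V. F (blinfun_mult_right c o\<^sub>L f) = c * F f) \<and>
        (\<exists>K. \<forall>f\<in>V. cmod (F f) \<le> K * norm f)
        \<longrightarrow> (\<exists>a. \<forall>f\<in>V. F f = blinfun_apply f a))"

text \<open>The algebra is a W*-algebra iff it has a predual, so the assumption \<open>normal\<close> below
  comprises both that the algebra is a W*-algebra and that \<open>\<phi>\<close> is normal.\<close>

locale tracial_wstar_probability_space =
  fixes \<phi> :: "'a::cstar_algebra \<Rightarrow> complex"
  assumes add: "\<phi> (a + b) = \<phi> a + \<phi> b"
    and scaleC: "\<phi> (c *\<^sub>C a) = c * \<phi> a"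
    and unital: "\<phi> 1 = 1"
    and positive: "\<phi> (star a * a) \<in> \<real>\<^sub>\<ge>\<^sub>0"
    and normal: "\<exists>V. is_predual V \<and> (\<exists>f\<in>V. \<phi> = blinfun_apply f)"
    and faithful: "\<phi> (star a * a) = 0 \<Longrightarrow> a = 0"
    and tracial: "\<phi> (a * b) = \<phi> (b * a)"

definition selfadjoint :: "'a::cstar_algebra \<Rightarrow> bool" where
  "selfadjoint a \<longleftrightarrow> star a = a"


section \<open>Freeness and free cumulants\<close>

inductive_set unital_subalgebra :: "'a::cstar_algebra set \<Rightarrow> 'a set" for S where
  gen: "a \<in> S \<Longrightarrow> a \<in> unital_subalgebra S"
| one: "1 \<in> unital_subalgebra S"
| scaleC: "a \<in> unital_subalgebra S \<Longrightarrow> c *\<^sub>C a \<in> unital_subalgebra S"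
| add: "a \<in> unital_subalgebra S \<Longrightarrow> b \<in> unital_subalgebra S \<Longrightarrow> a + b \<in> unital_subalgebra S"
| mult: "a \<in> unital_subalgebra S \<Longrightarrow> b \<in> unital_subalgebra S \<Longrightarrow> a * b \<in> unital_subalgebra S"

definition free_family :: "('a::cstar_algebra \<Rightarrow> complex) \<Rightarrow> ('i \<Rightarrow> 'a set) \<Rightarrow> bool" where
  "free_family \<phi> A \<longleftrightarrow>
     (\<forall>ws :: ('i \<times> 'a) list.
        ws \<noteq> [] \<and> successively (\<lambda>u v. fst u \<noteq> fst v) ws \<and>
        (\<forall>(i, a)\<in>set ws. a \<in> A i \<and> \<phi> a = 0)
        \<longrightarrow> \<phi> (prod_list (map snd ws)) = 0)"

definition freely_independent :: "('a::cstar_algebra \<Rightarrow> complex) \<Rightarrow> 'a \<Rightarrow> 'a \<Rightarrow> bool" where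
  "freely_independent \<phi> x y \<longleftrightarrow>
     free_family \<phi> (\<lambda>b::bool. if b then unital_subalgebra {x} else unital_subalgebra {y})"

definition noncrossing :: "nat set set \<Rightarrow> bool" where
  "noncrossing P \<longleftrightarrow>
     (\<forall>V\<in>P. \<forall>W\<in>P. \<forall>a\<in>V. \<forall>b\<in>W. \<forall>c\<in>V. \<forall>d\<in>W. a < b \<and> b < c \<and> c < d \<longrightarrow> V = W)"

definition NC :: "nat \<Rightarrow> nat set set set" where
  "NC n = {P. partition_on {1..n} P \<and> noncrossing P}"

lemma finite_NC: "finite (NC n)"
proof (rule finite_subset)
  show "NC n \<subseteq> Pow (Pow {1..n})"
    by (auto simp: NC_def partition_on_def)
qed simp

lemma card_block_less:
  assumes "P \<in> NC n - {{{1..n}}}" "V \<in> P"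
  shows "card V < n"
proof -
  have P: "partition_on {1..n} P" and ne: "P \<noteq> {{1..n}}"
    using assms(1) by (auto simp: NC_def)
  have sub: "V \<subseteq> {1..n}"
    using P assms(2) by (auto simp: partition_on_def)
  have "V \<noteq> {1..n}"
  proof
    assume V: "V = {1..n}"
    have "W = V" if "W \<in> P" for W
    proof (rule ccontr)
      assume "W \<noteq> V"
      then have "W \<inter> V = {}" "W \<noteq> {}" "W \<subseteq> {1..n}"
        using P that assms(2) by (auto simp: partition_on_def disjoint_def)
      then show False using V by auto
    qed
    then show False using ne assms(2) V by blast
  qed
  then have "card V < card {1..n}"
    using sub by (intro psubset_card_mono) auto
  then show ?thesis by simp
qed

text \<open>The free cumulants of a sequence of moments are obtained by solving the moment-cumulant
  formula for the term of the one-block partition.\<close>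

function free_cumulants :: "(nat \<Rightarrow> complex) \<Rightarrow> nat \<Rightarrow> complex" where
  "free_cumulants m n =
     m n - (\<Sum>P\<in>NC n - {{{1..n}}}. \<Prod>V\<in>P. free_cumulants m (card V))"
  by auto
termination
  by (relation "Wellfounded.measure snd") (auto intro: card_block_less)

declare free_cumulants.simps [simp del]

lemma one_block_in_NC: "n \<ge> 1 \<Longrightarrow> {{1..n}} \<in> NC n"
  by (auto simp: NC_def noncrossing_def partition_on_def disjoint_def)

lemma moment_cumulant_formula:
  assumes "n \<ge> 1"
  shows "m n = (\<Sum>P\<in>NC n. \<Prod>V\<in>P. free_cumulants m (card V))"
proof -
  have "(\<Sum>P\<in>NC n. \<Prod>V\<in>P. free_cumulants m (card V)) =
        (\<Prod>V\<in>{{1..n}}. free_cumulants m (card V)) +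
        (\<Sum>P\<in>NC n - {{{1..n}}}. \<Prod>V\<in>P. free_cumulants m (card V))"
    using finite_NC one_block_in_NC[OF assms] by (rule sum.remove)
  then show ?thesis
    by (simp add: free_cumulants.simps[of m n])
qed

definition free_cumulant :: "('a::cstar_algebra \<Rightarrow> complex) \<Rightarrow> 'a \<Rightarrow> nat \<Rightarrow> complex" where
  "free_cumulant \<phi> a = free_cumulants (\<lambda>n. \<phi> (a ^ n))"

definition free_poisson :: "('a::cstar_algebra \<Rightarrow> complex) \<Rightarrow> real \<Rightarrow> 'a \<Rightarrow> bool" where
  "free_poisson \<phi> p y \<longleftrightarrow> (\<forall>n\<ge>1. free_cumulant \<phi> y n = of_real p)"


section \<open>Complex matrices\<close>

definition adjoint_mat :: "complex^'n^'m \<Rightarrow> complex^'m^'n" where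
  "adjoint_mat B = (\<chi> i j. cnj (B $ j $ i))"

definition Im_mat :: "complex^'n^'n \<Rightarrow> complex^'n^'n" where
  "Im_mat B = map_matrix (\<lambda>z. z / (2 * \<i>)) (B - adjoint_mat B)"

definition quadratic_form :: "complex^'n^'n \<Rightarrow> complex^'n \<Rightarrow> complex" where
  "quadratic_form P v = (\<Sum>i\<in>UNIV. cnj (v $ i) * (P *v v) $ i)"

definition pos_semidef :: "complex^'n^'n \<Rightarrow> bool" where
  "pos_semidef P \<longleftrightarrow> (\<forall>v. quadratic_form P v \<in> \<real>\<^sub>\<ge>\<^sub>0)"

definition pos_def :: "complex^'n^'n \<Rightarrow> bool" where
  "pos_def P \<longleftrightarrow> (\<forall>v. v \<noteq> 0 \<longrightarrow> quadratic_form P v \<in> \<real>\<^sub>\<ge>\<^sub>0 - {0})"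

definition loewner_le :: "complex^'n^'n \<Rightarrow> complex^'n^'n \<Rightarrow> bool"  (infix \<open>\<preceq>\<close> 50) where
  "P \<preceq> Q \<longleftrightarrow> pos_semidef (Q - P)"

definition upper_half_plane :: "(complex^2^2) set"  (\<open>\<H>\<^sub>2\<^sup>+\<close>) where
  "\<H>\<^sub>2\<^sup>+ = {B. pos_def (Im_mat B) \<and> invertible (Im_mat B)}"

definition frechet_analytic_on :: "(complex^'n^'n) set \<Rightarrow> (complex^'n^'n \<Rightarrow> complex^'n^'n) \<Rightarrow> bool"
  where
  "frechet_analytic_on S f \<longleftrightarrow>
     (\<forall>B\<in>S. \<exists>D. (f has_derivative D) (at B) \<and>
        (\<forall>c M. D (map_matrix ((*) c) M) = map_matrix ((*) c) (D M)))"


section \<open>Cauchy transforms and subordination\<close>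

text \<open>The conditional expectation onto the complex matrices is \<open>map_matrix \<phi>\<close>, and the complex
  matrices are embedded in the matrices over the algebra by \<open>scalar_mat\<close>.\<close>

definition scalar_mat :: "complex^2^2 \<Rightarrow> 'a::cstar_algebra^2^2" where
  "scalar_mat = map_matrix (\<lambda>c. c *\<^sub>C 1)"

definition cauchy_transform ::
    "('a::cstar_algebra \<Rightarrow> complex) \<Rightarrow> 'a^2^2 \<Rightarrow> complex^2^2 \<Rightarrow> complex^2^2" where
  "cauchy_transform \<phi> A B = map_matrix \<phi> (matrix_inv (scalar_mat B - A))"

text \<open>The values of \<open>\<Omega>\<close> outside \<open>\<H>\<^sub>2\<^sup>+\<close> are irrelevant, since \<open>\<H>\<^sub>2\<^sup>+\<close> is open.\<close>

definition subordination_function ::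
    "('a::cstar_algebra \<Rightarrow> complex) \<Rightarrow> 'a^2^2 \<Rightarrow> 'a^2^2 \<Rightarrow> (complex^2^2 \<Rightarrow> complex^2^2) \<Rightarrow> bool" where
  "subordination_function \<phi> X Y \<Omega> \<longleftrightarrow>
     \<Omega> \<in> \<H>\<^sub>2\<^sup>+ \<rightarrow> \<H>\<^sub>2\<^sup>+ \<and> frechet_analytic_on \<H>\<^sub>2\<^sup>+ \<Omega> \<and>
     (\<forall>B\<in>\<H>\<^sub>2\<^sup>+. Im_mat B \<preceq> Im_mat (\<Omega> B)) \<and>
     (\<forall>B\<in>\<H>\<^sub>2\<^sup>+. cauchy_transform \<phi> (X + Y) B = cauchy_transform \<phi> X (\<Omega> B))"

definition X_mat :: "'a::cstar_algebra \<Rightarrow> 'a^2^2" where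
  "X_mat x = vector [vector [0, x], vector [x, 0]]"

definition Y_mat :: "'a::cstar_algebra \<Rightarrow> 'a^2^2" where
  "Y_mat y = vector [vector [0, \<i> *\<^sub>C y], vector [- (\<i> *\<^sub>C y), 0]]"

definition J_mat :: "complex^2^2" where
  "J_mat = vector [vector [0, \<i>], vector [- \<i>, 0]]"

end

(* For y alone, the recursion for the weighted number of noncrossing partitions gives
   M = 1 + z M^2 + (p - 1) z M for the moment generating function; with Y = y J this yields
   E((W2 - Y)^-1) = G for W2 = G^-1 + p (J - G)^-1 and every small invertible scalar matrix G.
   For large W and G = G_X(W), write (W - X)^-1 = (1 + u) G and (W2 - Y)^-1 = (1 + v) G with
   E u = E v = 0. Then (W + p (J - G)^-1 - X - Y)^-1 = (1 + v) (1 - u v)^-1 (1 + u) G, whose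
   expectation is G by freeness, so G_{X+Y}(H(W)) = G_X(W). Since G_{X+Y} is injective near
   infinity, W = Omega(B) gives H(Omega(B)) = B for large B, and analytic continuation along
   B + z I, Im z > - epsilon, extends (B - Omega(B)) (J - G_X(Omega(B))) = p to the half-plane. *)

theory Submission
  imports
    Defs
    "HOL-Complex_Analysis.Conformal_Mappings"
    "HOL-Computational_Algebra.Fundamental_Theorem_Algebra"
begin

section \<open>Weighted enumeration of noncrossing partitions\<close>

text \<open>Freeness over M_2(C) enters only through words alternating between one centred u and one
  centred v, because (1 - u v)^-1 is expanded as a geometric series; such words vanish entry by
  entry, by scalar freeness. G and J need not commute. What still makes the Poisson computation
  scalar is that z = W2^-1 J is a power series in G J, so these two commute, and E((W2 - Y)^-1) = G
  turns into the equation T = z + T^2 + (p - 1) z T for T = G J. The recursion for the moments gives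
  the same equation for the expectation, and its small solution is unique. All inverses near
  infinity are geometric series; a filter replaces explicit radii. No asymptotics of Omega are
  assumed: Im Omega(B) >= Im B alone makes Omega(B)^-1 small. Away from infinity, inverses need
  other arguments: C - X is inverted by Cramer's rule, whose determinant is, up to sign, a product
  of two nonreal shifts of x; and J - G_X is invertible because J is selfadjoint while faithfulness
  of \<open>\<phi>\<close> makes Im G_X strictly negative.\<close>

definition nc_on :: "nat set \<Rightarrow> nat set set set" where
  "nc_on S = {P. partition_on S P \<and> noncrossing P}"

text \<open>If all free cumulants equal p, this is the moment of order b - a. Half-open intervals
  concatenate at a cut point without an index shift, and \<open>{a<..a}\<close> is empty.\<close>

definition nc_weight :: "real \<Rightarrow> nat \<Rightarrow> nat \<Rightarrow> real" where
  "nc_weight p a b = (\<Sum>P\<in>nc_on {a<..b}. p ^ card P)"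

lemma finite_nc_on: "finite S \<Longrightarrow> finite (nc_on S)"
  by (rule finite_subset[of _ "Pow (Pow S)"]) (auto simp: nc_on_def partition_on_def)

lemma finite_nc_on_element: "P \<in> nc_on S \<Longrightarrow> finite S \<Longrightarrow> finite P"
  by (auto simp: nc_on_def intro: finite_elements)

lemma nc_onD:
  assumes "P \<in> nc_on S"
  shows "V \<in> P \<Longrightarrow> V \<subseteq> S" "{} \<notin> P" "\<Union>P = S"
    "V \<in> P \<Longrightarrow> W \<in> P \<Longrightarrow> u \<in> V \<Longrightarrow> u \<in> W \<Longrightarrow> V = W"
    "V \<in> P \<Longrightarrow> W \<in> P \<Longrightarrow> a \<in> V \<Longrightarrow> b \<in> W \<Longrightarrow> c \<in> V \<Longrightarrow> d \<in> W \<Longrightarrow> a < b \<Longrightarrow> b < c \<Longrightarrow> c < d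
      \<Longrightarrow> V = W"
proof -
  have P: "\<Union>P = S" "disjoint P" "{} \<notin> P" "noncrossing P"
    using assms by (auto simp: nc_on_def partition_on_def)
  show "V \<subseteq> S" if "V \<in> P" using P(1) that by blast
  show "{} \<notin> P" "\<Union>P = S" by fact+
  show "V = W" if "V \<in> P" "W \<in> P" "u \<in> V" "u \<in> W"
    using P(2) that unfolding disjoint_def by blast
  show "V = W" if "V \<in> P" "W \<in> P" "a \<in> V" "b \<in> W" "c \<in> V" "d \<in> W" "a < b" "b < c" "c < d"
    using P(4) that unfolding noncrossing_def by meson
qed

lemma nc_onI:
  assumes "\<Union>P = S" "{} \<notin> P"
    "\<And>V W u. V \<in> P \<Longrightarrow> W \<in> P \<Longrightarrow> u \<in> V \<Longrightarrow> u \<in> W \<Longrightarrow> V = W"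
    "\<And>V W a b c d. V \<in> P \<Longrightarrow> W \<in> P \<Longrightarrow> a \<in> V \<Longrightarrow> b \<in> W \<Longrightarrow> c \<in> V \<Longrightarrow> d \<in> W \<Longrightarrow> a < b \<Longrightarrow> b < c \<Longrightarrow> c < d
      \<Longrightarrow> V = W"
  shows "P \<in> nc_on S"
proof -
  have "noncrossing P" unfolding noncrossing_def using assms(4) by meson
  moreover have "disjoint P" unfolding disjoint_def using assms(3) by blast
  ultimately show ?thesis using assms(1,2) by (simp add: nc_on_def partition_on_def)
qed

lemma nc_weight_diag: "nc_weight p a a = 1"
proof -
  have "nc_on {} = {{}}"
    by (auto simp: nc_on_def noncrossing_def partition_on_def)
  then show ?thesis by (simp add: nc_weight_def)
qed

text \<open>Such a partition is the same as a pair of noncrossing partitions of the two halves: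
  blocks on different sides of the cut cannot interleave, and the numbers of blocks add up.\<close>

lemma nc_weight_split:
  assumes "a \<le> k" "k \<le> b"
  shows "(\<Sum>P | P \<in> nc_on {a<..b} \<and> (\<forall>W\<in>P. W \<subseteq> {a<..k} \<or> W \<subseteq> {k<..b}). p ^ card P) =
     nc_weight p a k * nc_weight p k b"
proof -
  let ?B = "{P. P \<in> nc_on {a<..b} \<and> (\<forall>W\<in>P. W \<subseteq> {a<..k} \<or> W \<subseteq> {k<..b})}"
  let ?f = "\<lambda>P. ({W\<in>P. W \<subseteq> {a<..k}}, {W\<in>P. W \<subseteq> {k<..b}})"
  have f: "?f P \<in> nc_on {a<..k} \<times> nc_on {k<..b}" if "P \<in> ?B" for P
  proof -
    have P: "P \<in> nc_on {a<..b}" using that by simp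
    note D = nc_onD[OF P]
    have sub: "Q \<in> nc_on (\<Union>Q)" if "Q \<subseteq> P" for Q
      by (rule nc_onI[OF refl]) (use that D(2) D(4) in blast, use that D(4) in blast,
        use that D(5) in \<open>meson subsetD\<close>)
    have ab: "u \<in> {a<..b} \<longleftrightarrow> (\<exists>W\<in>P. u \<in> W)" for u using D(3) by blast
    have "\<Union>{W\<in>P. W \<subseteq> {a<..k}} = {a<..k}"
    proof
      show "{a<..k} \<subseteq> \<Union>{W\<in>P. W \<subseteq> {a<..k}}"
      proof
        fix u assume u: "u \<in> {a<..k}"
        then obtain W where W: "W \<in> P" "u \<in> W" using ab[of u] assms by auto
        then have "W \<subseteq> {a<..k}" using that u by fastforce
        then show "u \<in> \<Union>{W\<in>P. W \<subseteq> {a<..k}}" using W by blast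
      qed
    qed auto
    moreover have "\<Union>{W\<in>P. W \<subseteq> {k<..b}} = {k<..b}"
    proof
      show "{k<..b} \<subseteq> \<Union>{W\<in>P. W \<subseteq> {k<..b}}"
      proof
        fix u assume u: "u \<in> {k<..b}"
        then obtain W where W: "W \<in> P" "u \<in> W" using ab[of u] assms by auto
        then have "W \<subseteq> {k<..b}" using that u by fastforce
        then show "u \<in> \<Union>{W\<in>P. W \<subseteq> {k<..b}}" using W by blast
      qed
    qed auto
    ultimately show ?thesis
      using sub[of "{W\<in>P. W \<subseteq> {a<..k}}"] sub[of "{W\<in>P. W \<subseteq> {k<..b}}"] by simp
  qed
  have g: "P1 \<union> P2 \<in> ?B" if "P1 \<in> nc_on {a<..k}" "P2 \<in> nc_on {k<..b}" for P1 P2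
  proof -
    note D1 = nc_onD[OF that(1)] and D2 = nc_onD[OF that(2)]
    have l: "u \<le> k" if "V \<in> P1" "u \<in> V" for V u using D1(1) that by fastforce
    have r: "k < u" if "V \<in> P2" "u \<in> V" for V u using D2(1) that by fastforce
    have "P1 \<union> P2 \<in> nc_on {a<..b}"
    proof (rule nc_onI)
      show "\<Union>(P1 \<union> P2) = {a<..b}" using D1(3) D2(3) assms by auto
      show "{} \<notin> P1 \<union> P2" using D1(2) D2(2) by auto
      show "V = W" if "V \<in> P1 \<union> P2" "W \<in> P1 \<union> P2" "u \<in> V" "u \<in> W" for V W u
        using that D1(4) D2(4) l r by (metis Un_iff leD)
      show "V = W" if *: "V \<in> P1 \<union> P2" "W \<in> P1 \<union> P2" "c \<in> V" "d \<in> W" "e \<in> V" "f \<in> W"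
        "c < d" "d < e" "e < f" for V W c d e f
      proof -
        consider "V \<in> P1" "W \<in> P1" | "V \<in> P2" "W \<in> P2" | "V \<in> P1" "W \<in> P2" | "V \<in> P2" "W \<in> P1"
          using * by blast
        then show ?thesis
        proof cases
          case 1 then show ?thesis using D1(5) * by blast
        next
          case 2 then show ?thesis using D2(5) * by blast
        next
          case 3 then show ?thesis using l[OF 3(1) *(5)] r[OF 3(2) *(4)] * by linarith
        next
          case 4 then show ?thesis using r[OF 4(1) *(3)] l[OF 4(2) *(6)] * by linarith
        qed
      qed
    qed
    then show ?thesis using D1(1) D2(1) by blast
  qed
  have gf: "fst (?f P) \<union> snd (?f P) = P" if "P \<in> ?B" for P
    using that by auto
  have fg: "?f (P1 \<union> P2) = (P1, P2)" if "P1 \<in> nc_on {a<..k}" "P2 \<in> nc_on {k<..b}" for P1 P2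
  proof -
    note D1 = nc_onD[OF that(1)] and D2 = nc_onD[OF that(2)]
    have "\<not> W \<subseteq> {k<..b}" if W: "W \<in> P1" for W
    proof -
      obtain u where "u \<in> W" using D1(2) W by (metis equals0I)
      then show ?thesis using D1(1)[OF W] by fastforce
    qed
    moreover have "\<not> W \<subseteq> {a<..k}" if W: "W \<in> P2" for W
    proof -
      obtain u where "u \<in> W" using D2(2) W by (metis equals0I)
      then show ?thesis using D2(1)[OF W] by fastforce
    qed
    ultimately show ?thesis using D1(1) D2(1) by blast
  qed
  have card: "card (P1 \<union> P2) = card P1 + card P2"
    if "P1 \<in> nc_on {a<..k}" "P2 \<in> nc_on {k<..b}" for P1 P2
  proof (rule card_Un_disjoint)
    show "finite P1" "finite P2" using that finite_nc_on_element by blast+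
    note D1 = nc_onD[OF that(1)] and D2 = nc_onD[OF that(2)]
    show "P1 \<inter> P2 = {}"
    proof (rule ccontr)
      assume "P1 \<inter> P2 \<noteq> {}"
      then obtain W where W: "W \<in> P1" "W \<in> P2" by blast
      obtain u where "u \<in> W" using D1(2) W(1) by (metis equals0I)
      then show False using D1(1)[OF W(1)] D2(1)[OF W(2)] by fastforce
    qed
  qed
  have card': "p ^ card (fst (?f P)) * p ^ card (snd (?f P)) = p ^ card P" if "P \<in> ?B" for P
    using f[OF that] card[of "fst (?f P)" "snd (?f P)"] gf[OF that]
    by (simp only: mem_Times_iff power_add[symmetric])
  have fg': "?f (fst Q \<union> snd Q) = Q" if "fst Q \<in> nc_on {a<..k} \<and> snd Q \<in> nc_on {k<..b}" for Q
    using fg[of "fst Q" "snd Q"] that by (simp only: prod.collapse)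
  have "(\<Sum>P\<in>?B. p ^ card P) =
      (\<Sum>Q\<in>nc_on {a<..k} \<times> nc_on {k<..b}. p ^ card (fst Q) * p ^ card (snd Q))"
  proof (rule sum.reindex_bij_witness[where i = "\<lambda>Q. fst Q \<union> snd Q" and j = ?f])
    fix P assume P: "P \<in> ?B"
    show "fst (?f P) \<union> snd (?f P) = P" by (rule gf[OF P])
    show "?f P \<in> nc_on {a<..k} \<times> nc_on {k<..b}" by (rule f[OF P])
    show "p ^ card (fst (?f P)) * p ^ card (snd (?f P)) = p ^ card P" by (rule card'[OF P])
  next
    fix Q assume Q: "Q \<in> nc_on {a<..k} \<times> nc_on {k<..b}"
    show "fst Q \<union> snd Q \<in> ?B" using g[of "fst Q" "snd Q"] Q unfolding mem_Times_iff by blast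
    show "?f (fst Q \<union> snd Q) = Q" using Q unfolding mem_Times_iff by (rule fg')
  qed
  also have "\<dots> = nc_weight p a k * nc_weight p k b"
    by (simp add: nc_weight_def sum_product sum.cartesian_product case_prod_unfold)
  finally show ?thesis .
qed

text \<open>Removing the singleton at the last point lowers the number of blocks by one and cannot
  affect crossings.\<close>

lemma nc_weight_last_singleton:
  assumes "a \<le> b"
  shows "(\<Sum>P | P \<in> nc_on {a<..Suc b} \<and> {Suc b} \<in> P. p ^ card P) = p * nc_weight p a b"
proof -
  let ?N = "Suc b"
  have 1: "P - {{?N}} \<in> nc_on {a<..b}" if P: "P \<in> nc_on {a<..?N}" and N: "{?N} \<in> P" for P
  proof (rule nc_onI)
    note D = nc_onD[OF P]
    have "W \<inter> {?N} = {}" if "W \<in> P - {{?N}}" for W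
      using D(4)[of W "{?N}" ?N] that N by blast
    then have "\<Union>(P - {{?N}}) = \<Union>P - {?N}" using N by auto
    then show "\<Union>(P - {{?N}}) = {a<..b}" using D(3) by auto
    show "{} \<notin> P - {{?N}}" using D(2) by blast
    show "V = W" if "V \<in> P - {{?N}}" "W \<in> P - {{?N}}" "u \<in> V" "u \<in> W" for V W u
      using D(4) that by blast
    show "V = W" if "V \<in> P - {{?N}}" "W \<in> P - {{?N}}" "c \<in> V" "d \<in> W" "e \<in> V" "f \<in> W"
      "c < d" "d < e" "e < f" for V W c d e f
      using D(5)[of V W c d e f] that by blast
  qed
  have N: "{?N} \<notin> Q" if "Q \<in> nc_on {a<..b}" for Q
    using nc_onD(1)[OF that, of "{?N}"] by auto
  have 2: "insert {?N} Q \<in> nc_on {a<..?N}" if Q: "Q \<in> nc_on {a<..b}" for Q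
  proof (rule nc_onI)
    note D = nc_onD[OF Q]
    show "\<Union>(insert {?N} Q) = {a<..?N}" using D(3) assms by auto
    show "{} \<notin> insert {?N} Q" using D(2) by blast
    have le: "u \<le> b" if "V \<in> Q" "u \<in> V" for u V using D(1) that by fastforce
    show "V = W" if "V \<in> insert {?N} Q" "W \<in> insert {?N} Q" "u \<in> V" "u \<in> W" for V W u
      using D(4)[of V W u] le[of V u] le[of W u] that by auto
    show "V = W" if *: "V \<in> insert {?N} Q" "W \<in> insert {?N} Q" "c \<in> V" "d \<in> W" "e \<in> V" "f \<in> W"
      "c < d" "d < e" "e < f" for V W c d e f
    proof -
      have "f \<le> ?N" using *(2,6) le[of W f] by auto
      then have "V \<noteq> {?N}" "W \<noteq> {?N}" using * by auto
      then show ?thesis using D(5)[of V W c d e f] * by blast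
    qed
  qed
  have card: "card (insert {?N} Q) = Suc (card Q)" if "Q \<in> nc_on {a<..b}" for Q
    using N[OF that] finite_nc_on_element[OF that] by simp
  have "(\<Sum>P | P \<in> nc_on {a<..?N} \<and> {?N} \<in> P. p ^ card P) = (\<Sum>Q\<in>nc_on {a<..b}. p * p ^ card Q)"
  proof (rule sum.reindex_bij_witness[where i = "insert {?N}" and j = "\<lambda>P. P - {{?N}}"])
    fix P assume P: "P \<in> {P. P \<in> nc_on {a<..?N} \<and> {?N} \<in> P}"
    show eq: "insert {?N} (P - {{?N}}) = P" using P by auto
    show 3: "P - {{?N}} \<in> nc_on {a<..b}" using P 1 by blast
    show "p * p ^ card (P - {{?N}}) = p ^ card P" using card[OF 3] unfolding eq by simp
  next
    fix Q assume Q: "Q \<in> nc_on {a<..b}"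
    show "insert {?N} Q \<in> {P. P \<in> nc_on {a<..?N} \<and> {?N} \<in> P}" using 2[OF Q] by blast
    show "insert {?N} Q - {{?N}} = Q" using N[OF Q] by simp
  qed
  then show ?thesis by (simp add: nc_weight_def sum_distrib_left)
qed

text \<open>Here \<open>k\<close> is the predecessor of the last point in its block. The arc from
  \<open>k\<close> to the last point forbids every block that straddles the cut at \<open>k\<close>.
  Deleting the last point (\<open>r\<close>) keeps the number of blocks, and attaching it to the
  block of \<open>k\<close> (\<open>e\<close>) is the inverse map, so the count reduces to
  \<open>nc_weight_split\<close>.\<close>

lemma nc_weight_last_linked:
  assumes k: "k \<in> {a<..b}"
  shows "(\<Sum>P | P \<in> nc_on {a<..Suc b} \<and> (\<exists>V\<in>P. Suc b \<in> V \<and> k \<in> V \<and> V \<inter> {k<..b} = {}). p ^ card P) =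
    nc_weight p a k * nc_weight p k b"
proof -
  let ?N = "Suc b"
  let ?A = "{P. P \<in> nc_on {a<..?N} \<and> (\<exists>V\<in>P. ?N \<in> V \<and> k \<in> V \<and> V \<inter> {k<..b} = {})}"
  let ?B = "{P. P \<in> nc_on {a<..b} \<and> (\<forall>W\<in>P. W \<subseteq> {a<..k} \<or> W \<subseteq> {k<..b})}"
  define r where "r = (\<lambda>W::nat set. W - {?N})"
  define e where "e = (\<lambda>W::nat set. if k \<in> W then insert ?N W else W)"
  have r: "r ` P \<in> ?B \<and> e ` r ` P = P \<and> inj_on r P" if P: "P \<in> ?A" for P
  proof -
    have P': "P \<in> nc_on {a<..?N}" using P by blast
    note D = nc_onD[OF P']
    obtain V where V: "V \<in> P" "?N \<in> V" "k \<in> V" "V \<inter> {k<..b} = {}" using P by blast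
    have N: "?N \<in> W \<longleftrightarrow> k \<in> W" if "W \<in> P" for W using D(4)[OF V(1) that] V(2,3) by blast
    have er: "e (r W) = W" if "W \<in> P" for W
      using N[OF that] k by (auto simp: e_def r_def)
    then have inj: "inj_on r P" by (metis inj_onI)
    have sub: "r W \<subseteq> {a<..k} \<or> r W \<subseteq> {k<..b}" if W: "W \<in> P" for W
    proof (cases "W = V")
      case True
      have "u \<le> k" if "u \<in> V" "u \<noteq> ?N" for u
      proof (rule ccontr)
        assume "\<not> u \<le> k"
        moreover have "u \<in> {a<..?N}" using D(1)[OF V(1)] that by blast
        ultimately have "u \<in> {k<..b}" using that by auto
        then show False using V(4) that by blast
      qed
      then have "r W \<subseteq> {a<..k}" using D(1)[OF W] True by (fastforce simp: r_def)
      then show ?thesis by blast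
    next
      case False
      have "?N \<notin> W" using D(4)[OF V(1) W V(2)] False by blast
      then have "u \<in> {a<..b}" if "u \<in> W" for u
        using D(1)[OF W] that by (cases "u = ?N") auto
      then have W0: "W \<subseteq> {a<..b}" by blast
      then have rW: "r W = W" by (auto simp: r_def)
      show ?thesis
      proof (rule ccontr)
        assume "\<not> ?thesis"
        then obtain u v where "u \<in> W" "u \<notin> {a<..k}" "v \<in> W" "v \<notin> {k<..b}"
          unfolding rW by blast
        then have u: "u \<in> W" "u > k" "v \<in> W" "v \<le> k" "u \<le> b" using W0 by auto
        moreover have "v \<noteq> k" using D(4)[OF V(1) W] V(3) u False by blast
        \<comment> \<open>Otherwise v < k < u < Suc b would interleave \<open>W\<close> with
          \<open>V\<close>.\<close>
        ultimately have "W = V"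
          using D(5)[OF W V(1) u(3) V(3) u(1) V(2)] by simp
        then show False using False by simp
      qed
    qed
    have "r ` P \<in> nc_on {a<..b}"
    proof (rule nc_onI)
      show "\<Union>(r ` P) = {a<..b}" using D(3) by (auto simp: r_def)
      show "{} \<notin> r ` P"
      proof
        assume "{} \<in> r ` P"
        then obtain W where W: "W \<in> P" "r W = {}" by auto
        then have "W = {}" using er[OF W(1)] by (simp add: e_def)
        then show False using D(2) W by blast
      qed
      show "V = W" if "V \<in> r ` P" "W \<in> r ` P" "u \<in> V" "u \<in> W" for V W u
        using that D(4) unfolding r_def by blast
      show "V = W" if *: "V \<in> r ` P" "W \<in> r ` P" "c \<in> V" "d \<in> W" "e \<in> V" "f \<in> W"
        "c < d" "d < e" "e < f" for V W c d e f
      proof -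
        obtain V' W' where "V' \<in> P" "V = r V'" "W' \<in> P" "W = r W'" using *(1,2) by blast
        then show ?thesis using D(5)[of V' W' c d e f] * unfolding r_def by blast
      qed
    qed
    then show ?thesis using sub er inj by (auto simp: image_image)
  qed
  have e: "e ` Q \<in> ?A \<and> r ` e ` Q = Q" if Q: "Q \<in> ?B" for Q
  proof -
    have Q': "Q \<in> nc_on {a<..b}" using Q by blast
    note D = nc_onD[OF Q']
    have re: "r (e W) = W" if "W \<in> Q" for W
      using D(1)[OF that] by (auto simp: e_def r_def)
    obtain V where V: "V \<in> Q" "k \<in> V" using D(3) k by blast
    have V': "V \<subseteq> {a<..k}" using Q V by fastforce
    have eW: "e W = W" if "W \<in> Q" "W \<noteq> V" for W
      using D(4)[OF V(1) that(1)] V(2) that by (auto simp: e_def)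
    have eV: "e V = insert ?N V" using V by (simp add: e_def)
    have le: "u \<le> b" if "u \<in> W" "W \<in> Q" for u W using D(1)[OF that(2)] that by fastforce
    have eN: "W = V" if W: "W \<in> Q" "?N \<in> e W" for W
    proof (rule ccontr)
      assume "W \<noteq> V"
      then have "?N \<in> W" using eW[OF W(1)] W(2) by simp
      then show False using le[of ?N W] W(1) by simp
    qed
    have "e ` Q \<in> nc_on {a<..?N}"
    proof (rule nc_onI)
      have "\<Union>(e ` Q) = insert ?N (\<Union>Q)" using V by (auto simp: e_def split: if_splits)
      then show "\<Union>(e ` Q) = {a<..?N}" using D(3) k by auto
      show "{} \<notin> e ` Q" using D(2) by (auto simp: e_def split: if_splits)
      show "V1 = W1" if *: "V1 \<in> e ` Q" "W1 \<in> e ` Q" "u \<in> V1" "u \<in> W1" for V1 W1 u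
      proof -
        obtain V' W' where VW: "V' \<in> Q" "V1 = e V'" "W' \<in> Q" "W1 = e W'" using *(1,2) by blast
        show ?thesis
        proof (cases "u = ?N")
          case True
          then have "V' = V" "W' = V" using VW * eN by auto
          then show ?thesis using VW by simp
        next
          case False
          then have "u \<in> V'" "u \<in> W'" using VW * by (auto simp: e_def split: if_splits)
          then show ?thesis using D(4) VW by blast
        qed
      qed
      show "V1 = W1" if *: "V1 \<in> e ` Q" "W1 \<in> e ` Q" "c \<in> V1" "d \<in> W1" "g \<in> V1" "f \<in> W1"
        "c < d" "d < g" "g < f" for V1 W1 c d g f
      proof -
        obtain V' W' where VW: "V' \<in> Q" "V1 = e V'" "W' \<in> Q" "W1 = e W'" using *(1,2) by blast
        have "f \<le> ?N" using VW(3) * le[of f W'] unfolding VW(4) by (auto simp: e_def split: if_splits)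
        then have ne: "c \<noteq> ?N" "d \<noteq> ?N" "g \<noteq> ?N" using * by auto
        then have in': "c \<in> V'" "d \<in> W'" "g \<in> V'" using VW * by (auto simp: e_def split: if_splits)
        show ?thesis
        proof (cases "f = ?N")
          case False
          then have "f \<in> W'" using VW * by (auto simp: e_def split: if_splits)
          then show ?thesis using D(5)[OF VW(1,3) in'(1,2,3)] * VW by blast
        next
          \<comment> \<open>The new point can end a crossing only as a member of the block of
            \<open>k\<close>. For g < k it is replaced by \<open>k\<close>, which gives a crossing
            inside \<open>Q\<close>; for g = k the two blocks meet; for g > k the block
            \<open>V'\<close> would straddle the cut.\<close>
          case True
          then have W': "W' = V" using VW * eN by auto
          then have "d \<le> k" using V' in' by fastforce
          show ?thesis
          proof (cases "g \<le> k")
            case True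
            show ?thesis
            proof (cases "g = k")
              case True
              then show ?thesis using D(4)[OF VW(1) V(1)] V(2) in' W' VW by blast
            next
              case False
              then show ?thesis using D(5)[OF VW(1,3) in'(1,2,3), of k] * VW V(2) W' True by simp
            qed
          next
            case False
            have "c \<le> k" using * \<open>d \<le> k\<close> by linarith
            have "V' \<subseteq> {a<..k} \<or> V' \<subseteq> {k<..b}" using Q VW by blast
            then show ?thesis using in' False \<open>c \<le> k\<close> by fastforce
          qed
        qed
      qed
    qed
    moreover have "e V \<in> e ` Q" using V(1) by (rule imageI)
    moreover have "?N \<in> e V" "k \<in> e V" "e V \<inter> {k<..b} = {}"
      using V V' unfolding eV by auto
    ultimately show ?thesis using re by (auto simp: image_image)
  qed
  have "(\<Sum>P\<in>?A. p ^ card P) = (\<Sum>Q\<in>?B. p ^ card Q)"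
  proof (rule sum.reindex_bij_witness[where i = "\<lambda>Q. e ` Q" and j = "\<lambda>P. r ` P"])
    fix P assume P: "P \<in> ?A"
    show "e ` r ` P = P" "r ` P \<in> ?B" using r[OF P] by blast+
    show "p ^ card (r ` P) = p ^ card P" using r[OF P] by (simp add: card_image)
  next
    fix Q assume Q: "Q \<in> ?B"
    show "r ` e ` Q = Q" "e ` Q \<in> ?A" using e[OF Q] by blast+
  qed
  also have "\<dots> = nc_weight p a k * nc_weight p k b"
    using k by (intro nc_weight_split) auto
  finally show ?thesis .
qed

text \<open>The partitions are sorted by the predecessor of the last point in its block: either
  there is none, or it is a unique \<open>k\<close>.\<close>

lemma nc_weight_Suc:
  assumes "a \<le> b"
  shows "nc_weight p a (Suc b) = p * nc_weight p a b + (\<Sum>k\<in>{a<..b}. nc_weight p a k * nc_weight p k b)"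
proof -
  let ?N = "Suc b"
  define A where "A = (\<lambda>k. {P. P \<in> nc_on {a<..?N} \<and> (\<exists>V\<in>P. ?N \<in> V \<and> k \<in> V \<and> V \<inter> {k<..b} = {})})"
  define S where "S = {P. P \<in> nc_on {a<..?N} \<and> {?N} \<in> P}"
  have fin: "finite (nc_on {a<..?N})" by (simp add: finite_nc_on)
  then have finS: "finite S" and finA: "finite (A k)" for k by (simp_all add: S_def A_def)
  have "nc_on {a<..?N} \<subseteq> S \<union> (\<Union>k\<in>{a<..b}. A k)"
  proof
    fix P assume P: "P \<in> nc_on {a<..?N}"
    note D = nc_onD[OF P]
    have "?N \<in> \<Union>P" unfolding D(3) using assms by simp
    then obtain V where V: "V \<in> P" "?N \<in> V" by blast
    show "P \<in> S \<union> (\<Union>k\<in>{a<..b}. A k)"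
    proof (cases "V = {?N}")
      case True
      then show ?thesis using P V by (simp add: S_def)
    next
      case False
      define k where "k = Max (V - {?N})"
      have "u \<in> {a<..b}" if "u \<in> V" "u \<noteq> ?N" for u using D(1)[OF V(1)] that by auto
      then have sub: "V - {?N} \<subseteq> {a<..b}" by blast
      then have f: "finite (V - {?N})" using finite_subset by blast
      have ne: "V - {?N} \<noteq> {}" using False V by blast
      have k: "k \<in> V - {?N}" unfolding k_def using f ne by (rule Max_in)
      have "u \<le> k" if "u \<in> V" "u \<noteq> ?N" for u unfolding k_def using f that by (intro Max_ge) auto
      then have "V \<inter> {k<..b} = {}" by fastforce
      then have "P \<in> A k" using V k P by (auto simp: A_def)
      then show ?thesis using k sub by blast
    qed
  qed
  moreover have "S \<subseteq> nc_on {a<..?N}" "A k \<subseteq> nc_on {a<..?N}" for k unfolding S_def A_def by blast+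
  ultimately have eq: "nc_on {a<..?N} = S \<union> (\<Union>k\<in>{a<..b}. A k)" by blast
  have uniq: "V = W" if "P \<in> nc_on {a<..?N}" "V \<in> P" "W \<in> P" "?N \<in> V" "?N \<in> W" for P V W
    using nc_onD(4)[OF that(1)] that by blast
  have disjS: "S \<inter> (\<Union>k\<in>{a<..b}. A k) = {}"
  proof (rule ccontr)
    assume "\<not> ?thesis"
    then obtain k P V where *: "k \<in> {a<..b}" "P \<in> nc_on {a<..?N}" "{?N} \<in> P" "V \<in> P" "?N \<in> V" "k \<in> V"
      unfolding S_def A_def by blast
    then have "V = {?N}" using uniq[OF *(2,4,3)] by simp
    then show False using * by simp
  qed
  have disjA: "A k \<inter> A l = {}" if "k \<in> {a<..b}" "l \<in> {a<..b}" "k \<noteq> l" for k l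
  proof (rule ccontr)
    assume "\<not> ?thesis"
    then obtain P V W where *: "P \<in> nc_on {a<..?N}" "V \<in> P" "?N \<in> V" "k \<in> V" "V \<inter> {k<..b} = {}"
      "W \<in> P" "?N \<in> W" "l \<in> W" "W \<inter> {l<..b} = {}" unfolding A_def by blast
    then have "V = W" using uniq by blast
    then have "l \<notin> {k<..b}" "k \<notin> {l<..b}" using * by blast+
    then show False using that by auto
  qed
  have "nc_weight p a ?N = (\<Sum>P\<in>S. p ^ card P) + (\<Sum>P\<in>(\<Union>k\<in>{a<..b}. A k). p ^ card P)"
    unfolding nc_weight_def eq using finS finA disjS by (intro sum.union_disjoint) auto
  also have "(\<Sum>P\<in>(\<Union>k\<in>{a<..b}. A k). p ^ card P) = (\<Sum>k\<in>{a<..b}. \<Sum>P\<in>A k. p ^ card P)"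
    using finA disjA by (intro sum.UNION_disjoint) auto
  also have "(\<Sum>P\<in>S. p ^ card P) = p * nc_weight p a b"
    unfolding S_def by (rule nc_weight_last_singleton[OF assms])
  also have "(\<Sum>k\<in>{a<..b}. \<Sum>P\<in>A k. p ^ card P) = (\<Sum>k\<in>{a<..b}. nc_weight p a k * nc_weight p k b)"
    unfolding A_def by (intro sum.cong refl nc_weight_last_linked)
  finally show ?thesis .
qed

text \<open>Translation invariance follows from the recursion by strong induction on the length,
  without transporting partitions along the shift.\<close>

lemma nc_weight_shift: "nc_weight p a (a + l) = nc_weight p 0 l"
proof (induction l arbitrary: a rule: less_induct)
  case (less l)
  show ?case
  proof (cases l)
    case 0
    then show ?thesis by (simp add: nc_weight_diag)
  next
    case (Suc m)
    have "nc_weight p a (a + l) = p * nc_weight p a (a + m)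
        + (\<Sum>k\<in>{a<..a+m}. nc_weight p a k * nc_weight p k (a + m))"
      using nc_weight_Suc[of a "a + m" p] Suc by simp
    also have "(\<Sum>k\<in>{a<..a+m}. nc_weight p a k * nc_weight p k (a + m)) =
        (\<Sum>k\<in>{0<..m}. nc_weight p 0 k * nc_weight p 0 (m - k))"
    proof (rule sum.reindex_bij_witness[where i = "\<lambda>k. a + k" and j = "\<lambda>k. k - a"])
      fix k assume k: "k \<in> {a<..a+m}"
      have "nc_weight p a k = nc_weight p 0 (k - a)" using less.IH[of "k - a" a] k Suc by auto
      moreover have "nc_weight p k (a + m) = nc_weight p 0 (m - (k - a))"
        using less.IH[of "a + m - k" k] k Suc by (auto simp: add.commute)
      ultimately show "nc_weight p 0 (k - a) * nc_weight p 0 (m - (k - a)) =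
          nc_weight p a k * nc_weight p k (a + m)" by simp
    qed auto
    also have "\<dots> = (\<Sum>k\<in>{0<..m}. nc_weight p 0 k * nc_weight p k m)"
    proof (rule sum.cong)
      fix k assume "k \<in> {0<..m}"
      then show "nc_weight p 0 k * nc_weight p 0 (m - k) = nc_weight p 0 k * nc_weight p k m"
        using less.IH[of "m - k" k] Suc by simp
    qed simp
    also have "nc_weight p a (a + m) = nc_weight p 0 m" using less.IH[of m] Suc by simp
    finally show ?thesis using nc_weight_Suc[of 0 m p] Suc by simp
  qed
qed

text \<open>The Marchenko--Pastur recursion: in terms of generating functions it is
  \<open>M = 1 + z M\<^sup>2 + (p - 1) z M\<close>.\<close>

lemma nc_weight_recursion:
  "nc_weight p 0 (Suc n) =
     (\<Sum>i\<le>n. nc_weight p 0 i * nc_weight p 0 (n - i)) + (p - 1) * nc_weight p 0 n"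
proof -
  have "(\<Sum>i\<le>n. nc_weight p 0 i * nc_weight p 0 (n - i)) =
      nc_weight p 0 n + (\<Sum>i\<in>{0<..n}. nc_weight p 0 i * nc_weight p 0 (n - i))"
  proof -
    have "{..n} = insert 0 {0<..n}" by auto
    then show ?thesis by (simp add: nc_weight_diag)
  qed
  also have "(\<Sum>i\<in>{0<..n}. nc_weight p 0 i * nc_weight p 0 (n - i)) =
      (\<Sum>i\<in>{0<..n}. nc_weight p 0 i * nc_weight p i n)"
    by (rule sum.cong) (use nc_weight_shift[of p _ "n - _"] in \<open>auto, metis le_add_diff_inverse\<close>)
  finally show ?thesis using nc_weight_Suc[of 0 n p] by (simp add: algebra_simps)
qed

text \<open>Each block contributes one factor p in the moment-cumulant formula. Index 0 is separate
  because that formula starts at 1.\<close>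

lemma moments_of_constant_free_cumulants:
  assumes "m 0 = 1" and c: "\<And>n. n \<ge> 1 \<Longrightarrow> free_cumulants m n = of_real p"
  shows "m n = of_real (nc_weight p 0 n)"
proof (cases "n = 0")
  case True
  then show ?thesis using assms by (simp add: nc_weight_diag)
next
  case False
  have NC: "NC n = nc_on {0<..n}"
    by (simp add: NC_def nc_on_def atLeastSucAtMost_greaterThanAtMost[symmetric])
  have "m n = (\<Sum>P\<in>NC n. \<Prod>V\<in>P. free_cumulants m (card V))"
    using False by (intro moment_cumulant_formula) simp
  also have "\<dots> = (\<Sum>P\<in>nc_on {0<..n}. of_real (p ^ card P))"
    unfolding NC
  proof (rule sum.cong[OF refl])
    fix P assume P: "P \<in> nc_on {0<..n}"
    \<comment> \<open>Blocks are nonempty, so only cumulants of index at least 1 occur, where they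
      are known to be p.\<close>
    have "card V \<ge> 1" if "V \<in> P" for V
    proof -
      have "finite V" using nc_onD(1)[OF P that] finite_subset by blast
      moreover have "V \<noteq> {}" using nc_onD(2)[OF P] that by blast
      ultimately show ?thesis by (simp add: Suc_le_eq card_gt_0_iff)
    qed
    then have "(\<Prod>V\<in>P. free_cumulants m (card V)) = (\<Prod>V\<in>P. of_real p)"
      using c by (intro prod.cong) auto
    then show "(\<Prod>V\<in>P. free_cumulants m (card V)) = of_real (p ^ card P)" by simp
  qed
  finally show ?thesis by (simp add: nc_weight_def)
qed

section \<open>Neumann series in Banach algebras\<close>

definition neumann :: "'m::{real_normed_algebra_1,banach} \<Rightarrow> 'm" where
  "neumann a = (\<Sum>n. a ^ n)"

lemma neumann_sums:
  fixes a :: "'m::{real_normed_algebra_1,banach}"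
  assumes "norm a < 1"
  shows "(\<lambda>n. a ^ n) sums neumann a"
  using complete_algebra_summable_geometric[OF assms] by (simp add: neumann_def summable_sums)

lemma neumann_unfold_left:
  fixes a :: "'m::{real_normed_algebra_1,banach}"
  assumes "norm a < 1"
  shows "neumann a = 1 + a * neumann a"
proof -
  have "(\<lambda>n. a * a ^ n) sums (a * neumann a)"
    using neumann_sums[OF assms] by (rule sums_mult)
  then have "(\<lambda>n. a ^ n) sums (a * neumann a + a ^ 0)"
    by (intro sums_Suc) simp
  then show ?thesis using neumann_sums[OF assms] sums_unique2 by (fastforce simp: add.commute)
qed

lemma neumann_commute:
  fixes a b :: "'m::{real_normed_algebra_1,banach}"
  assumes "norm a < 1" "a * b = b * a"
  shows "neumann a * b = b * neumann a"
proof -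
  have "(\<lambda>n. a ^ n * b) sums (neumann a * b)" "(\<lambda>n. b * a ^ n) sums (b * neumann a)"
    using neumann_sums[OF assms(1)] by (auto intro: sums_mult sums_mult2)
  moreover have "a ^ n * b = b * a ^ n" for n
    using assms(2) by (induction n) (simp_all add: mult.assoc, metis mult.assoc)
  ultimately show ?thesis using sums_unique2 by fastforce
qed

lemma neumann_unfold_right:
  fixes a :: "'m::{real_normed_algebra_1,banach}"
  assumes "norm a < 1"
  shows "neumann a = 1 + neumann a * a"
  using neumann_unfold_left[OF assms] neumann_commute[OF assms refl] by simp

lemma neumann_inverse:
  fixes a :: "'m::{real_normed_algebra_1,banach}"
  assumes "norm a < 1"
  shows "(1 - a) * neumann a = 1" "neumann a * (1 - a) = 1"
  using neumann_unfold_left[OF assms] neumann_unfold_right[OF assms]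
  by (simp_all add: algebra_simps)

lemma norm_neumann_diff_one_le:
  fixes a :: "'m::{real_normed_algebra_1,banach}"
  assumes "norm a \<le> 1/2"
  shows "norm (neumann a - 1) \<le> 2 * norm a"
proof -
  have eq: "neumann a - 1 = a + a * (neumann a - 1)"
    using neumann_unfold_left[of a] assms by (simp add: algebra_simps)
  have "norm (neumann a - 1) \<le> norm a + norm (a * (neumann a - 1))"
    by (subst eq) (rule norm_triangle_ineq)
  \<comment> \<open>This half is absorbed on the left-hand side, which produces the factor
    2.\<close>
  also have "norm (a * (neumann a - 1)) \<le> 1/2 * norm (neumann a - 1)"
    by (rule order_trans[OF norm_mult_ineq mult_right_mono]) (use assms in auto)
  finally show ?thesis by simp
qed

section \<open>Geometric series along filters and resolvents near infinity\<close>

lemma eventually_norm_less: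
  fixes f :: "'i \<Rightarrow> 'm::real_normed_vector"
  assumes "(f \<longlongrightarrow> 0) F" "0 < e"
  shows "\<forall>\<^sub>F i in F. norm (f i) < e"
  using tendstoD[OF assms] by simp

lemma tendsto_neumann:
  fixes f :: "'i \<Rightarrow> 'm::{real_normed_algebra_1,banach}"
  assumes "(f \<longlongrightarrow> 0) F"
  shows "((\<lambda>i. neumann (f i)) \<longlongrightarrow> 1) F"
proof -
  have "((\<lambda>i. neumann (f i) - 1) \<longlongrightarrow> 0) F"
  proof (rule Lim_null_comparison)
    show "((\<lambda>i. 2 * norm (f i)) \<longlongrightarrow> 0) F" using assms by (auto intro!: tendsto_eq_intros)
    have "\<forall>\<^sub>F i in F. norm (f i) < 1/2" by (rule eventually_norm_less[OF assms]) simp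
    then show "\<forall>\<^sub>F i in F. norm (neumann (f i) - 1) \<le> 2 * norm (f i)"
      by eventually_elim (simp add: norm_neumann_diff_one_le)
  qed
  then show ?thesis by (simp add: LIM_zero_iff)
qed

lemma neumann_in_closed_subalgebra:
  fixes a :: "'m::{real_normed_algebra_1,banach}"
  assumes "norm a < 1" "closed S" "1 \<in> S" "\<And>u v. u \<in> S \<Longrightarrow> v \<in> S \<Longrightarrow> u + v \<in> S"
    "\<And>u v. u \<in> S \<Longrightarrow> v \<in> S \<Longrightarrow> u * v \<in> S" "a \<in> S"
  shows "neumann a \<in> S"
proof -
  have pow: "a ^ n \<in> S" for n using assms by (induction n) auto
  \<comment> \<open>The partial sums have at least one term, since \<open>S\<close> is only known to
    contain 1, not 0.\<close>
  have part: "(\<Sum>k<Suc n. a ^ k) \<in> S" for n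
  proof (induction n)
    case (Suc n)
    then show ?case using assms(4)[OF Suc pow[of "Suc n"]] by simp
  qed (use assms in simp)
  have "(\<lambda>n. \<Sum>k<Suc n. a ^ k) \<longlonglongrightarrow> neumann a"
    using neumann_sums[OF assms(1)] unfolding sums_def by (rule LIMSEQ_Suc)
  then show ?thesis by (rule closed_sequentially[OF assms(2) part])
qed

lemma right_inverse_eq_left_inverse:
  fixes a b c :: "'m::monoid_mult"
  assumes "b * a = 1" "a * c = 1"
  shows "b = c"
  by (metis assms mult.assoc mult_1_left mult_1_right)

text \<open>Expansion at infinity: w - a = w (1 - b a) with b the inverse of w. In the applications
  w is a large scalar matrix, hence b is small.\<close>

lemma neumann_resolvent:
  fixes a b w :: "'m::{real_normed_algebra_1,banach}"
  assumes "b * w = 1" "w * b = 1" "norm (b * a) < 1"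
  shows "neumann (b * a) * b * (w - a) = 1" "(w - a) * (neumann (b * a) * b) = 1"
proof -
  note inv = neumann_inverse[OF assms(3)]
  have "neumann (b * a) * b * (w - a) = neumann (b * a) * (b * w - b * a)"
    by (simp add: algebra_simps)
  then show "neumann (b * a) * b * (w - a) = 1" using inv assms(1) by simp
  have "w - a = w * (1 - b * a)"
    using assms(2) by (simp add: right_diff_distrib mult.assoc[symmetric])
  then have "(w - a) * (neumann (b * a) * b) = w * ((1 - b * a) * neumann (b * a)) * b"
    by (simp only: mult.assoc)
  then show "(w - a) * (neumann (b * a) * b) = 1" using inv assms(2) by simp
qed

section \<open>The Banach algebra of square matrices\<close>

text \<open>Square matrices get a type of their own because the product of nested vectors is
  componentwise. Here \<open>*\<close> is \<open>**\<close>, so that matrices form a Banach algebra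
  and geometric series apply to them.\<close>

typedef (overloaded) ('a, 'n) sqmat = "UNIV :: ('a^'n::finite^'n) set"
  morphisms mat_of of_mat
  by simp

setup_lifting type_definition_sqmat

lemma mat_of_of_mat [simp]: "mat_of (of_mat A) = A"
  by (simp add: of_mat_inverse)

instantiation sqmat :: (ring_1, finite) ring_1
begin

lift_definition zero_sqmat :: "('a, 'b) sqmat" is 0 .
lift_definition one_sqmat :: "('a, 'b) sqmat" is "mat 1" .
lift_definition plus_sqmat :: "('a, 'b) sqmat \<Rightarrow> ('a, 'b) sqmat \<Rightarrow> ('a, 'b) sqmat" is "(+)" .
lift_definition minus_sqmat :: "('a, 'b) sqmat \<Rightarrow> ('a, 'b) sqmat \<Rightarrow> ('a, 'b) sqmat" is "(-)" .
lift_definition uminus_sqmat :: "('a, 'b) sqmat \<Rightarrow> ('a, 'b) sqmat" is "uminus" .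
lift_definition times_sqmat :: "('a, 'b) sqmat \<Rightarrow> ('a, 'b) sqmat \<Rightarrow> ('a, 'b) sqmat" is "(**)" .

instance
proof
  show "(0::('a, 'b) sqmat) \<noteq> 1"
    by transfer (simp add: vec_eq_iff mat_def)
next
  fix a b c :: "('a, 'b) sqmat"
  show "a * b * c = a * (b * c)" by transfer (simp add: matrix_mul_assoc)
  show "(a + b) * c = a * c + b * c"
    by transfer (simp add: vec_eq_iff matrix_matrix_mult_def distrib_right sum.distrib)
  show "a * (b + c) = a * b + a * c" by transfer (simp add: matrix_add_ldistrib)
qed (transfer; simp)+

end

instantiation sqmat :: (real_normed_algebra_1, finite) real_normed_algebra_1
begin

lift_definition scaleR_sqmat :: "real \<Rightarrow> ('a, 'b) sqmat \<Rightarrow> ('a, 'b) sqmat" is "(*\<^sub>R)" .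

text \<open>Maximal row sum: it is submultiplicative, gives the identity norm 1 and bounds every
  entry. Completeness and smallness are all that is read off from it.\<close>

lift_definition norm_sqmat :: "('a, 'b) sqmat \<Rightarrow> real" is
  "\<lambda>A. Max (range (\<lambda>i. \<Sum>j\<in>UNIV. norm (A $ i $ j)))" .

definition dist_sqmat :: "('a, 'b) sqmat \<Rightarrow> ('a, 'b) sqmat \<Rightarrow> real" where
  "dist_sqmat a b = norm (a - b)"

definition sgn_sqmat :: "('a, 'b) sqmat \<Rightarrow> ('a, 'b) sqmat" where
  "sgn_sqmat a = scaleR (inverse (norm a)) a"

definition uniformity_sqmat :: "(('a, 'b) sqmat \<times> ('a, 'b) sqmat) filter" where
  "uniformity_sqmat = (INF e\<in>{0<..}. principal {(x, y). dist x y < e})"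

definition open_sqmat :: "('a, 'b) sqmat set \<Rightarrow> bool" where
  "open_sqmat S = (\<forall>x\<in>S. \<forall>\<^sub>F (x', y) in uniformity. x' = x \<longrightarrow> y \<in> S)"

instance
proof
  fix a b c :: "('a, 'b) sqmat" and r s :: real
  show "dist a b = norm (a - b)" by (rule dist_sqmat_def)
  show "sgn a = inverse (norm a) *\<^sub>R a" by (rule sgn_sqmat_def)
  show "r *\<^sub>R (a + b) = r *\<^sub>R a + r *\<^sub>R b" by transfer (rule scaleR_add_right)
  show "(r + s) *\<^sub>R a = r *\<^sub>R a + s *\<^sub>R a" by transfer (rule scaleR_add_left)
  show "r *\<^sub>R s *\<^sub>R a = (r * s) *\<^sub>R a" by transfer simp
  show "1 *\<^sub>R a = a" by transfer simp
  show "r *\<^sub>R a * b = r *\<^sub>R (a * b)"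
    by transfer (simp add: vec_eq_iff matrix_matrix_mult_def scaleR_sum_right)
  show "a * r *\<^sub>R b = r *\<^sub>R (a * b)"
    by transfer (simp add: vec_eq_iff matrix_matrix_mult_def scaleR_sum_right)
  have le: "(\<Sum>j\<in>UNIV. norm (mat_of a $ i $ j)) \<le> norm a" for a :: "('a, 'b) sqmat" and i
    by transfer (rule Max_ge; simp)
  have leI: "norm a \<le> r" if "\<And>i. (\<Sum>j\<in>UNIV. norm (mat_of a $ i $ j)) \<le> r"
    for a :: "('a, 'b) sqmat" and r using that by transfer auto
  have nonneg: "norm a \<ge> 0" for a :: "('a, 'b) sqmat"
    using order_trans[OF _ le] by (meson norm_ge_zero sum_nonneg)
  have entry: "norm (mat_of a $ i $ j) \<le> norm a" for a :: "('a, 'b) sqmat" and i j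
    by (rule order_trans[OF member_le_sum le[of a i]]) auto
  show "norm a = 0 \<longleftrightarrow> a = 0"
  proof
    assume "norm a = 0"
    then have "mat_of a $ i $ j = 0" for i j using entry[of a i j] by simp
    then show "a = 0" by (metis mat_of_inject vec_eq_iff zero_index zero_sqmat.rep_eq)
  next
    assume "a = 0"
    then have "norm a \<le> 0" by (intro leI) (simp add: zero_sqmat.rep_eq)
    then show "norm a = 0" using nonneg[of a] by simp
  qed
  show "norm (a + b) \<le> norm a + norm b"
  proof (rule leI)
    fix i
    have "(\<Sum>j\<in>UNIV. norm (mat_of (a + b) $ i $ j)) \<le>
        (\<Sum>j\<in>UNIV. norm (mat_of a $ i $ j) + norm (mat_of b $ i $ j))"
      by (rule sum_mono) (simp add: plus_sqmat.rep_eq norm_triangle_ineq)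
    also have "\<dots> \<le> norm a + norm b" using add_mono[OF le le] by (simp add: sum.distrib)
    finally show "(\<Sum>j\<in>UNIV. norm (mat_of (a + b) $ i $ j)) \<le> norm a + norm b" .
  qed
  show "norm (r *\<^sub>R a) = \<bar>r\<bar> * norm a"
  proof (rule antisym)
    have scale_le: "norm (r *\<^sub>R a) \<le> \<bar>r\<bar> * norm a" for r and a :: "('a, 'b) sqmat"
      by (rule leI) (simp add: scaleR_sqmat.rep_eq sum_distrib_left[symmetric] mult_left_mono le)
    show "norm (r *\<^sub>R a) \<le> \<bar>r\<bar> * norm a" by (rule scale_le)
    show "\<bar>r\<bar> * norm a \<le> norm (r *\<^sub>R a)"
    proof (cases "r = 0")
      case False
      have "inverse r *\<^sub>R r *\<^sub>R a = a" using False by transfer simp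
      then have "norm a \<le> \<bar>inverse r\<bar> * norm (r *\<^sub>R a)" using scale_le[of "inverse r" "r *\<^sub>R a"] by simp
      then show ?thesis using False by (simp add: field_simps)
    qed (simp add: nonneg)
  qed
  show "norm (a * b) \<le> norm a * norm b"
  proof (rule leI)
    fix i
    have "(\<Sum>j\<in>UNIV. norm (mat_of (a * b) $ i $ j)) \<le>
        (\<Sum>j\<in>UNIV. \<Sum>k\<in>UNIV. norm (mat_of a $ i $ k) * norm (mat_of b $ k $ j))"
      unfolding times_sqmat.rep_eq matrix_matrix_mult_def
      by (intro sum_mono) (simp add: sum_norm_le norm_mult_ineq)
    also have "\<dots> = (\<Sum>k\<in>UNIV. norm (mat_of a $ i $ k) * (\<Sum>j\<in>UNIV. norm (mat_of b $ k $ j)))"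
      by (subst sum.swap) (simp add: sum_distrib_left)
    also have "\<dots> \<le> (\<Sum>k\<in>UNIV. norm (mat_of a $ i $ k) * norm b)"
      by (intro sum_mono mult_left_mono le) simp
    also have "\<dots> \<le> norm a * norm b"
      using mult_right_mono[OF le nonneg] by (simp add: sum_distrib_right[symmetric])
    finally show "(\<Sum>j\<in>UNIV. norm (mat_of (a * b) $ i $ j)) \<le> norm a * norm b" .
  qed
  show "norm (1::('a, 'b) sqmat) = 1"
  proof -
    have "(\<Sum>j\<in>UNIV. norm ((mat 1 :: 'a^'b^'b) $ i $ j)) = 1" for i
      by (simp add: mat_def if_distrib[of norm] cong: if_cong)
    then show ?thesis by transfer simp
  qed
  show "(uniformity :: (('a, 'b) sqmat \<times> ('a, 'b) sqmat) filter) =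
      (INF e\<in>{0<..}. principal {(x, y). dist x y < e})"
    by (rule uniformity_sqmat_def)
  show "open U = (\<forall>x\<in>U. \<forall>\<^sub>F (x', y) in uniformity. x' = x \<longrightarrow> y \<in> U)" for U :: "('a, 'b) sqmat set"
    by (rule open_sqmat_def)
qed

end

section \<open>Entrywise convergence and completeness of the matrix algebra\<close>

lemma norm_sqmat_le:
  assumes "\<And>i. (\<Sum>j\<in>UNIV. norm (mat_of a $ i $ j)) \<le> r"
  shows "norm a \<le> r"
  using assms by transfer auto

lemma norm_entry_le: "norm (mat_of a $ i $ j) \<le> norm a"
proof -
  have "norm (mat_of a $ i $ j) \<le> (\<Sum>j\<in>UNIV. norm (mat_of a $ i $ j))"
    by (rule member_le_sum) auto
  also have "\<dots> \<le> norm a" by transfer (rule Max_ge; simp)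
  finally show ?thesis .
qed

lemma bounded_linear_entry: "bounded_linear (\<lambda>a. mat_of a $ i $ j)"
  by (rule bounded_linear_intro[where K = 1])
    (simp_all add: plus_sqmat.rep_eq scaleR_sqmat.rep_eq norm_entry_le)

lemmas tendsto_entry = bounded_linear.tendsto[OF bounded_linear_entry]

lemma tendsto_sqmat:
  assumes "\<And>i j. ((\<lambda>x. mat_of (f x) $ i $ j) \<longlongrightarrow> mat_of a $ i $ j) F"
  shows "(f \<longlongrightarrow> a) F"
proof -
  have "((\<lambda>x. f x - a) \<longlongrightarrow> 0) F"
  proof (rule Lim_null_comparison)
    show "((\<lambda>x. \<Sum>i\<in>UNIV. \<Sum>j\<in>UNIV. norm (mat_of (f x) $ i $ j - mat_of a $ i $ j)) \<longlongrightarrow> 0) F"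
      using assms by (intro tendsto_null_sum tendsto_norm_zero LIM_zero) auto
    show "\<forall>\<^sub>F x in F. norm (f x - a) \<le>
        (\<Sum>i\<in>UNIV. \<Sum>j\<in>UNIV. norm (mat_of (f x) $ i $ j - mat_of a $ i $ j))"
    proof (intro always_eventually allI norm_sqmat_le)
      fix x i
      show "(\<Sum>j\<in>UNIV. norm (mat_of (f x - a) $ i $ j)) \<le>
          (\<Sum>i\<in>UNIV. \<Sum>j\<in>UNIV. norm (mat_of (f x) $ i $ j - mat_of a $ i $ j))"
        unfolding minus_sqmat.rep_eq vector_minus_component
        by (rule member_le_sum) (simp_all add: sum_nonneg)
    qed
  qed
  then show ?thesis by (simp add: LIM_zero_iff)
qed

instance sqmat :: ("{real_normed_algebra_1,banach}", finite) banach
proof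
  fix X :: "nat \<Rightarrow> ('a, 'b) sqmat"
  assume X: "Cauchy X"
  have "convergent (\<lambda>n. mat_of (X n) $ i $ j)" for i j
    using bounded_linear.Cauchy[OF bounded_linear_entry X] by (rule Cauchy_convergent)
  then obtain L where L: "\<And>i j. (\<lambda>n. mat_of (X n) $ i $ j) \<longlonglongrightarrow> L i j"
    unfolding convergent_def by metis
  have "X \<longlonglongrightarrow> of_mat (\<chi> i j. L i j)"
    by (rule tendsto_sqmat) (simp add: L)
  then show "convergent X" by (auto simp: convergent_def)
qed

section \<open>Subordination near infinity in a Banach algebra with an expectation\<close>

text \<open>A conditional expectation written as an endomorphism: its fixed points play the role of
  the scalar matrices, and the product rules are the bimodule property over them.\<close>

locale expectation =
  fixes E :: "'m::{real_normed_algebra_1,banach} \<Rightarrow> 'm"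
  assumes bounded_linear_E: "bounded_linear E"
    and E_one: "E 1 = 1"
    and E_mult_left: "E (E a * b) = E a * E b"
    and E_mult_right: "E (a * E b) = E a * E b"
begin

lemma E_idem: "E (E a) = E a"
  using E_mult_left[of a 1] by (simp add: E_one)

lemmas E_linear = bounded_linear.linear[OF bounded_linear_E]

lemma E_simps:
  "E 0 = 0" "E (a + b) = E a + E b" "E (a - b) = E a - E b" "E (- a) = - E a" "E (r *\<^sub>R a) = r *\<^sub>R E a"
  using E_linear by (simp_all add: linear_0 linear_add linear_diff linear_neg linear_scale)

lemma E_fixed_left: "E a = a \<Longrightarrow> E (a * b) = a * E b"
  using E_mult_left[of a b] by simp

lemma E_fixed_right: "E b = b \<Longrightarrow> E (a * b) = E a * b"
  using E_mult_right[of a b] by simp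

text \<open>The fixed points of \<open>E\<close> form a closed unital subalgebra.\<close>

lemma E_fixed_neumann:
  assumes "norm a < 1" "E a = a"
  shows "E (neumann a) = neumann a"
proof -
  have "closed {a. E a = a}"
    using bounded_linear.continuous_on[OF bounded_linear_E continuous_on_id]
    by (intro closed_Collect_eq) (auto intro: continuous_on_id)
  then have "neumann a \<in> {a. E a = a}"
    by (rule neumann_in_closed_subalgebra[OF assms(1)])
      (use assms(2) in \<open>auto simp: E_one E_simps E_fixed_left\<close>)
  then show ?thesis by simp
qed

lemma tendsto_E: "(f \<longlongrightarrow> a) F \<Longrightarrow> ((\<lambda>i. E (f i)) \<longlongrightarrow> E a) F"
  by (rule bounded_linear.tendsto[OF bounded_linear_E])

text \<open>The expectation M of the geometric series is the sum of m n z^n, so the recursion for m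
  gives M = 1 + z M^2 + (p - 1) z M. Thus T = M z solves T = z + T^2 + (p - 1) z T, which is
  \<open>quad\<close> with T for w. Everything involved commutes, and \<open>small\<close> makes the
  solution unique.\<close>

lemma E_neumann_eq_of_quadratic:
  fixes m :: "nat \<Rightarrow> real"
  assumes m: "m 0 = 1" "\<And>n. m (Suc n) = (\<Sum>i\<le>n. m i * m (n - i)) + (p - 1) * m n"
    and mom: "\<And>n. E ((y * z) ^ n) = m n *\<^sub>R z ^ n"
    and yz: "norm (y * z) < 1"
    and comm: "w * z = z * w"
    and quad: "z + (p - 1) *\<^sub>R (z * w) = w - w * w"
    and small: "norm (E (neumann (y * z)) * z) + norm w + \<bar>p - 1\<bar> * norm z < 1"
  shows "E (neumann (y * z)) * z = w"
proof -
  define M where "M = E (neumann (y * z))"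
  define a where "a = (\<lambda>n. m n *\<^sub>R z ^ n)"
  obtain K where K0: "K > 0" and K: "\<And>x. norm (E x) \<le> norm x * K"
    using bounded_linear.pos_bounded[OF bounded_linear_E] by blast
  have M: "a sums M"
    unfolding M_def a_def mom[symmetric]
    by (rule bounded_linear.sums[OF bounded_linear_E neumann_sums[OF yz]])
  \<comment> \<open>The Cauchy product requires absolute convergence. The bound on the terms comes
    from the boundedness of \<open>E\<close> and the powers of \<open>y * z\<close>, not from the
    numbers m n.\<close>
  have summ: "summable (\<lambda>n. norm (a n))"
  proof (rule summable_comparison_test)
    show "summable (\<lambda>n. norm (y * z) ^ n * \<bar>K\<bar>)"
      using yz by (intro summable_mult2 summable_geometric) simp
    have "norm (norm (a n)) \<le> norm (y * z) ^ n * \<bar>K\<bar>" for n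
    proof -
      have "norm (a n) \<le> norm ((y * z) ^ n) * K" unfolding a_def mom[symmetric] by (rule K)
      also have "\<dots> \<le> norm (y * z) ^ n * \<bar>K\<bar>"
        by (rule mult_mono) (use K0 in \<open>auto simp: norm_power_ineq\<close>)
      finally show ?thesis by simp
    qed
    then show "\<exists>N. \<forall>n\<ge>N. norm (norm (a n)) \<le> norm (y * z) ^ n * \<bar>K\<bar>" by blast
  qed
  have MM: "(\<lambda>n. \<Sum>i\<le>n. a i * a (n - i)) sums (M * M)"
    using Cauchy_product_sums[OF summ summ] M by (simp add: sums_unique[symmetric])
  have conv: "(\<Sum>i\<le>n. a i * a (n - i)) = (\<Sum>i\<le>n. m i * m (n - i)) *\<^sub>R z ^ n" for n
    unfolding scaleR_sum_left
    by (rule sum.cong) (auto simp: a_def power_add[symmetric])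
  have shift: "a (Suc n) = z * (\<Sum>i\<le>n. a i * a (n - i)) + (p - 1) *\<^sub>R (z * a n)" for n
    unfolding conv by (simp add: a_def m(2) scaleR_add_left)
  have "(\<lambda>n. a (Suc n)) sums (z * (M * M) + (p - 1) *\<^sub>R (z * M))"
    unfolding shift using MM M by (intro sums_add sums_mult sums_scaleR_right)
  then have "a sums (z * (M * M) + (p - 1) *\<^sub>R (z * M) + a 0)" by (rule sums_Suc)
  with M have "M = z * (M * M) + (p - 1) *\<^sub>R (z * M) + a 0" by (rule sums_unique2)
  moreover have "a 0 = 1" by (simp add: a_def m(1))
  ultimately have Meq: "M = z * (M * M) + (p - 1) *\<^sub>R (z * M) + 1" by simp
  have commM: "M * v = v * M" if "v * z = z * v" for v
  proof -
    have "v * z ^ n = z ^ n * v" for n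
      using that by (induction n) (simp_all, metis mult.assoc)
    then have "a n * v = v * a n" for n by (simp add: a_def)
    moreover have "(\<lambda>n. a n * v) sums (M * v)" "(\<lambda>n. v * a n) sums (v * M)"
      using M by (auto intro: sums_mult sums_mult2)
    ultimately show ?thesis using sums_unique2 by fastforce
  qed
  define T where "T = M * z"
  have T: "T = z + T * T + (p - 1) *\<^sub>R (z * T)"
  proof -
    have "T = (z * (M * M) + (p - 1) *\<^sub>R (z * M) + 1) * z" unfolding T_def using Meq by simp
    also have "\<dots> = z + T * T + (p - 1) *\<^sub>R (z * T)"
      using commM[of z] by (simp add: T_def algebra_simps)
    finally show ?thesis .
  qed
  have "w * T = T * w" unfolding T_def using commM[OF comm] comm by (metis mult.assoc)
  then have "(T - w) - (T - w) * (T + w) = z + (p - 1) *\<^sub>R (z * T) - (z + (p - 1) *\<^sub>R (z * w))"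
    unfolding quad using T by (simp add: algebra_simps)
  moreover have "z * T = T * z" using commM[of z] by (simp add: T_def mult.assoc)
  \<comment> \<open>The difference of the two solutions is itself times T + w + (p - 1) z, a factor
    of norm below 1.\<close>
  ultimately have eq: "T - w = (T - w) * (T + w) + (p - 1) *\<^sub>R ((T - w) * z)"
    using comm by (simp add: algebra_simps)
  let ?q = "norm T + norm w + \<bar>p - 1\<bar> * norm z"
  have "norm (T - w) \<le> norm ((T - w) * (T + w)) + \<bar>p - 1\<bar> * norm ((T - w) * z)"
    by (subst eq) (rule norm_triangle_le, simp)
  also have "\<dots> \<le> norm (T - w) * (norm T + norm w) + \<bar>p - 1\<bar> * (norm (T - w) * norm z)"
    by (intro add_mono mult_left_mono norm_mult_ineq order_trans[OF norm_mult_ineq]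
        norm_triangle_ineq) auto
  also have "\<dots> = norm (T - w) * ?q" by (simp add: algebra_simps)
  finally have le: "norm (T - w) \<le> norm (T - w) * ?q" .
  have "?q < 1" using small by (simp add: T_def M_def)
  then have "norm (T - w) = 0"
    using le mult_strict_left_mono[of ?q 1 "norm (T - w)"] by (cases "norm (T - w) = 0") auto
  then show ?thesis by (simp add: T_def M_def)
qed

text \<open>Injectivity of the Cauchy transform near infinity. The resolvent identity writes the
  difference of the two resolvents as N d N' with d = b - b', and N, N' tend to 1. If its
  expectation vanishes, d is bounded by a small multiple of itself.\<close>

lemma eventually_resolvent_expectation_inj:
  assumes b: "(b \<longlongrightarrow> 0) F" and b': "(b' \<longlongrightarrow> 0) F"
    and fixed: "\<forall>\<^sub>F i in F. E (b i) = b i \<and> E (b' i) = b' i"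
    and eq: "\<forall>\<^sub>F i in F. E (neumann (b i * a) * b i) = E (neumann (b' i * a) * b' i)"
  shows "\<forall>\<^sub>F i in F. b i = b' i"
proof -
  obtain K where K: "K > 0" "\<And>x. norm (E x) \<le> norm x * K"
    using bounded_linear.pos_bounded[OF bounded_linear_E] by blast
  define N where "N = (\<lambda>i. neumann (b i * a))"
  define N' where "N' = (\<lambda>i. neumann (a * b' i))"
  have ba: "((\<lambda>i. b i * a) \<longlongrightarrow> 0) F" "((\<lambda>i. b' i * a) \<longlongrightarrow> 0) F" "((\<lambda>i. a * b' i) \<longlongrightarrow> 0) F"
    using b b' by (auto intro: tendsto_mult_left_zero tendsto_mult_right_zero)
  have N: "(N \<longlongrightarrow> 1) F" "(N' \<longlongrightarrow> 1) F"
    unfolding N_def N'_def using ba by (intro tendsto_neumann; simp)+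
  have "((\<lambda>i. norm (N i - 1) * norm (N' i) + norm (N' i - 1)) \<longlongrightarrow> norm (1 - 1::'m) * norm (1::'m) + norm (1 - 1::'m)) F"
    using N by (intro tendsto_intros)
  then have "((\<lambda>i. norm (N i - 1) * norm (N' i) + norm (N' i - 1)) \<longlongrightarrow> 0) F" by simp
  \<comment> \<open>The threshold 1 / K compensates for the norm bound K of \<open>E\<close> at the
    end of the estimate.\<close>
  then have sm: "\<forall>\<^sub>F i in F. norm (N i - 1) * norm (N' i) + norm (N' i - 1) < 1 / K"
    by (rule order_tendstoD) (use K in simp)
  have s: "\<forall>\<^sub>F i in F. norm (b i * a) < 1" "\<forall>\<^sub>F i in F. norm (b' i * a) < 1" "\<forall>\<^sub>F i in F. norm (a * b' i) < 1"
    using ba by (auto intro: eventually_norm_less)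
  show ?thesis
    using sm s fixed eq
  proof eventually_elim
    case (elim i)
    define d where "d = b i - b' i"
    \<comment> \<open>Push-through identity: \<open>b' i\<close> moves across the inverse, so that
      \<open>N' i\<close> can stand on the right of d.\<close>
    have 1: "neumann (b' i * a) * b' i = b' i * N' i"
    proof -
      have "(1 - b' i * a) * (b' i * N' i) = b' i * ((1 - a * b' i) * N' i)"
        by (simp add: algebra_simps)
      also have "\<dots> = b' i" using neumann_inverse(1)[OF elim(4)] by (simp add: N'_def)
      finally have "neumann (b' i * a) * ((1 - b' i * a) * (b' i * N' i)) = neumann (b' i * a) * b' i" by simp
      then show ?thesis using neumann_inverse(2)[OF elim(3)] by (simp add: mult.assoc[symmetric])
    qed
    have d: "N i * d * N' i = N i * b i - b' i * N' i"
    proof -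
      have "N i * (b i * (1 - a * b' i) - (1 - b i * a) * b' i) * N' i = N i * d * N' i"
        by (simp add: d_def algebra_simps)
      moreover have "N i * (b i * (1 - a * b' i) - (1 - b i * a) * b' i) * N' i
          = N i * b i * ((1 - a * b' i) * N' i) - (N i * (1 - b i * a)) * b' i * N' i"
        by (simp add: algebra_simps)
      moreover have "(1 - a * b' i) * N' i = 1" "N i * (1 - b i * a) = 1"
        using neumann_inverse elim by (auto simp: N'_def N_def)
      ultimately show ?thesis by simp
    qed
    have "E (N i * d * N' i) = 0"
      unfolding d using elim(6) 1 by (simp add: E_simps N_def)
    \<comment> \<open>Since \<open>E\<close> fixes d, the element N d N' of expectation zero may be
      subtracted; the rest carries a factor N - 1 or N' - 1.\<close>
    then have "d = E (d - N i * d * N' i)"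
      using elim(5) by (simp add: E_simps d_def)
    then have "norm d \<le> norm (d - N i * d * N' i) * K" using K(2) by metis
    also have "d - N i * d * N' i = - ((N i - 1) * d * N' i + d * (N' i - 1))"
      by (simp add: algebra_simps)
    also have "norm \<dots> \<le> norm (N i - 1) * norm d * norm (N' i) + norm d * norm (N' i - 1)"
      unfolding norm_minus_cancel
      by (intro norm_triangle_mono norm_mult_ineq order_trans[OF norm_mult_ineq mult_right_mono]) auto
    also have "\<dots> = norm d * (norm (N i - 1) * norm (N' i) + norm (N' i - 1))"
      by (simp add: algebra_simps)
    finally have le: "norm d \<le> norm d * (norm (N i - 1) * norm (N' i) + norm (N' i - 1)) * K"
      using K(1) by simp
    have "d = 0"
    proof (rule ccontr)
      assume "d \<noteq> 0"
      then have "norm d * (norm (N i - 1) * norm (N' i) + norm (N' i - 1)) < norm d * (1 / K)"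
        using elim(1) by (intro mult_strict_left_mono) auto
      then have "norm d * (norm (N i - 1) * norm (N' i) + norm (N' i - 1)) * K < norm d"
        using K(1) by (simp add: field_simps)
      then show False using le by simp
    qed
    then show ?case by (simp add: d_def)
  qed
qed

end

text \<open>Freeness with amalgamation is only needed for words alternating between one element of
  each algebra.\<close>

locale free_pair = expectation E for E :: "'m::{real_normed_algebra_1,banach} \<Rightarrow> 'm" +
  fixes SX SY :: "'m set"
  assumes closed_SX: "closed SX" and closed_SY: "closed SY"
    and E_in_SX: "E a \<in> SX" and E_in_SY: "E a \<in> SY"
    and add_SX: "a \<in> SX \<Longrightarrow> b \<in> SX \<Longrightarrow> a + b \<in> SX"
    and add_SY: "a \<in> SY \<Longrightarrow> b \<in> SY \<Longrightarrow> a + b \<in> SY"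
    and mult_SX: "a \<in> SX \<Longrightarrow> b \<in> SX \<Longrightarrow> a * b \<in> SX"
    and mult_SY: "a \<in> SY \<Longrightarrow> b \<in> SY \<Longrightarrow> a * b \<in> SY"
    and E_alternating:
      "u \<in> SX \<Longrightarrow> v \<in> SY \<Longrightarrow> E u = 0 \<Longrightarrow> E v = 0 \<Longrightarrow> E ((u * v) ^ Suc n) = 0"
      "u \<in> SX \<Longrightarrow> v \<in> SY \<Longrightarrow> E u = 0 \<Longrightarrow> E v = 0 \<Longrightarrow> E ((v * u) ^ Suc n) = 0"
      "u \<in> SX \<Longrightarrow> v \<in> SY \<Longrightarrow> E u = 0 \<Longrightarrow> E v = 0 \<Longrightarrow> E (v * (u * v) ^ n) = 0"
      "u \<in> SX \<Longrightarrow> v \<in> SY \<Longrightarrow> E u = 0 \<Longrightarrow> E v = 0 \<Longrightarrow> E ((u * v) ^ n * u) = 0"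
begin

text \<open>Multiplying out (1 + v) (u v)^n (1 + u) gives four alternating words in centred letters.
  Freeness kills all of them except the empty word at n = 0.\<close>

lemma E_free_resolvent:
  assumes uv: "u \<in> SX" "v \<in> SY" "E u = 0" "E v = 0" and n: "norm (u * v) < 1"
  shows "E ((1 + v) * neumann (u * v) * (1 + u)) = 1"
proof -
  have pow: "v * (u * v) ^ n * u = (v * u) ^ Suc n" for n
    by (induction n) (simp_all add: mult.assoc power_commutes)
  have E_term: "E ((1 + v) * (u * v) ^ n * (1 + u)) = (if n = 0 then 1 else 0)" for n
  proof -
    have "(1 + v) * (u * v) ^ n * (1 + u) =
        (u * v) ^ n + v * (u * v) ^ n + (u * v) ^ n * u + v * (u * v) ^ n * u"
      by (simp add: algebra_simps)
    then have "E ((1 + v) * (u * v) ^ n * (1 + u)) = E ((u * v) ^ n)"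
      unfolding pow using E_alternating(2-4)[OF uv] by (simp add: E_simps del: power_Suc)
    then show ?thesis using E_alternating(1)[OF uv] by (cases n) (auto simp: E_one simp del: power_Suc)
  qed
  have "(\<lambda>n. E ((1 + v) * (u * v) ^ n * (1 + u))) sums E ((1 + v) * neumann (u * v) * (1 + u))"
    by (intro bounded_linear.sums[OF bounded_linear_E] sums_mult sums_mult2 neumann_sums n)
  then have "(\<lambda>n. if n = 0 then 1 else 0) sums E ((1 + v) * neumann (u * v) * (1 + u))"
    unfolding E_term .
  then show ?thesis by (rule sums_unique2) (rule sums_single)
qed

text \<open>With \<open>P = (1 + u) G\<close> and \<open>Q = (1 + v) G\<close> one has
  \<open>P\<^sup>-\<^sup>1 + Q\<^sup>-\<^sup>1 - G\<^sup>-\<^sup>1 = G\<^sup>-\<^sup>1 (1 + u)\<^sup>-\<^sup>1 (1 - u v) (1 + v)\<^sup>-\<^sup>1\<close>.\<close>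

lemma E_resolvent_sum:
  assumes P: "P \<in> SX" "P * P' = 1" "P' * P = 1" and Q: "Q \<in> SY" "Q * Q' = 1" "Q' * Q = 1"
    and G: "E P = G" "E Q = G" "G * G' = 1" "G' * G = 1" "E G' = G'"
    and small: "norm ((P * G' - 1) * (Q * G' - 1)) < 1"
  obtains R where "R * (P' + Q' - G') = 1" "(P' + Q' - G') * R = 1" "E R = G"
proof -
  define u v where "u = P * G' - 1" and "v = Q * G' - 1"
  \<comment> \<open>Writing the constant as a value of \<open>E\<close> shows that it lies in
    \<open>SX\<close> and \<open>SY\<close>, which are known to contain the range of
    \<open>E\<close>.\<close>
  have mone: "-1 = E (-1)" by (simp add: E_simps E_one)
  have "u = P * E G' + E (-1)" "v = Q * E G' + E (-1)" using mone G by (simp_all add: u_def v_def)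
  then have uv: "u \<in> SX" "v \<in> SY"
    using P(1) Q(1) by (auto intro!: add_SX add_SY mult_SX mult_SY E_in_SX E_in_SY)
  have E0: "E u = 0" "E v = 0"
    using G by (simp_all add: u_def v_def E_simps E_fixed_right E_one)
  have n: "norm (u * v) < 1" using small by (simp add: u_def v_def)
  define R where "R = (1 + v) * neumann (u * v) * (1 + u) * G"
  have "1 + u = P * G'" "1 + v = Q * G'" by (simp_all add: u_def v_def)
  then have i: "G * P' * (1 + u) = 1" "(1 + u) * (G * P') = 1" "G * Q' * (1 + v) = 1" "(1 + v) * (G * Q') = 1"
    using P Q G by (metis (no_types, lifting) mult.assoc mult_1_right)+
  have key: "P' + Q' - G' = G' * (G * P') * (1 - u * v) * (G * Q')"
  proof -
    have "1 - u * v = (1 + v) + (1 + u) - (1 + u) * (1 + v)" by (simp add: algebra_simps)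
    then have "(G * P') * (1 - u * v) * (G * Q') =
        (G * P') * ((1 + v) * (G * Q')) + (G * P' * (1 + u)) * (G * Q')
          - (G * P' * (1 + u)) * ((1 + v) * (G * Q'))"
      by (simp add: algebra_simps)
    also have "\<dots> = G * P' + G * Q' - 1" using i by simp
    finally have "G' * ((G * P') * (1 - u * v) * (G * Q')) = G' * (G * P' + G * Q' - 1)" by simp
    also have "\<dots> = P' + Q' - G'" using G(4) by (simp add: algebra_simps mult.assoc[symmetric])
    finally show ?thesis by (simp add: mult.assoc)
  qed
  have "R * (P' + Q' - G') = (1 + v) * (neumann (u * v) * ((1 + u) * ((G * G') * (G * P')) * (1 - u * v))) * (G * Q')"
    unfolding R_def key by (simp only: mult.assoc)
  also have "\<dots> = 1" using G(3) i neumann_inverse[OF n] by simp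
  finally have 1: "R * (P' + Q' - G') = 1" .
  have "(P' + Q' - G') * R = G' * (G * P') * ((1 - u * v) * (((G * Q') * (1 + v)) * neumann (u * v))) * (1 + u) * G"
    unfolding R_def key by (simp only: mult.assoc)
  also have "\<dots> = G' * ((G * P') * (1 + u)) * G" using i neumann_inverse[OF n] by (simp add: mult.assoc)
  also have "\<dots> = 1" using i G(4) by simp
  finally have 2: "(P' + Q' - G') * R = 1" .
  have "E G = G" using G(1) E_idem by blast
  then have "E R = E ((1 + v) * neumann (u * v) * (1 + u)) * G" unfolding R_def by (rule E_fixed_right)
  then have "E R = G" using E_free_resolvent[OF uv E0 n] by simp
  then show thesis using that 1 2 by blast
qed

lemma neumann_in_SX: "a \<in> SX \<Longrightarrow> norm a < 1 \<Longrightarrow> neumann a \<in> SX"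
  using E_in_SX[of 1] by (intro neumann_in_closed_subalgebra closed_SX add_SX mult_SX) (auto simp: E_one)

lemma neumann_in_SY: "a \<in> SY \<Longrightarrow> norm a < 1 \<Longrightarrow> neumann a \<in> SY"
  using E_in_SY[of 1] by (intro neumann_in_closed_subalgebra closed_SY add_SY mult_SY) (auto simp: E_one)

text \<open>The point \<open>\<Omega>\<^sub>2 = G\<^sup>-\<^sup>1 + R\<close> with
  \<open>R = p (J - G)\<^sup>-\<^sup>1\<close> (the R-transform of \<open>y J\<close> at \<open>G\<close>) satisfies \<open>E ((\<Omega>\<^sub>2 - y J)\<^sup>-\<^sup>1) = G\<close>, so that
  \<open>\<Omega> + R\<close> has the same image under the Cauchy transform of \<open>X + y J\<close> as \<open>B\<close>.\<close>

lemma eventually_left_inverse_of_subordination: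
  fixes m :: "nat \<Rightarrow> real"
  assumes X: "X \<in> SX" and Y: "y * J \<in> SY"
    and y: "\<And>a. y * E a = E a * y" "\<And>n. E (y ^ n) = m n *\<^sub>R 1"
    and m: "m 0 = 1" "\<And>n. m (Suc n) = (\<Sum>i\<le>n. m i * m (n - i)) + (p - 1) * m n"
    and J: "E J = J" "J * J = 1"
    and b: "(b \<longlongrightarrow> 0) F" "\<And>i. E (b i) = b i" "\<And>i. E (\<Omega> i) = \<Omega> i"
      "\<forall>\<^sub>F i in F. b i * \<Omega> i = 1 \<and> \<Omega> i * b i = 1"
    and \<beta>: "(\<beta> \<longlongrightarrow> 0) F" "\<And>i. E (\<beta> i) = \<beta> i"
      "\<forall>\<^sub>F i in F. \<beta> i * B i = 1 \<and> B i * \<beta> i = 1"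
    and sub: "\<forall>\<^sub>F i in F. E (neumann (b i * X) * b i) = E (neumann (\<beta> i * (X + y * J)) * \<beta> i)"
  shows "\<forall>\<^sub>F i in F. (B i - \<Omega> i) * (J - E (neumann (b i * X) * b i)) = p *\<^sub>R 1"
proof -
  define P where "P = (\<lambda>i. neumann (b i * X) * b i)"
  define G where "G = (\<lambda>i. E (P i))"
  \<comment> \<open>G = (1 - k) b with k tending to 0, hence G' = \<Omega> (1 - k)^-1 is the inverse
    of G.\<close>
  define k where "k = (\<lambda>i. 1 - E (neumann (b i * X)))"
  define G' where "G' = (\<lambda>i. \<Omega> i * neumann (k i))"
  define W where "W = (\<lambda>i. G i * J)"
  \<comment> \<open>As J - G = (1 - G J) J and J squares to 1, this is p (J - G)^-1. It tends to p
    J, hence stays bounded while G tends to 0.\<close>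
  define R where "R = (\<lambda>i. p *\<^sub>R (J * neumann (W i)))"
  define g where "g = (\<lambda>i. neumann (- (G i * R i)))"
  \<comment> \<open>The inverse of \<Omega>_2 = G' + R = G' (1 + G R). Accordingly \<open>Q\<close>
    is the resolvent of y J at \<Omega>_2, and the argument of its series is y z, because y commutes
    with the fixed points of \<open>E\<close>.\<close>
  define c where "c = (\<lambda>i. g i * G i)"
  define z where "z = (\<lambda>i. c i * J)"
  define Q where "Q = (\<lambda>i. neumann (c i * (y * J)) * c i)"
  \<comment> \<open>In the same way b' is the inverse of \<Omega> + R, to be compared with \<beta>,
    the inverse of B.\<close>
  define h where "h = (\<lambda>i. neumann (- (b i * R i)))"
  define b' where "b' = (\<lambda>i. h i * b i)"

  have l: "((\<lambda>i. b i * X) \<longlongrightarrow> 0) F" using b(1) by (rule tendsto_mult_left_zero)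
  have tP: "(P \<longlongrightarrow> 0) F"
    unfolding P_def using tendsto_mult[OF tendsto_neumann[OF l] b(1)] by simp
  have tG: "(G \<longlongrightarrow> 0) F"
    unfolding G_def using tendsto_E[OF tP] by (simp add: E_simps)
  have tk: "(k \<longlongrightarrow> 0) F"
    unfolding k_def using tendsto_diff[OF tendsto_const tendsto_E[OF tendsto_neumann[OF l]], of 1]
    by (simp add: E_one)
  have tW: "(W \<longlongrightarrow> 0) F" unfolding W_def using tG by (rule tendsto_mult_left_zero)
  have tR: "(R \<longlongrightarrow> p *\<^sub>R (J * 1)) F"
    unfolding R_def by (intro tendsto_intros tendsto_neumann tW)
  have tGR: "((\<lambda>i. - (G i * R i)) \<longlongrightarrow> 0) F"
    using tendsto_minus[OF tendsto_mult[OF tG tR]] by simp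
  have tbR: "((\<lambda>i. - (b i * R i)) \<longlongrightarrow> 0) F"
    using tendsto_minus[OF tendsto_mult[OF b(1) tR]] by simp
  have tg: "(g \<longlongrightarrow> 1) F" unfolding g_def by (rule tendsto_neumann[OF tGR])
  have tc: "(c \<longlongrightarrow> 0) F" unfolding c_def using tendsto_mult[OF tg tG] by simp
  have tz: "(z \<longlongrightarrow> 0) F" unfolding z_def using tc by (rule tendsto_mult_left_zero)
  have tyz: "((\<lambda>i. y * z i) \<longlongrightarrow> 0) F" using tz by (rule tendsto_mult_right_zero)
  have tcy: "((\<lambda>i. c i * (y * J)) \<longlongrightarrow> 0) F" using tc by (rule tendsto_mult_left_zero)
  have tb': "(b' \<longlongrightarrow> 0) F"
    unfolding b'_def h_def using tendsto_mult[OF tendsto_neumann[OF tbR] b(1)] by simp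
  have tsmall: "((\<lambda>i. norm (E (neumann (y * z i)) * z i) + norm (W i) + \<bar>p - 1\<bar> * norm (z i)) \<longlongrightarrow> 0) F"
  proof -
    have "((\<lambda>i. norm (E (neumann (y * z i)) * z i) + norm (W i) + \<bar>p - 1\<bar> * norm (z i)) \<longlongrightarrow>
        norm (E 1 * 0) + norm (0::'m) + \<bar>p - 1\<bar> * norm (0::'m)) F"
      by (intro tendsto_intros tendsto_E tendsto_neumann tyz tz tW)
    then show ?thesis by simp
  qed
  \<comment> \<open>These factors are P G' - 1 and Q G' - 1 with the cancellation carried out
    beforehand. The limit cannot be taken in the original form, where G' contains the large matrix
    \<Omega>.\<close>
  have tuv: "((\<lambda>i. (neumann (b i * X) * neumann (k i) - 1) * (neumann (c i * (y * J)) * g i - 1)) \<longlongrightarrow> 0) F"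
  proof -
    have "((\<lambda>i. (neumann (b i * X) * neumann (k i) - 1) * (neumann (c i * (y * J)) * g i - 1)) \<longlongrightarrow>
        (1 * 1 - 1) * (1 * 1 - 1)) F"
      by (intro tendsto_intros tendsto_neumann l tk tcy tg)
    then show ?thesis by simp
  qed

  have ev_small: "\<forall>\<^sub>F i in F. norm (b i * X) < 1 \<and> norm (k i) < 1 \<and> norm (W i) < 1 \<and>
      norm (- (G i * R i)) < 1 \<and> norm (- (b i * R i)) < 1 \<and> norm (y * z i) < 1 \<and>
      norm (c i * (y * J)) < 1 \<and> norm (b' i * (X + y * J)) < 1"
    using l tk tW tGR tbR tyz tcy tendsto_mult_left_zero[OF tb', of "X + y * J"]
    by (intro eventually_conj eventually_norm_less) auto
  have ev_small2: "\<forall>\<^sub>F i in F. norm (E (neumann (y * z i)) * z i) + norm (W i) + \<bar>p - 1\<bar> * norm (z i) < 1"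
    using order_tendstoD(2)[OF tsmall, of 1] by simp
  have ev_small3: "\<forall>\<^sub>F i in F. norm ((neumann (b i * X) * neumann (k i) - 1) * (neumann (c i * (y * J)) * g i - 1)) < 1"
    using tuv by (rule eventually_norm_less) simp

  have ev: "\<forall>\<^sub>F i in F. E (b' i) = b' i \<and> b' i * (\<Omega> i + R i) = 1 \<and> (\<Omega> i + R i) * b' i = 1 \<and>
      E (neumann (b' i * (X + y * J)) * b' i) = G i"
    using ev_small ev_small2 ev_small3 b(4)
  proof eventually_elim
    case (elim i)
    let ?b = "b i" and ?\<Omega> = "\<Omega> i" and ?P = "P i" and ?G = "G i" and ?k = "k i" and ?G' = "G' i"
      and ?W = "W i" and ?R = "R i" and ?c = "c i" and ?z = "z i" and ?Q = "Q i" and ?b' = "b' i" and ?g = "g i"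
    note s = elim(1)
    have bO: "?b * ?\<Omega> = 1" "?\<Omega> * ?b = 1" using elim by blast+
    have Nk: "(1 - ?k) * neumann ?k = 1" "neumann ?k * (1 - ?k) = 1" using neumann_inverse s by blast+
    have Ek: "E ?k = ?k" by (simp add: k_def E_simps E_one E_idem)
    have ENk: "E (neumann ?k) = neumann ?k" using s Ek by (intro E_fixed_neumann) auto
    have EG: "E ?G = ?G" by (simp add: G_def E_idem)
    have EG': "E ?G' = ?G'" unfolding G'_def using b(3) ENk by (simp add: E_fixed_left)
    have EW: "E ?W = ?W" unfolding W_def using EG J by (simp add: E_fixed_left)
    have ER: "E ?R = ?R"
      unfolding R_def using J EW s by (simp add: E_simps E_fixed_left E_fixed_neumann)
    have Gk: "?G = (1 - ?k) * ?b"
      unfolding G_def P_def k_def using b(2) by (simp add: E_fixed_right)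
    have GG': "?G * ?G' = 1" "?G' * ?G = 1"
    proof -
      have "?G * ?G' = (1 - ?k) * (?b * ?\<Omega>) * neumann ?k" unfolding Gk G'_def by (simp only: mult.assoc)
      then show "?G * ?G' = 1" using bO Nk by simp
      have "?G' * ?G = ?\<Omega> * (neumann ?k * (1 - ?k)) * ?b" unfolding Gk G'_def by (simp only: mult.assoc)
      then show "?G' * ?G = 1" using bO Nk by simp
    qed
    have P: "?P * (?\<Omega> - X) = 1" "(?\<Omega> - X) * ?P = 1"
      unfolding P_def using neumann_resolvent[OF bO] s by blast+
    have g: "(1 + ?G * ?R) * ?g = 1" "?g * (1 + ?G * ?R) = 1"
      using neumann_inverse[of "- (?G * ?R)"] s by (simp_all add: g_def)
    have Eg: "E ?g = ?g"
      unfolding g_def using s EG ER by (intro E_fixed_neumann) (auto simp: E_simps E_fixed_left)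
    have Ec: "E ?c = ?c" unfolding c_def using Eg EG by (simp add: E_fixed_left)
    have Ez: "E ?z = ?z" unfolding z_def using Ec J by (simp add: E_fixed_left)
    have c: "?c * (?G' + ?R) = 1" "(?G' + ?R) * ?c = 1"
    proof -
      have "?c * (?G' + ?R) = ?g * (?G * ?G' + ?G * ?R)" unfolding c_def by (simp add: algebra_simps)
      then show "?c * (?G' + ?R) = 1" using g GG' by simp
      have "?G' + ?R = ?G' * (1 + ?G * ?R)" using GG' by (simp add: algebra_simps mult.assoc[symmetric])
      then have "(?G' + ?R) * ?c = ?G' * ((1 + ?G * ?R) * ?g) * ?G" unfolding c_def by (simp only: mult.assoc)
      then show "(?G' + ?R) * ?c = 1" using g GG' by simp
    qed
    have y': "y * a = a * y" if "E a = a" for a using y(1)[of a] that by simp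
    have zJ: "?z * J = ?c" unfolding z_def using J by (simp add: mult.assoc)
    have cyJ: "?c * (y * J) = y * ?z" unfolding z_def using y'[OF Ec] by (metis mult.assoc)
    have EQ: "E ?Q = ?G"
    proof -
      have mom: "E ((y * ?z) ^ n) = m n *\<^sub>R ?z ^ n" for n
      proof -
        have "?z * y ^ n = y ^ n * ?z" for n
          using y'[OF Ez] by (induction n) (simp_all, metis mult.assoc)
        then have "(y * ?z) ^ n = y ^ n * ?z ^ n" 
          by (induction n) (simp_all, metis mult.assoc)
        moreover have "E (?z ^ n) = ?z ^ n" using Ez by (induction n) (simp_all add: E_one E_fixed_left)
        ultimately show ?thesis by (simp add: E_fixed_right y(2))
      qed
      have NW: "neumann ?W - neumann ?W * ?W = 1" "?W * neumann ?W = neumann ?W * ?W"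
        using neumann_inverse(2)[of ?W] neumann_commute[of ?W ?W] s by (simp_all add: algebra_simps)
      have GR: "?G * ?R = p *\<^sub>R (?W * neumann ?W)" unfolding R_def W_def by (simp add: mult.assoc)
      have zW: "?z = ?g * ?W" unfolding z_def c_def W_def by (simp add: mult.assoc)
      \<comment> \<open>Although G and J need not commute, g is a series in G R = p W (1 - W)^-1,
        hence commutes with W = G J.\<close>
      have gW: "?W * ?g = ?g * ?W"
      proof -
        have "- (?G * ?R) * ?W = ?W * - (?G * ?R)" 
        proof -
          have "?W * neumann ?W * ?W = ?W * (?W * neumann ?W)" using NW(2) by (metis mult.assoc)
          then show ?thesis unfolding GR by simp
        qed
        then show ?thesis unfolding g_def using neumann_commute[of "- (?G * ?R)" ?W] s by simp
      qed
      have comm: "?W * ?z = ?z * ?W" unfolding zW using gW by (metis mult.assoc)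
      \<comment> \<open>From g (1 + p W (1 - W)^-1) = 1, multiplied by W - W^2 in order to remove
        the inverse of 1 - W.\<close>
      have quad: "?z + (p - 1) *\<^sub>R (?z * ?W) = ?W - ?W * ?W"
      proof -
        have "?g * (1 + p *\<^sub>R (?W * neumann ?W)) * (?W - ?W * ?W) = ?W - ?W * ?W"
          using g(2) unfolding GR by simp
        moreover have "neumann ?W * (?W - ?W * ?W) = ?W"
          using NW by (metis (no_types, lifting) left_diff_distrib mult.assoc mult_1_left right_diff_distrib)
        then have "(1 + p *\<^sub>R (?W * neumann ?W)) * (?W - ?W * ?W) = ?W + (p - 1) *\<^sub>R (?W * ?W)"
          by (simp add: algebra_simps mult.assoc)
        ultimately have "?g * (?W + (p - 1) *\<^sub>R (?W * ?W)) = ?W - ?W * ?W" by (simp add: mult.assoc)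
        then show ?thesis unfolding zW by (simp add: algebra_simps)
      qed
      have T: "E (neumann (y * ?z)) * ?z = ?W"
        by (rule E_neumann_eq_of_quadratic[OF m mom _ comm quad elim(2)]) (use s in blast)
      have "E ?Q = E (neumann (y * ?z)) * ?c" unfolding Q_def cyJ using Ec by (simp add: E_fixed_right)
      also have "\<dots> = E (neumann (y * ?z)) * ?z * J" using zJ by (simp add: mult.assoc)
      also have "\<dots> = ?G" unfolding T W_def using J by (simp add: mult.assoc)
      finally show ?thesis .
    qed
    have Q: "?Q * (?G' + ?R - y * J) = 1" "(?G' + ?R - y * J) * ?Q = 1"
      unfolding Q_def using neumann_resolvent[OF c] s by blast+
    have PX: "?P \<in> SX"
      unfolding P_def using s X E_in_SX[of ?b] b(2)[of i] by (intro mult_SX neumann_in_SX) auto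
    have QY: "?Q \<in> SY"
      unfolding Q_def
      by (rule mult_SY[OF neumann_in_SY[OF mult_SY]]) (use s Y E_in_SY[of ?c] Ec in auto)
    have PG': "?P * ?G' = neumann (?b * X) * neumann ?k"
      unfolding P_def G'_def using bO by (metis mult.assoc mult_1_right)
    have QG': "?Q * ?G' = neumann (?c * (y * J)) * ?g"
      unfolding Q_def c_def using GG' by (metis mult.assoc mult_1_right)
    have "norm ((?P * ?G' - 1) * (?Q * ?G' - 1)) < 1" using elim(3) unfolding PG' QG' .
    then obtain T where T: "T * (?\<Omega> - X + (?G' + ?R - y * J) - ?G') = 1" "E T = ?G"
      using E_resolvent_sum[OF PX P QY Q _ EQ GG' EG'] by (metis G_def)
    have h: "(1 + ?b * ?R) * h i = 1" "h i * (1 + ?b * ?R) = 1"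
      using neumann_inverse[of "- (?b * ?R)"] s by (simp_all add: h_def)
    have Eb': "E ?b' = ?b'"
    proof -
      have "E (- (?b * ?R)) = - (?b * ?R)" using b(2)[of i] ER by (simp add: E_simps E_fixed_left)
      then have "E (h i) = h i" unfolding h_def using s by (intro E_fixed_neumann) auto
      then show ?thesis unfolding b'_def using b(2)[of i] by (simp add: E_fixed_left)
    qed
    have b': "?b' * (?\<Omega> + ?R) = 1" "(?\<Omega> + ?R) * ?b' = 1"
    proof -
      have "?b' * (?\<Omega> + ?R) = h i * (?b * ?\<Omega> + ?b * ?R)" unfolding b'_def by (simp add: algebra_simps)
      then show "?b' * (?\<Omega> + ?R) = 1" using h bO by simp
      have "?\<Omega> + ?R = ?\<Omega> * (1 + ?b * ?R)" using bO by (simp add: algebra_simps mult.assoc[symmetric])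
      then have "(?\<Omega> + ?R) * ?b' = ?\<Omega> * ((1 + ?b * ?R) * h i) * ?b" unfolding b'_def by (simp only: mult.assoc)
      then show "(?\<Omega> + ?R) * ?b' = 1" using h bO by simp
    qed
    have "T = neumann (?b' * (X + y * J)) * ?b'"
    proof (rule right_inverse_eq_left_inverse)
      have "?\<Omega> - X + (?G' + ?R - y * J) - ?G' = ?\<Omega> + ?R - (X + y * J)" by simp
      then show "T * (?\<Omega> + ?R - (X + y * J)) = 1" using T(1) by (simp only:)
      show "(?\<Omega> + ?R - (X + y * J)) * (neumann (?b' * (X + y * J)) * ?b') = 1"
        using neumann_resolvent(2)[OF b'] s by blast
    qed
    then show ?case using Eb' b' T(2) by blast
  qed
  have "\<forall>\<^sub>F i in F. b' i = \<beta> i"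
  proof (rule eventually_resolvent_expectation_inj[OF tb' \<beta>(1)])
    show "\<forall>\<^sub>F i in F. E (b' i) = b' i \<and> E (\<beta> i) = \<beta> i" using ev \<beta>(2) by (auto elim: eventually_mono)
    show "\<forall>\<^sub>F i in F. E (neumann (b' i * (X + y * J)) * b' i) = E (neumann (\<beta> i * (X + y * J)) * \<beta> i)"
      using ev sub by eventually_elim (simp add: G_def P_def)
  qed
  then show ?thesis
    using ev ev_small \<beta>(3)
  proof eventually_elim
    case (elim i)
    then have "\<Omega> i + R i = B i" using right_inverse_eq_left_inverse[of "\<Omega> i + R i" "b' i" "B i"] by simp
    then have "B i - \<Omega> i = R i" by (simp add: algebra_simps)
    moreover have "J - G i = (1 - W i) * J" using J(2) by (simp add: W_def algebra_simps)
    then have "R i * (J - G i) = p *\<^sub>R (J * (neumann (W i) * (1 - W i)) * J)"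
      unfolding R_def by (simp add: mult.assoc)
    ultimately have "(B i - \<Omega> i) * (J - G i) = p *\<^sub>R 1"
      using neumann_inverse(2)[of "W i"] elim J(2) by simp
    then show ?case by (simp add: G_def P_def)
  qed
qed

end

section \<open>Matrices over a C*-algebra\<close>

lemma scaleC_zero_left [simp]: "0 *\<^sub>C (a::'a::cstar_algebra) = 0"
  using scaleC_add_left[of 0 0 a] by simp

lemma scaleC_zero_right [simp]: "c *\<^sub>C (0::'a::cstar_algebra) = 0"
  using scaleC_add_right[of c 0 0] by simp

lemma scaleC_one [simp]: "1 *\<^sub>C (a::'a::cstar_algebra) = a"
  using scaleR_scaleC[of 1 a] by simp

lemma scaleC_minus_left [simp]: "(- c) *\<^sub>C (a::'a::cstar_algebra) = - (c *\<^sub>C a)"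
  using scaleC_add_left[of "- c" c a] by (simp add: eq_neg_iff_add_eq_0)

lemma scaleC_diff_left: "(c - d) *\<^sub>C (a::'a::cstar_algebra) = c *\<^sub>C a - d *\<^sub>C a"
  using scaleC_add_left[of c "- d" a] by simp

lemma scaleC_sum_left: "(\<Sum>k\<in>K. f k) *\<^sub>C (a::'a::cstar_algebra) = (\<Sum>k\<in>K. f k *\<^sub>C a)"
  by (induction K rule: infinite_finite_induct) (simp_all add: scaleC_add_left)

definition emb :: "complex^'n::finite^'n \<Rightarrow> ('a::cstar_algebra, 'n) sqmat" where
  "emb B = of_mat (map_matrix (\<lambda>c. c *\<^sub>C 1) B)"

lemma mat_of_emb: "mat_of (emb B) $ i $ j = (B $ i $ j) *\<^sub>C 1"
  by (simp add: emb_def)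

lemma sqmat_eqI: "(\<And>i j. mat_of a $ i $ j = mat_of b $ i $ j) \<Longrightarrow> a = b"
  by (metis mat_of_inject vec_eq_iff)

lemma mat_of_times: "mat_of (a * b) $ i $ j = (\<Sum>k\<in>UNIV. mat_of a $ i $ k * mat_of b $ k $ j)"
  by (simp add: times_sqmat.rep_eq matrix_matrix_mult_def)

lemma emb_mult: "emb (A ** B) = emb A * emb B"
  by (rule sqmat_eqI)
    (simp add: mat_of_emb mat_of_times matrix_matrix_mult_def scaleC_sum_left mult_scaleC_left scaleC_scaleC)

lemma emb_one: "emb (mat 1) = 1"
  by (rule sqmat_eqI) (simp add: mat_of_emb one_sqmat.rep_eq mat_def)

lemma emb_zero: "emb 0 = 0"
  by (rule sqmat_eqI) (simp add: mat_of_emb zero_sqmat.rep_eq)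

lemma emb_add: "emb (A + B) = emb A + emb B"
  by (rule sqmat_eqI) (simp add: mat_of_emb plus_sqmat.rep_eq scaleC_add_left)

lemma emb_diff: "emb (A - B) = emb A - emb B"
  by (rule sqmat_eqI) (simp add: mat_of_emb minus_sqmat.rep_eq scaleC_diff_left)

lemma emb_scaleR: "emb (r *\<^sub>R A) = r *\<^sub>R emb A"
  by (rule sqmat_eqI) (simp add: mat_of_emb scaleR_sqmat.rep_eq scaleR_scaleC scaleC_scaleC scaleR_conv_of_real[where 'a = complex])

lemma norm_scaleC_one: "norm (c *\<^sub>C (1::'a::cstar_algebra)) = cmod c"
  by (simp add: norm_scaleC)

definition mexp :: "('a::cstar_algebra \<Rightarrow> complex) \<Rightarrow> ('a, 'n::finite) sqmat \<Rightarrow> complex^'n^'n" where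
  "mexp \<phi> a = map_matrix \<phi> (mat_of a)"

lemma mexp_nth: "mexp \<phi> a $ i $ j = \<phi> (mat_of a $ i $ j)"
  by (simp add: mexp_def)

lemma of_mat_scalar_mat: "of_mat (scalar_mat B) = emb B"
  by (simp add: scalar_mat_def emb_def)

lemma matrix_inv_eqI:
  assumes "A ** B = mat 1" "B ** A = mat 1"
  shows "matrix_inv A = B"
proof -
  have "A ** matrix_inv A = mat 1 \<and> matrix_inv A ** A = mat 1"
    unfolding matrix_inv_def
    using someI[of "\<lambda>A'. A ** A' = mat 1 \<and> A' ** A = mat 1" B] assms by blast
  then show ?thesis by (metis assms(2) matrix_mul_assoc matrix_mul_lid matrix_mul_rid)
qed

text \<open>\<open>matrix_inv\<close> is defined by choice; any explicit two-sided inverse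
  determines its value and thereby the Cauchy transform.\<close>

lemma cauchy_transform_eq_mexp:
  assumes "P * (emb B - of_mat A) = 1" "(emb B - of_mat A) * P = 1"
  shows "cauchy_transform \<phi> A B = mexp \<phi> P"
proof -
  have "of_mat (scalar_mat B - A) = emb B - of_mat A"
    by (simp add: of_mat_scalar_mat[symmetric] minus_sqmat_def)
  then have "mat_of (emb B - of_mat A) = scalar_mat B - A" by (metis mat_of_of_mat)
  then have "mat_of P ** (scalar_mat B - A) = mat 1" "(scalar_mat B - A) ** mat_of P = mat 1"
    using arg_cong[OF assms(1), of mat_of] arg_cong[OF assms(2), of mat_of]
    by (simp_all add: times_sqmat.rep_eq one_sqmat.rep_eq)
  then show ?thesis by (simp add: cauchy_transform_def mexp_def matrix_inv_eqI)
qed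

section \<open>The conditional expectation onto the scalar matrices\<close>

context tracial_wstar_probability_space
begin

text \<open>Boundedness is read off from normality: a predual consists of bounded
  functionals.\<close>

lemma bounded_linear_phi: "bounded_linear \<phi>"
  using normal blinfun.bounded_linear_right by metis

lemma phi_zero: "\<phi> 0 = 0" and phi_diff: "\<phi> (a - b) = \<phi> a - \<phi> b"
  and phi_sum: "\<phi> (\<Sum>k\<in>K. f k) = (\<Sum>k\<in>K. \<phi> (f k))"
  using bounded_linear.linear[OF bounded_linear_phi]
  by (simp_all add: linear_0 linear_diff linear_sum)

lemma mexp_emb: "mexp \<phi> (emb B) = B"
  by (simp add: vec_eq_iff mexp_nth mat_of_emb scaleC unital)

lemma mexp_emb_mult_left: "mexp \<phi> (emb B * a) = B ** mexp \<phi> a"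
  by (simp add: vec_eq_iff mexp_nth mat_of_times mat_of_emb matrix_matrix_mult_def phi_sum
      mult_scaleC_left scaleC)

lemma mexp_emb_mult_right: "mexp \<phi> (a * emb B) = mexp \<phi> a ** B"
  by (simp add: vec_eq_iff mexp_nth mat_of_times mat_of_emb matrix_matrix_mult_def phi_sum
      mult_scaleC_right scaleC mult.commute)

lemma mexp_add: "mexp \<phi> (a + b) = mexp \<phi> a + mexp \<phi> b"
  by (simp add: vec_eq_iff mexp_nth plus_sqmat.rep_eq add)

lemma mexp_diff: "mexp \<phi> (a - b) = mexp \<phi> a - mexp \<phi> b"
  by (simp add: vec_eq_iff mexp_nth minus_sqmat.rep_eq phi_diff)

lemma mexp_scaleR: "mexp \<phi> (r *\<^sub>R a) = r *\<^sub>R mexp \<phi> a"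
  by (simp add: vec_eq_iff mexp_nth scaleR_sqmat.rep_eq scaleR_scaleC scaleC scaleR_conv_of_real[where 'a = complex])

lemma emb_inj: "emb A = (emb B :: ('a, 'n::finite) sqmat) \<Longrightarrow> A = B"
  by (metis mexp_emb)

text \<open>The expectation is composed with the embedding of scalar matrices to give an
  endomorphism, as \<open>expectation\<close> demands.\<close>

definition mE :: "('a, 'n::finite) sqmat \<Rightarrow> ('a, 'n) sqmat" where
  "mE a = emb (mexp \<phi> a)"

lemma mE_emb: "mE (emb A) = emb A"
  by (simp add: mE_def mexp_emb)

lemma expectation_mE: "expectation (mE :: ('a, 'n::finite) sqmat \<Rightarrow> _)"
proof (rule expectation.intro)
  obtain K where K: "K > 0" "\<And>a. norm (\<phi> a) \<le> norm a * K"
    using bounded_linear.pos_bounded[OF bounded_linear_phi] by blast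
  show "bounded_linear (mE :: ('a, 'n) sqmat \<Rightarrow> _)"
  proof (rule bounded_linear_intro)
    show "mE (a + b) = mE a + mE b" for a b :: "('a, 'n) sqmat" by (simp add: mE_def mexp_add emb_add)
    show "mE (r *\<^sub>R a) = r *\<^sub>R mE a" for r and a :: "('a, 'n) sqmat" by (simp add: mE_def mexp_scaleR emb_scaleR)
    show "norm (mE a) \<le> norm a * (K * CARD('n))" for a :: "('a, 'n) sqmat"
    proof (rule norm_sqmat_le)
      fix i
      have "(\<Sum>j\<in>UNIV. norm (mat_of (mE a) $ i $ j)) \<le> (\<Sum>j\<in>(UNIV::'n set). norm a * K)"
        using K(1) by (intro sum_mono)
          (auto simp: mE_def mat_of_emb norm_scaleC_one mexp_nth
            intro!: order_trans[OF K(2)] mult_right_mono norm_entry_le)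
      then show "(\<Sum>j\<in>UNIV. norm (mat_of (mE a) $ i $ j)) \<le> norm a * (K * CARD('n))"
        by (simp add: mult_ac)
    qed
  qed
  show "mE (1::('a, 'n) sqmat) = 1" by (metis emb_one mE_emb)
  show "mE (mE a * b) = mE a * mE b" for a b :: "('a, 'n) sqmat"
    by (simp add: mE_def mexp_emb_mult_left emb_mult)
  show "mE (a * mE b) = mE a * mE b" for a b :: "('a, 'n) sqmat"
    by (simp add: mE_def mexp_emb_mult_right emb_mult)
qed

end

section \<open>Freeness with amalgamation over the scalar matrices\<close>

lemma closure_closed_under_continuous:
  fixes f :: "'a::metric_space \<Rightarrow> 'a \<Rightarrow> 'a"
  assumes "\<And>u v. u \<in> S \<Longrightarrow> v \<in> S \<Longrightarrow> f u v \<in> S"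
    and cont: "\<And>s t a b. s \<longlonglongrightarrow> a \<Longrightarrow> t \<longlonglongrightarrow> b \<Longrightarrow> (\<lambda>n::nat. f (s n) (t n)) \<longlonglongrightarrow> f a b"
    and "a \<in> closure S" "b \<in> closure S"
  shows "f a b \<in> closure S"
proof -
  obtain s t where "\<And>n. s n \<in> S" "s \<longlonglongrightarrow> a" "\<And>n. t n \<in> S" "t \<longlonglongrightarrow> b"
    using assms(3,4) unfolding closure_sequential by blast
  then show ?thesis
    unfolding closure_sequential using assms(1) cont by (intro exI[of _ "\<lambda>n. f (s n) (t n)"]) auto
qed

definition entries_in :: "'a set \<Rightarrow> ('a, 'n::finite) sqmat set" where
  "entries_in S = {m. \<forall>i j. mat_of m $ i $ j \<in> S}"

lemma closed_entries_in:
  fixes S :: "'a::real_normed_algebra_1 set"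
  assumes "closed S"
  shows "closed (entries_in S :: ('a, 'n::finite) sqmat set)"
proof -
  have "entries_in S = (\<Inter>i j. (\<lambda>m::('a, 'n) sqmat. mat_of m $ i $ j) -` S)"
    by (auto simp: entries_in_def)
  then show ?thesis
    using assms by (auto intro!: closed_INT closed_vimage bounded_linear.continuous_on[OF bounded_linear_entry] continuous_on_id)
qed

lemma sum_in_additive:
  assumes "\<And>k. k \<in> K \<Longrightarrow> f k \<in> S" "0 \<in> S" "\<And>u v. u \<in> S \<Longrightarrow> v \<in> S \<Longrightarrow> u + v \<in> S"
  shows "sum f K \<in> S"
  using assms(1) by (induction K rule: infinite_finite_induct) (auto simp: assms(2,3))

lemma entries_in_add:
  assumes "\<And>u v. u \<in> S \<Longrightarrow> v \<in> S \<Longrightarrow> u + v \<in> S" "a \<in> entries_in S" "b \<in> entries_in S"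
  shows "a + b \<in> entries_in S"
  using assms by (simp add: entries_in_def plus_sqmat.rep_eq)

lemma entries_in_mult:
  assumes "0 \<in> S" "\<And>u v. u \<in> S \<Longrightarrow> v \<in> S \<Longrightarrow> u + v \<in> S" "\<And>u v. u \<in> S \<Longrightarrow> v \<in> S \<Longrightarrow> u * v \<in> S"
    "a \<in> entries_in S" "b \<in> entries_in S"
  shows "a * b \<in> entries_in S"
  unfolding entries_in_def mem_Collect_eq mat_of_times
  using assms(4,5) by (auto simp: entries_in_def intro!: sum_in_additive assms(1-3))

text \<open>Swapping the two letters at each step treats even and odd alternating words, starting
  with either letter, in one induction.\<close>

fun alt_word :: "nat \<Rightarrow> 'm::monoid_mult \<Rightarrow> 'm \<Rightarrow> 'm" where
  "alt_word 0 u v = 1"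
| "alt_word (Suc n) u v = u * alt_word n v u"

lemma alt_word_even: "alt_word (2 * n) u v = (u * v) ^ n"
  by (induction n) (simp_all add: mult.assoc)

lemma alt_word_odd: "alt_word (2 * n + 1) u v = u * (v * u) ^ n"
  by (simp add: alt_word_even)

section \<open>Matrix freeness from scalar freeness\<close>

context tracial_wstar_probability_space
begin

text \<open>Geometric series leave the algebraic subalgebras, so freeness is passed to norm
  closures. Approximants t_n of a centred element are recentred to t_n - \<phi>(t_n) 1, which stays
  in the algebra and has the same limit.\<close>

lemma free_family_closure:
  assumes free: "free_family \<phi> A"
    and A: "\<And>i. 1 \<in> A i" "\<And>i a c. a \<in> A i \<Longrightarrow> c *\<^sub>C a \<in> A i" "\<And>i a b. a \<in> A i \<Longrightarrow> b \<in> A i \<Longrightarrow> a + b \<in> A i"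
  shows "free_family \<phi> (\<lambda>i. closure (A i))"
  unfolding free_family_def
proof (intro allI impI, elim conjE)
  fix ws :: "('b \<times> 'a) list"
  assume ws: "ws \<noteq> []" "successively (\<lambda>u v. fst u \<noteq> fst v) ws"
    "\<forall>(i, a)\<in>set ws. a \<in> closure (A i) \<and> \<phi> a = 0"
  have "\<exists>s. (\<forall>n. s n \<in> A (fst w) \<and> \<phi> (s n) = 0) \<and> s \<longlonglongrightarrow> snd w" if w: "w \<in> set ws" for w
  proof -
    have *: "snd w \<in> closure (A (fst w))" "\<phi> (snd w) = 0" using ws(3) w by (auto simp: case_prod_beta)
    then obtain t where t: "\<And>n. t n \<in> A (fst w)" "t \<longlonglongrightarrow> snd w" unfolding closure_sequential by blast
    define s where "s = (\<lambda>n. t n + (- \<phi> (t n)) *\<^sub>C 1)"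
    have "(\<lambda>n. (\<phi> (t n)) *\<^sub>C (1::'a)) \<longlonglongrightarrow> 0"
    proof (rule tendsto_norm_zero_cancel)
      have "(\<lambda>n. norm (\<phi> (t n))) \<longlonglongrightarrow> norm (\<phi> (snd w))"
        by (intro tendsto_norm bounded_linear.tendsto[OF bounded_linear_phi] t)
      then show "(\<lambda>n. norm (\<phi> (t n) *\<^sub>C (1::'a))) \<longlonglongrightarrow> 0" using * by (simp add: norm_scaleC_one)
    qed
    then have "(\<lambda>n. t n - \<phi> (t n) *\<^sub>C 1) \<longlonglongrightarrow> snd w - 0" by (intro tendsto_diff t)
    then have "s \<longlonglongrightarrow> snd w" by (simp add: s_def)
    moreover have "s n \<in> A (fst w)" for n unfolding s_def by (intro A t)
    moreover have "\<phi> (s n) = 0" for n by (simp add: s_def phi_diff scaleC unital)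
    ultimately show ?thesis by blast
  qed
  then obtain s where s: "\<And>w n. w \<in> set ws \<Longrightarrow> s w n \<in> A (fst w)" "\<And>w n. w \<in> set ws \<Longrightarrow> \<phi> (s w n) = 0"
    "\<And>w. w \<in> set ws \<Longrightarrow> s w \<longlonglongrightarrow> snd w" by metis
  have "(\<lambda>n. prod_list (map (\<lambda>w. s w n) vs)) \<longlonglongrightarrow> prod_list (map snd vs)" if "set vs \<subseteq> set ws" for vs
    using that by (induction vs) (auto intro!: tendsto_mult s)
  then have "(\<lambda>n. \<phi> (prod_list (map (\<lambda>w. s w n) ws))) \<longlonglongrightarrow> \<phi> (prod_list (map snd ws))"
    by (intro bounded_linear.tendsto[OF bounded_linear_phi]) simp
  moreover have "\<phi> (prod_list (map (\<lambda>w. s w n) ws)) = 0" for n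
  proof -
    let ?vs = "map (\<lambda>w. (fst w, s w n)) ws"
    have "?vs \<noteq> []" "successively (\<lambda>u v. fst u \<noteq> fst v) ?vs" "\<forall>(i, a)\<in>set ?vs. a \<in> A i \<and> \<phi> a = 0"
      using ws s(1,2) by (auto simp: successively_map)
    then have "\<phi> (prod_list (map snd ?vs)) = 0" using free unfolding free_family_def by blast
    then show ?thesis by (simp add: comp_def)
  qed
  ultimately show "\<phi> (prod_list (map snd ws)) = 0" by (simp add: LIMSEQ_const_iff)
qed

text \<open>An entry of an alternating product of centred matrices is a sum of products of centred
  entries from alternating algebras. \<open>ws\<close> collects the entries already chosen; its last
  letter must not come from the algebra of \<open>u\<close>. The empty word, whose expectation is 1,
  has to be excluded.\<close>

lemma alternating_word_entry:
  fixes u v :: "('a, 'n::finite) sqmat"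
  assumes free: "free_family \<phi> (A :: bool \<Rightarrow> 'a set)"
    and "u \<in> entries_in (A c)" "v \<in> entries_in (A (\<not> c))" "mexp \<phi> u = 0" "mexp \<phi> v = 0"
    and "successively (\<lambda>u v. fst u \<noteq> fst v) ws" "\<forall>(i, a)\<in>set ws. a \<in> A i \<and> \<phi> a = 0"
    and "ws \<noteq> [] \<Longrightarrow> fst (last ws) \<noteq> c" "ws \<noteq> [] \<or> n > 0"
  shows "\<phi> (prod_list (map snd ws) * mat_of (alt_word n u v) $ i $ j) = 0"
  using assms(2-)
proof (induction n arbitrary: u v c ws i)
  case 0
  then have "\<phi> (prod_list (map snd ws)) = 0" using free unfolding free_family_def by blast
  then show ?case by (simp add: one_sqmat.rep_eq mat_def phi_zero)
next
  case (Suc n)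
  have "\<phi> (prod_list (map snd ws) * (mat_of u $ i $ k * mat_of (alt_word n v u) $ k $ j)) = 0" for k
  proof -
    let ?ws = "ws @ [(c, mat_of u $ i $ k)]"
    have "\<phi> (mat_of u $ i $ k) = 0" using Suc.prems(3) by (metis mexp_nth zero_index)
    then have "\<phi> (prod_list (map snd ?ws) * mat_of (alt_word n v u) $ k $ j) = 0"
      using Suc.prems by (intro Suc.IH[of v "\<not> c" u]) (auto simp: successively_append_iff entries_in_def)
    then show ?thesis by (simp add: mult.assoc)
  qed
  then show ?case by (simp add: mat_of_times sum_distrib_left phi_sum)
qed

text \<open>Matrices with entries in a closed unital subalgebra again form one. They contain the
  scalar matrices, and their alternating centred words have expectation zero entry by entry.\<close>

lemma free_pair_of_freely_independent:
  fixes x y :: 'a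
  assumes free: "freely_independent \<phi> x y"
  shows "free_pair (mE :: ('a, 'n::finite) sqmat \<Rightarrow> _)
    (entries_in (closure (unital_subalgebra {x}))) (entries_in (closure (unital_subalgebra {y})))"
proof -
  let ?A = "\<lambda>b::bool. if b then unital_subalgebra {x} else unital_subalgebra {y}"
  have fam: "free_family \<phi> (\<lambda>b. closure (?A b))"
    by (rule free_family_closure)
      (use free in \<open>auto simp: freely_independent_def intro: unital_subalgebra.intros\<close>)
  have add': "u + v \<in> closure (unital_subalgebra S)"
    if "u \<in> closure (unital_subalgebra S)" "v \<in> closure (unital_subalgebra S)" for u v :: 'a and S
    by (rule closure_closed_under_continuous[where f = "(+)", OF _ _ that]) (auto intro: unital_subalgebra.intros tendsto_intros)
  have mult': "u * v \<in> closure (unital_subalgebra S)"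
    if "u \<in> closure (unital_subalgebra S)" "v \<in> closure (unital_subalgebra S)" for u v :: 'a and S
    by (rule closure_closed_under_continuous[where f = "(*)", OF _ _ that]) (auto intro: unital_subalgebra.intros tendsto_intros)
  have scalar: "c *\<^sub>C 1 \<in> closure (unital_subalgebra S)" for c and S :: "'a set"
    using closure_subset[of "unital_subalgebra S"] unital_subalgebra.intros(2,3) by blast
  have zero: "0 \<in> closure (unital_subalgebra S)" for S :: "'a set"
    using scalar[of 0 S] by simp
  have E0: "mE a = 0 \<Longrightarrow> mexp \<phi> a = 0" for a :: "('a, 'n) sqmat"
    using emb_inj[of "mexp \<phi> a" 0] by (simp add: mE_def emb_zero)
  have alt: "mE (alt_word (Suc n) u v) = 0"
    if "u \<in> entries_in (closure (?A c))" "v \<in> entries_in (closure (?A (\<not> c)))" "mE u = 0" "mE v = 0"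
    for c n and u v :: "('a, 'n) sqmat"
  proof -
    have "mexp \<phi> (alt_word (Suc n) u v) $ i $ j = 0" for i j
      using alternating_word_entry[OF fam that(1,2) E0[OF that(3)] E0[OF that(4)], of "[]" "Suc n" i j]
      by (simp add: mexp_nth)
    then have "mexp \<phi> (alt_word (Suc n) u v) = 0" by (simp add: vec_eq_iff)
    then show ?thesis by (simp add: mE_def emb_zero)
  qed
  let ?M = "\<lambda>S. entries_in (closure (unital_subalgebra S)) :: ('a, 'n) sqmat set"
  have closed: "closed (?M S)" for S by (rule closed_entries_in) simp
  have mE_in: "mE a \<in> ?M S" for a S by (auto simp: entries_in_def mE_def mat_of_emb scalar)
  have add_in: "a \<in> ?M S \<Longrightarrow> b \<in> ?M S \<Longrightarrow> a + b \<in> ?M S" for a b S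
    by (rule entries_in_add[OF add'])
  have mult_in: "a \<in> ?M S \<Longrightarrow> b \<in> ?M S \<Longrightarrow> a * b \<in> ?M S" for a b S
    by (rule entries_in_mult[OF zero add' mult'])
  show ?thesis
  proof (intro free_pair.intro expectation_mE free_pair_axioms.intro; (intro closed mE_in add_in mult_in; assumption)?)
    fix u v :: "('a, 'n) sqmat" and n
    assume uv: "u \<in> entries_in (closure (unital_subalgebra {x}))" "v \<in> entries_in (closure (unital_subalgebra {y}))"
      "mE u = 0" "mE v = 0"
    have a: "mE (alt_word (Suc k) u v) = 0" "mE (alt_word (Suc k) v u) = 0" for k
      using alt[of u True v k] alt[of v False u k] uv by simp_all
    show "mE ((u * v) ^ Suc n) = 0" using a(1)[of "2 * n + 1"] alt_word_even[of "Suc n" u v] by simp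
    show "mE ((v * u) ^ Suc n) = 0" using a(2)[of "2 * n + 1"] alt_word_even[of "Suc n" v u] by simp
    show "mE (v * (u * v) ^ n) = 0" using a(2)[of "2 * n"] alt_word_odd[of n v u] by simp
    have "(u * v) ^ n * u = u * (v * u) ^ n" by (induction n) (simp_all add: mult.assoc)
    then show "mE ((u * v) ^ n * u) = 0" using a(1)[of "2 * n"] alt_word_odd[of n u v] by simp
  qed
qed

end

section \<open>Quadratic forms and the upper half-plane\<close>

lemma quadratic_form_2:
  fixes B :: "complex^2^2"
  shows "quadratic_form B v = cnj (v $ 1) * (B $ 1 $ 1 * v $ 1 + B $ 1 $ 2 * v $ 2) +
    cnj (v $ 2) * (B $ 2 $ 1 * v $ 1 + B $ 2 $ 2 * v $ 2)"
  by (simp add: quadratic_form_def matrix_vector_mult_def sum_2)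

lemma quadratic_form_add: "quadratic_form (A + B) v = quadratic_form A v + quadratic_form B v"
  by (simp add: quadratic_form_def matrix_vector_mult_add_rdistrib distrib_left sum.distrib)

lemma quadratic_form_diff: "quadratic_form (A - B) v = quadratic_form A v - quadratic_form B v"
  by (simp add: quadratic_form_def matrix_vector_mult_diff_rdistrib right_diff_distrib sum_subtractf)

lemma norm_vec_squared: "(norm (v :: complex^'n))\<^sup>2 = (\<Sum>i\<in>UNIV. (cmod (v $ i))\<^sup>2)"
  by (simp add: norm_vec_def L2_set_def sum_nonneg)

lemma quadratic_form_mat: "quadratic_form (mat z) v = z * of_real ((norm v)\<^sup>2)"
proof -
  have "(mat z *v v) $ i = z * v $ i" for i
    by (simp add: matrix_vector_mult_def mat_def if_distrib if_distribR cong: if_cong)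
  then have "quadratic_form (mat z) v = (\<Sum>i\<in>UNIV. z * (v $ i * cnj (v $ i)))"
    by (simp add: quadratic_form_def mult_ac)
  then show ?thesis
    by (simp add: norm_vec_squared sum_distrib_left complex_norm_square[symmetric])
qed

lemma quadratic_form_scaleR: "quadratic_form B (r *\<^sub>R v) = of_real (r\<^sup>2) * quadratic_form B v"
proof -
  have "(B *v (r *\<^sub>R v)) $ i = of_real r * (B *v v) $ i" for i
    unfolding matrix_vector_mult_def
    by (simp add: sum_distrib_left scaleR_conv_of_real[where 'a = complex] mult_ac)
  then show ?thesis
    by (simp add: quadratic_form_def sum_distrib_left scaleR_conv_of_real[where 'a = complex]
        power2_eq_square mult_ac)
qed

lemma quadratic_form_Im_mat:
  fixes B :: "complex^2^2"
  shows "quadratic_form (Im_mat B) v = of_real (Im (quadratic_form B v))"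
proof -
  have div: "z / (2 * \<i>) = Complex (Im z / 2) (- Re z / 2)" for z
    by (simp add: complex_eq_iff Re_divide Im_divide power2_eq_square)
  show ?thesis
    by (simp add: quadratic_form_2 Im_mat_def adjoint_mat_def div complex_eq_iff field_simps)
qed

lemma invertible_if_quadratic_form_nonzero:
  assumes "\<And>v. v \<noteq> 0 \<Longrightarrow> quadratic_form A v \<noteq> 0"
  shows "invertible A"
proof -
  have "v = 0" if "A *v v = 0" for v
    using assms[of v] that by (auto simp: quadratic_form_def)
  then have "\<exists>B. B ** A = mat 1" by (simp add: matrix_left_invertible_ker)
  then show ?thesis by (simp add: invertible_left_inverse)
qed

text \<open>The quadratic form of the imaginary part is the imaginary part of the quadratic form,
  and positive definiteness already yields invertibility.\<close>

lemma upper_half_plane_iff: "B \<in> \<H>\<^sub>2\<^sup>+ \<longleftrightarrow> (\<forall>v. v \<noteq> 0 \<longrightarrow> Im (quadratic_form B v) > 0)"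
proof -
  have "pos_def (Im_mat B) \<longleftrightarrow> (\<forall>v. v \<noteq> 0 \<longrightarrow> Im (quadratic_form B v) > 0)"
    unfolding pos_def_def quadratic_form_Im_mat
    by (auto simp: complex_nonneg_Reals_iff order_less_le)
  moreover have "invertible (Im_mat B)" if "pos_def (Im_mat B)"
    using that by (intro invertible_if_quadratic_form_nonzero) (auto simp: pos_def_def)
  ultimately show ?thesis by (auto simp: upper_half_plane_def)
qed

lemma loewner_le_Im_mat:
  fixes A B :: "complex^2^2"
  assumes "Im_mat A \<preceq> Im_mat B"
  shows "Im (quadratic_form A v) \<le> Im (quadratic_form B v)"
  using assms unfolding loewner_le_def pos_semidef_def quadratic_form_diff quadratic_form_Im_mat
  by (simp add: complex_nonneg_Reals_iff)

text \<open>The minimum over the compact unit sphere, extended by homogeneity.\<close>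

lemma quadratic_form_coercive:
  assumes "B \<in> \<H>\<^sub>2\<^sup>+"
  obtains m where "m > 0" "\<And>v. Im (quadratic_form B v) \<ge> m * (norm v)\<^sup>2"
proof -
  have cont: "continuous_on (sphere 0 1) (\<lambda>v. Im (quadratic_form B v))"
    unfolding quadratic_form_2 by (intro continuous_intros)
  have "sphere (0 :: complex^2) 1 \<noteq> {}" by (simp add: sphere_eq_empty)
  then obtain w where w: "w \<in> sphere 0 1" "\<And>v. v \<in> sphere 0 1 \<Longrightarrow> Im (quadratic_form B w) \<le> Im (quadratic_form B v)"
    using continuous_attains_inf[OF compact_sphere _ cont] by blast
  have "w \<noteq> 0" using w(1) by auto
  then have pos: "Im (quadratic_form B w) > 0" using assms by (simp add: upper_half_plane_iff)
  have "Im (quadratic_form B v) \<ge> Im (quadratic_form B w) * (norm v)\<^sup>2" for v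
  proof (cases "v = 0")
    case True
    then show ?thesis by (simp add: quadratic_form_2)
  next
    case False
    then have "v = norm v *\<^sub>R (v /\<^sub>R norm v)" by simp
    then have "quadratic_form B v = of_real ((norm v)\<^sup>2) * quadratic_form B (v /\<^sub>R norm v)"
      by (metis quadratic_form_scaleR)
    moreover have "Im (quadratic_form B w) \<le> Im (quadratic_form B (v /\<^sub>R norm v))"
      using False by (intro w) simp
    ultimately show ?thesis
      using mult_left_mono[of "Im (quadratic_form B w)" "Im (quadratic_form B (v /\<^sub>R norm v))" "(norm v)\<^sup>2"]
      by (simp add: mult.commute flip: of_real_power)
  qed
  then show thesis using pos that by blast
qed

text \<open>For the column w = D e_j, coercivity gives m |w|^2 <= Im (cnj w_j) <= |w|, so every
  entry of D is at most 1/m. Summing a row gives the numerator.\<close>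

lemma norm_emb_inverse_le:
  fixes B D :: "complex^'n::finite^'n"
  assumes m: "m > 0" "\<And>v. Im (quadratic_form B v) \<ge> m * (norm v)\<^sup>2" and inv: "B ** D = mat 1"
  shows "norm (emb D :: ('a::cstar_algebra, 'n) sqmat) \<le> CARD('n) / m"
proof -
  have entry: "cmod (D $ i $ j) \<le> 1 / m" for i j
  proof -
    define w where "w = D *v axis j 1"
    have Bw: "B *v w = axis j 1" unfolding w_def by (simp add: matrix_vector_mul_assoc inv)
    have "m * (norm w)\<^sup>2 \<le> Im (quadratic_form B w)" by (rule m)
    also have "quadratic_form B w = cnj (w $ j)"
      unfolding quadratic_form_def Bw by (simp add: axis_def if_distrib cong: if_cong)
    also have "Im (cnj (w $ j)) \<le> norm w"
      using abs_Im_le_cmod[of "w $ j"] Finite_Cartesian_Product.norm_nth_le[of w j] by simp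
    finally have "m * norm w * norm w \<le> 1 * norm w" by (simp add: power2_eq_square mult.assoc)
    then have "m * norm w \<le> 1" by (cases "w = 0") (auto dest: mult_right_le_imp_le)
    then have "norm w \<le> 1 / m" using m(1) by (simp add: field_simps)
    moreover have "w $ i = D $ i $ j"
      by (simp add: w_def matrix_vector_mult_def axis_def if_distrib cong: if_cong)
    ultimately show ?thesis using Finite_Cartesian_Product.norm_nth_le[of w i] by simp
  qed
  show ?thesis
  proof (rule norm_sqmat_le)
    fix i
    have "(\<Sum>j\<in>UNIV. norm (mat_of (emb D :: ('a, 'n) sqmat) $ i $ j)) \<le> (\<Sum>j\<in>(UNIV::'n set). 1 / m)"
      by (intro sum_mono) (simp add: mat_of_emb norm_scaleC_one entry del: divide_inverse)
    then show "(\<Sum>j\<in>UNIV. norm (mat_of (emb D :: ('a, 'n) sqmat) $ i $ j)) \<le> CARD('n) / m" by simp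
  qed
qed

section \<open>Resolvents\<close>

lemma scaleC_diff_right: "c *\<^sub>C (a - b::'a::cstar_algebra) = c *\<^sub>C a - c *\<^sub>C b"
  using scaleC_add_right[of c "a - b" b] by simp

lemma star_one [simp]: "star (1::'a::cstar_algebra) = 1"
  by (metis mult_1_left star_mult star_star)

lemma star_minus: "star (- a::'a::cstar_algebra) = - star a"
  using star_scaleC[of "-1" a] by simp

lemma star_diff: "star (a - b::'a::cstar_algebra) = star a - star b"
  using star_add[of a "- b"] by (simp add: star_minus)

text \<open>Selfadjoint elements have real spectrum. With r = a + i b one writes h - r = k - i (b +
  t), where k = h - a + i t. The C*-identity bounds the norm of k below |b + t| for a suitable real
  t, and a geometric series inverts the difference.\<close>

lemma selfadjoint_minus_nonreal_invertible:
  fixes h :: "'a::cstar_algebra"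
  assumes h: "selfadjoint h" and r: "Im r \<noteq> 0"
  obtains g where "(h - r *\<^sub>C 1) * g = 1" "g * (h - r *\<^sub>C 1) = 1"
proof -
  define h' where "h' = h - of_real (Re r) *\<^sub>C 1"
  define b where "b = Im r"
  \<comment> \<open>The condition |h'|^2 + t^2 < (b + t)^2 means |h'|^2 < b^2 + 2 b t; this t, of
    the same sign as b if nonzero, makes 2 b t equal to |h'|^2.\<close>
  define t where "t = (norm h')\<^sup>2 / (2 * b)"
  define k where "k = h' + (\<i> * t) *\<^sub>C 1"
  define s where "s = \<i> * of_real (b + t)"
  have b: "b \<noteq> 0" using r by (simp add: b_def)
  have "star h' = h'" using h by (simp add: h'_def selfadjoint_def star_diff star_scaleC)
  then have "star k * k = h' * h' + of_real (t\<^sup>2) *\<^sub>C 1"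
    by (simp add: k_def star_add star_scaleC algebra_simps mult_scaleC_left mult_scaleC_right scaleC_scaleC
        scaleC_diff_right power2_eq_square)
  then have "(norm k)\<^sup>2 = norm (h' * h' + of_real (t\<^sup>2) *\<^sub>C 1)" using cstar_identity[of k] by simp
  also have "\<dots> \<le> norm h' * norm h' + t\<^sup>2"
    by (rule order_trans[OF norm_triangle_ineq add_mono[OF norm_mult_ineq]]) (simp add: norm_scaleC_one norm_power)
  also have "\<dots> = 2 * b * t + t\<^sup>2" using b by (simp add: t_def power2_eq_square)
  also have "\<dots> < (b + t)\<^sup>2" using b zero_less_power2[of b] by (simp add: power2_sum)
  also have "\<dots> = (cmod s)\<^sup>2" unfolding s_def norm_mult norm_of_real by simp
  finally have lt: "norm k < cmod s" by (simp add: power2_less_imp_less)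
  then have s: "s \<noteq> 0" by auto
  define q where "q = inverse s *\<^sub>C k"
  have "norm q = norm k / cmod s" by (simp add: q_def norm_scaleC norm_inverse divide_inverse)
  then have "norm q < 1" using lt s by simp
  note inv = neumann_inverse[OF this]
  have "of_real (Re r) + \<i> * of_real b = r" by (simp add: complex_eq_iff b_def)
  then have "r *\<^sub>C (1::'a) = of_real (Re r) *\<^sub>C 1 + (\<i> * of_real b) *\<^sub>C 1"
    unfolding scaleC_add_left[symmetric] by simp
  then have "h - r *\<^sub>C 1 = h' - (\<i> * of_real b) *\<^sub>C 1" unfolding h'_def by simp
  also have "\<dots> = k - s *\<^sub>C 1" by (simp add: k_def s_def scaleC_add_left distrib_left)
  also have "\<dots> = (- s) *\<^sub>C (1 - q)"
    using s scaleC_add_right[of s "1 - q" q] by (simp add: q_def scaleC_scaleC)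
  finally have eq: "h - r *\<^sub>C 1 = (- s) *\<^sub>C (1 - q)" .
  show thesis
  proof (rule that)
    show "(h - r *\<^sub>C 1) * ((- inverse s) *\<^sub>C neumann q) = 1" "((- inverse s) *\<^sub>C neumann q) * (h - r *\<^sub>C 1) = 1"
      unfolding eq mult_scaleC_left mult_scaleC_right scaleC_scaleC inv using s by simp_all
  qed
qed

text \<open>Cramer's rule for commuting entries. The inverse g of the determinant stands on the
  right in \<open>P\<close> and on the left in \<open>P'\<close>, so that only the entries have to
  be interchanged.\<close>

lemma sqmat_2_inverse:
  fixes A :: "('a::ring_1, 2) sqmat"
  assumes A: "mat_of A $ 1 $ 1 = a" "mat_of A $ 1 $ 2 = b" "mat_of A $ 2 $ 1 = c" "mat_of A $ 2 $ 2 = d"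
    and comm: "a * b = b * a" "a * c = c * a" "a * d = d * a" "b * c = c * b" "b * d = d * b" "c * d = d * c"
    and g: "(a * d - b * c) * g = 1" "g * (a * d - b * c) = 1"
  obtains P where "A * P = 1" "P * A = 1"
proof
  define P where "P = (of_mat (vector [vector [d * g, - (b * g)], vector [- (c * g), a * g]]) :: ('a, 2) sqmat)"
  define P' where "P' = (of_mat (vector [vector [g * d, - (g * b)], vector [- (g * c), g * a]]) :: ('a, 2) sqmat)"
  have P: "mat_of P $ 1 $ 1 = d * g" "mat_of P $ 1 $ 2 = - (b * g)" "mat_of P $ 2 $ 1 = - (c * g)" "mat_of P $ 2 $ 2 = a * g"
    and P': "mat_of P' $ 1 $ 1 = g * d" "mat_of P' $ 1 $ 2 = - (g * b)" "mat_of P' $ 2 $ 1 = - (g * c)" "mat_of P' $ 2 $ 2 = g * a"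
    by (simp_all add: P_def P'_def vector_2)
  have c': "a * (b * g) = b * (a * g)" "c * (d * g) = d * (c * g)" "d * (a * g) = a * (d * g)" "c * (b * g) = b * (c * g)"
    using comm by (metis mult.assoc)+
  have g': "a * (d * g) - b * (c * g) = 1" "g * (a * d) - g * (b * c) = 1"
    using g by (simp_all add: algebra_simps)
  have g'': "g * (d * a) - g * (c * b) = 1" using g'(2) comm by simp
  have "\<forall>i j. mat_of (A * P) $ i $ j = mat_of 1 $ i $ j"
    unfolding forall_2 by (simp add: mat_of_times sum_2 A P one_sqmat.rep_eq mat_def c' g')
  then show AP: "A * P = 1" by (blast intro: sqmat_eqI)
  have "\<forall>i j. mat_of (P' * A) $ i $ j = mat_of 1 $ i $ j"
    unfolding forall_2 by (simp add: mat_of_times sum_2 A P' one_sqmat.rep_eq mat_def mult.assoc comm g'')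
  then have PA: "P' * A = 1" by (blast intro: sqmat_eqI)
  then show "P * A = 1" using AP right_inverse_eq_left_inverse[of P' A P] by simp
qed

text \<open>The determinant of C - X is - (x - r) (x - r') with r, r' the roots of q. A real root
  would give a nonzero vector at which the form of C is real, which is impossible in the upper
  half-plane; hence both factors are invertible.\<close>

lemma resolvent_X_mat_exists:
  fixes x :: "'a::cstar_algebra"
  assumes x: "selfadjoint x" and C: "C \<in> \<H>\<^sub>2\<^sup>+"
  obtains P where "(emb C - of_mat (X_mat x)) * P = 1" "P * (emb C - of_mat (X_mat x)) = 1"
proof -
  define q where "q = [: C $ 1 $ 2 * C $ 2 $ 1 - C $ 1 $ 1 * C $ 2 $ 2, - (C $ 1 $ 2 + C $ 2 $ 1), 1 :]"
  obtain r where r: "poly q r = 0"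
    using fundamental_theorem_of_algebra[of q] by (auto simp: q_def constant_degree)
  define r' where "r' = C $ 1 $ 2 + C $ 2 $ 1 - r"
  have r'q: "poly q r' = 0" using r by (simp add: q_def r'_def algebra_simps)
  have vieta: "r * r' = C $ 1 $ 2 * C $ 2 $ 1 - C $ 1 $ 1 * C $ 2 $ 2"
    using r by (simp add: q_def r'_def algebra_simps)
  have C11: "C $ 1 $ 1 \<noteq> 0"
  proof
    assume "C $ 1 $ 1 = 0"
    then have "quadratic_form C (axis 1 1) = 0" by (simp add: quadratic_form_2 axis_def)
    moreover have "axis 1 1 \<noteq> (0 :: complex^2)" by (simp add: axis_eq_0_iff)
    ultimately show False using C[unfolded upper_half_plane_iff, rule_format, of "axis 1 1"] by simp
  qed
  have nonreal: "Im t \<noteq> 0" if t: "poly q t = 0" for t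
  proof
    assume "Im t = 0"
    then have ct: "cnj t = t" by (simp add: complex_eq_iff)
    \<comment> \<open>A kernel vector of C - t F with F the flip matrix; q is minus the determinant
      of C - t F.\<close>
    define v :: "complex^2" where "v = vector [C $ 1 $ 2 - t, - C $ 1 $ 1]"
    have v: "v $ 1 = C $ 1 $ 2 - t" "v $ 2 = - C $ 1 $ 1" by (simp_all add: v_def vector_2)
    have "v \<noteq> 0" using C11 v by (metis neg_equal_0_iff_equal zero_index)
    have "quadratic_form C v = t * (cnj (v $ 1) * v $ 2 + v $ 1 * cnj (v $ 2))"
    proof -
      have "C $ 1 $ 1 * v $ 1 + C $ 1 $ 2 * v $ 2 = t * v $ 2" by (simp add: v algebra_simps)
      moreover have "C $ 2 $ 1 * v $ 1 + C $ 2 $ 2 * v $ 2 = t * v $ 1"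
        using t by (simp add: v q_def algebra_simps)
      ultimately show ?thesis unfolding quadratic_form_2 by (simp add: algebra_simps)
    qed
    moreover have "Im (t * (cnj (v $ 1) * v $ 2 + v $ 1 * cnj (v $ 2))) = 0"
      using \<open>Im t = 0\<close> by (simp add: algebra_simps)
    ultimately show False using C[unfolded upper_half_plane_iff, rule_format, of v] \<open>v \<noteq> 0\<close> by (metis less_irrefl)
  qed
  obtain g where g: "(x - r *\<^sub>C 1) * g = 1" "g * (x - r *\<^sub>C 1) = 1"
    using selfadjoint_minus_nonreal_invertible[OF x nonreal[OF r]] by blast
  obtain g' where g': "(x - r' *\<^sub>C 1) * g' = 1" "g' * (x - r' *\<^sub>C 1) = 1"
    using selfadjoint_minus_nonreal_invertible[OF x nonreal[OF r'q]] by blast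
  let ?a = "C $ 1 $ 1 *\<^sub>C (1::'a)" and ?b = "C $ 1 $ 2 *\<^sub>C 1 - x" and ?c = "C $ 2 $ 1 *\<^sub>C 1 - x"
    and ?d = "C $ 2 $ 2 *\<^sub>C (1::'a)"
  have det: "?a * ?d - ?b * ?c = - ((x - r *\<^sub>C 1) * (x - r' *\<^sub>C 1))"
  proof -
    have "?a * ?d - ?b * ?c = (C $ 1 $ 1 * C $ 2 $ 2 - C $ 1 $ 2 * C $ 2 $ 1) *\<^sub>C 1 + (C $ 1 $ 2 + C $ 2 $ 1) *\<^sub>C x - x * x"
      by (simp add: algebra_simps mult_scaleC_left mult_scaleC_right scaleC_scaleC scaleC_add_left scaleC_diff_left scaleC_diff_right)
    also have "\<dots> = (- (r * r')) *\<^sub>C 1 + (r + r') *\<^sub>C x - x * x"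
      unfolding vieta by (simp add: r'_def)
    also have "\<dots> = - ((x - r *\<^sub>C 1) * (x - r' *\<^sub>C 1))"
      by (simp add: algebra_simps mult_scaleC_left mult_scaleC_right scaleC_scaleC scaleC_add_left
          scaleC_diff_right)
    finally show ?thesis .
  qed
  have "(x - r *\<^sub>C 1) * (x - r' *\<^sub>C 1) * (g' * g) = (x - r *\<^sub>C 1) * ((x - r' *\<^sub>C 1) * g') * g"
    "(g' * g) * ((x - r *\<^sub>C 1) * (x - r' *\<^sub>C 1)) = g' * (g * (x - r *\<^sub>C 1)) * (x - r' *\<^sub>C 1)"
    by (simp_all only: mult.assoc)
  then have u: "(?a * ?d - ?b * ?c) * (- (g' * g)) = 1" "(- (g' * g)) * (?a * ?d - ?b * ?c) = 1"
    unfolding det using g g' by simp_all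
  let ?A = "emb C - of_mat (X_mat x) :: ('a, 2) sqmat"
  have A: "mat_of ?A $ 1 $ 1 = ?a" "mat_of ?A $ 1 $ 2 = ?b" "mat_of ?A $ 2 $ 1 = ?c" "mat_of ?A $ 2 $ 2 = ?d"
    by (simp_all add: minus_sqmat.rep_eq mat_of_emb X_mat_def vector_2)
  have "?a * ?b = ?b * ?a" "?a * ?c = ?c * ?a" "?a * ?d = ?d * ?a" "?b * ?c = ?c * ?b" "?b * ?d = ?d * ?b"
    "?c * ?d = ?d * ?c"
    by (simp_all add: left_diff_distrib right_diff_distrib mult_scaleC_left mult_scaleC_right scaleC_scaleC
        scaleC_diff_right mult.commute[where 'a = complex])
  then show thesis using sqmat_2_inverse[OF A _ _ _ _ _ _ u] that by blast
qed

section \<open>Positivity of the trace and the sign of the Cauchy transform\<close>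

context tracial_wstar_probability_space
begin

text \<open>Polarization: positivity at 1 + c a makes c \<phi>(a) + cnj(c) \<phi>(star a) real, and
  c = 1 and c = i give the two components.\<close>

lemma phi_star: "\<phi> (star a) = cnj (\<phi> a)"
proof -
  have real: "Im (\<phi> (star b * b)) = 0" for b
    using positive[of b] by (simp add: complex_nonneg_Reals_iff)
  have "Im (c * \<phi> a + cnj c * \<phi> (star a)) = 0" if c: "cnj c * c = 1" for c
  proof -
    have "star (1 + c *\<^sub>C a) * (1 + c *\<^sub>C a) = 1 + c *\<^sub>C a + cnj c *\<^sub>C star a + (cnj c * c) *\<^sub>C (star a * a)"
      by (simp add: star_add star_scaleC distrib_left distrib_right mult_scaleC_left mult_scaleC_right
          scaleC_scaleC scaleC_add_right mult.commute[where 'a = complex] add.assoc)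
    then have "\<phi> (star (1 + c *\<^sub>C a) * (1 + c *\<^sub>C a)) = 1 + c * \<phi> a + cnj c * \<phi> (star a) + \<phi> (star a * a)"
      unfolding c by (simp add: add scaleC unital)
    then show ?thesis using real[of "1 + c *\<^sub>C a"] real[of a] by simp
  qed
  from this[of 1] this[of \<i>] show ?thesis by (simp add: complex_eq_iff)
qed

text \<open>The form pairs Im C with the Gram matrix of u1, u2. Completing the square, \<alpha>
  times it is the value of \<phi> at \<open>star w * w\<close> plus det(Im C) times its value at
  \<open>star u2 * u2\<close>. Both terms are nonnegative, and by faithfulness they vanish together
  only if u2 = 0 and w = 0, hence u1 = 0.\<close>

lemma gram_form_pos:
  fixes u1 u2 :: 'a
  assumes C: "C \<in> \<H>\<^sub>2\<^sup>+" and u: "u1 \<noteq> 0 \<or> u2 \<noteq> 0"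
  shows "Im (C $ 1 $ 1 * \<phi> (star u1 * u1) + C $ 1 $ 2 * \<phi> (star u1 * u2) +
    C $ 2 $ 1 * \<phi> (star u2 * u1) + C $ 2 $ 2 * \<phi> (star u2 * u2)) > 0"
proof -
  \<comment> \<open>\<alpha> and \<gamma> are the diagonal entries of \<open>Im_mat C\<close>, and h
    is its upper right entry.\<close>
  define \<alpha> where "\<alpha> = Im (C $ 1 $ 1)"
  define \<gamma> where "\<gamma> = Im (C $ 2 $ 2)"
  define h where "h = Complex ((Im (C $ 1 $ 2) + Im (C $ 2 $ 1)) / 2) ((Re (C $ 2 $ 1) - Re (C $ 1 $ 2)) / 2)"
  define g1 where "g1 = Re (\<phi> (star u1 * u1))"
  define g2 where "g2 = Re (\<phi> (star u2 * u2))"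
  define g where "g = \<phi> (star u1 * u2)"
  have g1: "\<phi> (star u1 * u1) = of_real g1" "g1 \<ge> 0" and g2: "\<phi> (star u2 * u2) = of_real g2" "g2 \<ge> 0"
    using positive[of u1] positive[of u2] by (auto simp: g1_def g2_def complex_nonneg_Reals_iff complex_eq_iff)
  have gc: "\<phi> (star u2 * u1) = cnj g"
    using phi_star[of "star u1 * u2"] by (simp add: g_def star_mult star_star)
  have "axis 1 1 \<noteq> (0 :: complex^2)" by (simp add: axis_eq_0_iff)
  then have "Im (quadratic_form C (axis 1 1)) > 0" using C by (simp add: upper_half_plane_iff)
  then have \<alpha>: "\<alpha> > 0" by (simp add: quadratic_form_2 axis_def \<alpha>_def)
  have det: "\<alpha> * \<gamma> - (cmod h)\<^sup>2 > 0"
  proof -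
    \<comment> \<open>This vector is chosen so that the form equals \<alpha> times the determinant
      of \<open>Im_mat C\<close>.\<close>
    define v :: "complex^2" where "v = vector [- h, of_real \<alpha>]"
    have v: "v $ 1 = - h" "v $ 2 = of_real \<alpha>" by (simp_all add: v_def vector_2)
    then have "v \<noteq> 0" using \<alpha> by (metis less_irrefl of_real_eq_0_iff zero_index)
    then have "Im (quadratic_form C v) > 0" using C by (simp add: upper_half_plane_iff)
    also have "Im (quadratic_form C v) = \<alpha> * (\<alpha> * \<gamma> - (cmod h)\<^sup>2)"
      unfolding quadratic_form_2 v cmod_power2
      by (simp add: h_def \<alpha>_def \<gamma>_def power2_eq_square field_simps)
    finally show ?thesis using \<alpha> by (simp add: zero_less_mult_iff)
  qed
  define w where "w = of_real \<alpha> *\<^sub>C u1 + h *\<^sub>C u2"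
  define gw where "gw = Re (\<phi> (star w * w))"
  have gw0: "gw \<ge> 0" and gw_eq: "\<phi> (star w * w) = of_real gw"
    using positive[of w] by (auto simp: gw_def complex_nonneg_Reals_iff complex_eq_iff)
  have "\<phi> (star w * w) = of_real (\<alpha>\<^sup>2) * of_real g1 + of_real \<alpha> * h * g + of_real \<alpha> * cnj h * cnj g + (cnj h * h) * of_real g2"
    by (simp add: w_def star_add star_scaleC algebra_simps mult_scaleC_left mult_scaleC_right scaleC_scaleC add scaleC
        g1 g2 gc g_def[symmetric] power2_eq_square)
  then have gw: "gw = \<alpha>\<^sup>2 * g1 + 2 * \<alpha> * Re (h * g) + (cmod h)\<^sup>2 * g2"
    unfolding gw_def cmod_power2 by (simp add: power2_eq_square algebra_simps)
  let ?I = "Im (C $ 1 $ 1 * \<phi> (star u1 * u1) + C $ 1 $ 2 * \<phi> (star u1 * u2) +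
    C $ 2 $ 1 * \<phi> (star u2 * u1) + C $ 2 $ 2 * \<phi> (star u2 * u2))"
  have I: "?I = \<alpha> * g1 + 2 * Re (h * g) + \<gamma> * g2"
    unfolding g1 g2 gc g_def[symmetric] by (simp add: \<alpha>_def \<gamma>_def h_def field_simps)
  have sum: "\<alpha> * ?I = gw + (\<alpha> * \<gamma> - (cmod h)\<^sup>2) * g2"
    unfolding I gw by (simp add: power2_eq_square algebra_simps)
  have "gw + (\<alpha> * \<gamma> - (cmod h)\<^sup>2) * g2 \<noteq> 0"
  proof
    assume *: "gw + (\<alpha> * \<gamma> - (cmod h)\<^sup>2) * g2 = 0"
    have "(\<alpha> * \<gamma> - (cmod h)\<^sup>2) * g2 \<ge> 0" using det g2 by simp
    then have 0: "gw = 0" "(\<alpha> * \<gamma> - (cmod h)\<^sup>2) * g2 = 0" using * gw0 by linarith+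
    then have "g2 = 0" using det by simp
    then have "u2 = 0" "w = 0" using faithful[of u2] faithful[of w] g2 gw_eq 0 by auto
    then have "of_real \<alpha> *\<^sub>C u1 = 0" by (simp add: w_def)
    then have "norm (of_real \<alpha> *\<^sub>C u1) = 0" by simp
    then have "u1 = 0" using \<alpha> by (simp add: norm_scaleC)
    then show False using u \<open>u2 = 0\<close> by simp
  qed
  moreover have "gw + (\<alpha> * \<gamma> - (cmod h)\<^sup>2) * g2 \<ge> 0" using gw0 det g2 by simp
  ultimately have "\<alpha> * ?I > 0" unfolding sum by simp
  then show ?thesis using \<alpha> by (simp add: zero_less_mult_iff)
qed

text \<open>The pair u = P v over the algebra satisfies (C - X) u = v. The pairing of u with v under
  \<phi> is the form of C at u minus that of X, and the latter is real because x is selfadjoint. The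
  quadratic form of the expectation pairs v with u instead; this conjugation produces the negative
  sign.\<close>

lemma Im_quadratic_form_resolvent_neg:
  fixes x :: 'a
  assumes x: "selfadjoint x" and C: "C \<in> \<H>\<^sub>2\<^sup>+"
    and P: "(emb C - of_mat (X_mat x)) * P = 1" and v: "v \<noteq> 0"
  shows "Im (quadratic_form (mexp \<phi> P) v) < 0"
proof -
  define u where "u = (\<lambda>i. mat_of P $ i $ 1 * (v $ 1 *\<^sub>C 1) + mat_of P $ i $ 2 * (v $ 2 *\<^sub>C 1))"
  have entry: "mat_of ((emb C - of_mat (X_mat x)) * P) $ i $ j = (if i = j then 1 else 0)" for i j
    unfolding P by (simp add: one_sqmat.rep_eq mat_def)
  have e1: "(C $ 1 $ 1 *\<^sub>C 1) * mat_of P $ 1 $ j + (C $ 1 $ 2 *\<^sub>C 1 - x) * mat_of P $ 2 $ j = (if 1 = j then 1 else 0)"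
    and e2: "(C $ 2 $ 1 *\<^sub>C 1 - x) * mat_of P $ 1 $ j + (C $ 2 $ 2 *\<^sub>C 1) * mat_of P $ 2 $ j = (if 2 = j then 1 else 0)" for j
    using entry[of 1 j] entry[of 2 j]
    by (simp_all add: mat_of_times sum_2 minus_sqmat.rep_eq mat_of_emb X_mat_def vector_2)
  have U1: "(C $ 1 $ 1 *\<^sub>C 1) * u 1 + (C $ 1 $ 2 *\<^sub>C 1 - x) * u 2 = v $ 1 *\<^sub>C 1"
  proof -
    have "(C $ 1 $ 1 *\<^sub>C 1) * u 1 + (C $ 1 $ 2 *\<^sub>C 1 - x) * u 2 =
      ((C $ 1 $ 1 *\<^sub>C 1) * mat_of P $ 1 $ 1 + (C $ 1 $ 2 *\<^sub>C 1 - x) * mat_of P $ 2 $ 1) * (v $ 1 *\<^sub>C 1) +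
      ((C $ 1 $ 1 *\<^sub>C 1) * mat_of P $ 1 $ 2 + (C $ 1 $ 2 *\<^sub>C 1 - x) * mat_of P $ 2 $ 2) * (v $ 2 *\<^sub>C 1)"
      unfolding u_def by (simp only: distrib_left distrib_right mult.assoc add.assoc add.left_commute)
    then show ?thesis unfolding e1 by simp
  qed
  have U2: "(C $ 2 $ 1 *\<^sub>C 1 - x) * u 1 + (C $ 2 $ 2 *\<^sub>C 1) * u 2 = v $ 2 *\<^sub>C 1"
  proof -
    have "(C $ 2 $ 1 *\<^sub>C 1 - x) * u 1 + (C $ 2 $ 2 *\<^sub>C 1) * u 2 =
      ((C $ 2 $ 1 *\<^sub>C 1 - x) * mat_of P $ 1 $ 1 + (C $ 2 $ 2 *\<^sub>C 1) * mat_of P $ 2 $ 1) * (v $ 1 *\<^sub>C 1) +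
      ((C $ 2 $ 1 *\<^sub>C 1 - x) * mat_of P $ 1 $ 2 + (C $ 2 $ 2 *\<^sub>C 1) * mat_of P $ 2 $ 2) * (v $ 2 *\<^sub>C 1)"
      unfolding u_def by (simp only: distrib_left distrib_right mult.assoc add.assoc add.left_commute)
    then show ?thesis unfolding e2 by simp
  qed
  have u: "u 1 \<noteq> 0 \<or> u 2 \<noteq> 0"
  proof (rule ccontr)
    assume "\<not> ?thesis"
    then have "v $ 1 *\<^sub>C (1::'a) = 0" "v $ 2 *\<^sub>C (1::'a) = 0" using U1 U2 by simp_all
    then have "norm (v $ 1 *\<^sub>C (1::'a)) = 0" "norm (v $ 2 *\<^sub>C (1::'a)) = 0" by simp_all
    then have "v $ 1 = 0" "v $ 2 = 0" by (simp_all add: norm_scaleC_one)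
    then show False using v by (simp add: vec_eq_iff forall_2)
  qed
  define T where "T = star (u 1) * x * u 2 + star (u 2) * x * u 1"
  have "star T = T" using x by (simp add: T_def star_add star_mult star_star selfadjoint_def mult.assoc add.commute)
  then have T: "Im (\<phi> T) = 0" using phi_star[of T] by (simp add: complex_eq_iff)
  define S where "S = star (u 1) * (v $ 1 *\<^sub>C 1) + star (u 2) * (v $ 2 *\<^sub>C 1)"
  have "star S = cnj (v $ 1) *\<^sub>C u 1 + cnj (v $ 2) *\<^sub>C u 2"
    by (simp add: S_def star_add star_mult star_star star_scaleC mult_scaleC_left)
  then have "\<phi> (star S) = quadratic_form (mexp \<phi> P) v"
    by (simp add: quadratic_form_2 mexp_nth u_def add scaleC mult_scaleC_right algebra_simps)
  then have "quadratic_form (mexp \<phi> P) v = cnj (\<phi> S)" using phi_star[of S] by simp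
  then have "Im (quadratic_form (mexp \<phi> P) v) = - Im (\<phi> S)" by simp
  also have "S = C $ 1 $ 1 *\<^sub>C (star (u 1) * u 1) + C $ 1 $ 2 *\<^sub>C (star (u 1) * u 2) +
      C $ 2 $ 1 *\<^sub>C (star (u 2) * u 1) + C $ 2 $ 2 *\<^sub>C (star (u 2) * u 2) - T"
    unfolding S_def U1[symmetric] U2[symmetric] T_def
    by (simp add: algebra_simps mult_scaleC_left mult_scaleC_right)
  then have "Im (\<phi> S) = Im (C $ 1 $ 1 * \<phi> (star (u 1) * u 1) + C $ 1 $ 2 * \<phi> (star (u 1) * u 2) +
      C $ 2 $ 1 * \<phi> (star (u 2) * u 1) + C $ 2 $ 2 * \<phi> (star (u 2) * u 2))"
    using T by (simp add: phi_diff add scaleC)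
  finally show ?thesis using gram_form_pos[OF C u] by simp
qed

end

section \<open>Behaviour near infinity and analytic continuation\<close>

text \<open>Continuity of inversion. Near the limit a geometric series provides a right inverse of
  \<open>A i\<close>, which must agree with the given left inverse.\<close>

lemma tendsto_inverse_in_banach_algebra:
  fixes A P :: "'i \<Rightarrow> 'm::{real_normed_algebra_1,banach}"
  assumes A: "(A \<longlongrightarrow> A0) F" and P: "\<forall>\<^sub>F i in F. P i * A i = 1" and P0: "A0 * P0 = 1" "P0 * A0 = 1"
  shows "(P \<longlongrightarrow> P0) F"
proof -
  have t: "((\<lambda>i. P0 * (A0 - A i)) \<longlongrightarrow> 0) F"
    using tendsto_mult[OF tendsto_const[of P0] tendsto_diff[OF tendsto_const[of A0] A]] by simp
  have "((\<lambda>i. neumann (P0 * (A0 - A i)) * P0) \<longlongrightarrow> 1 * P0) F"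
    by (intro tendsto_intros tendsto_neumann t)
  moreover have "\<forall>\<^sub>F i in F. neumann (P0 * (A0 - A i)) * P0 = P i"
    using eventually_norm_less[OF t zero_less_one] P
  proof eventually_elim
    case (elim i)
    then have "A i * (neumann (P0 * (A0 - A i)) * P0) = 1"
      using neumann_resolvent(2)[OF P0(2,1), of "A0 - A i"] by simp
    then show ?case using right_inverse_eq_left_inverse[OF elim(2)] by simp
  qed
  ultimately show ?thesis by (simp add: tendsto_cong)
qed

lemma mat_of_of_mat_mat_times:
  fixes B :: "('a::ring_1, 'n::finite) sqmat"
  shows "mat_of (of_mat (mat a) * B) $ i $ j = a * mat_of B $ i $ j"
    and "mat_of (B * of_mat (mat a)) $ i $ j = mat_of B $ i $ j * a"
  by (simp_all add: mat_of_times mat_def if_distrib[of "\<lambda>u. u * _"] if_distrib[of "\<lambda>u. _ * u"] cong: if_cong)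

text \<open>The diagonal factor commutes with all scalar matrices, so the moments of y enter the
  matrix computation as numbers.\<close>

lemma of_mat_Y_mat: "of_mat (Y_mat y) = of_mat (mat y) * emb J_mat"
proof -
  have "\<forall>i j. mat_of (of_mat (Y_mat y)) $ i $ j = mat_of (of_mat (mat y) * emb J_mat) $ i $ j"
    unfolding forall_2 mat_of_of_mat_mat_times
    by (simp add: mat_of_emb Y_mat_def J_mat_def vector_2 mult_scaleC_right)
  then show ?thesis by (blast intro: sqmat_eqI)
qed

lemma of_mat_X_plus_Y: "of_mat (X_mat x + Y_mat y) = of_mat (X_mat x) + of_mat (mat y) * emb J_mat"
  unfolding of_mat_Y_mat[symmetric] by (simp add: plus_sqmat_def)

lemma J_mat_nth: "J_mat $ 1 $ 1 = 0" "J_mat $ 1 $ 2 = \<i>" "J_mat $ 2 $ 1 = - \<i>" "J_mat $ 2 $ 2 = 0"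
  by (simp_all add: J_mat_def vector_2)

lemma J_mat_squared: "J_mat ** J_mat = mat 1"
  by (simp add: vec_eq_iff forall_2 matrix_matrix_mult_def sum_2 J_mat_nth mat_def)

lemma of_mat_mat_power: "of_mat (mat a) ^ n = (of_mat (mat (a ^ n)) :: ('a::ring_1, 'n::finite) sqmat)"
proof (induction n)
  case 0
  then show ?case by (simp add: one_sqmat_def)
next
  case (Suc n)
  have "of_mat (mat a) * of_mat (mat b) = (of_mat (mat (a * b)) :: ('a, 'n) sqmat)" for b
    by (rule sqmat_eqI) (simp add: mat_of_of_mat_mat_times, simp add: mat_def)
  then show ?case using Suc by simp
qed

lemma of_mat_mat_commute_emb: "of_mat (mat a) * emb B = emb B * of_mat (mat a)"
  by (rule sqmat_eqI) (simp add: mat_of_of_mat_mat_times mat_of_emb mult_scaleC_right mult_scaleC_left)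

section \<open>Holomorphy, the identity near infinity and its continuation\<close>

context tracial_wstar_probability_space
begin

text \<open>The resolvent identity P z - P z0 = - P z (W z - W z0) P z0 makes the difference
  quotient an explicit finite sum, which converges by continuity of inversion.\<close>

lemma has_field_derivative_mexp_inverse:
  fixes P :: "complex \<Rightarrow> ('a, 'n::finite) sqmat" and W :: "complex \<Rightarrow> complex^'n^'n"
  assumes W: "\<And>k l. ((\<lambda>z. W z $ k $ l) has_field_derivative W' k l) (at z0)"
    and P: "\<forall>\<^sub>F z in at z0. P z * (emb (W z) - A) = 1"
    and P0: "P z0 * (emb (W z0) - A) = 1" "(emb (W z0) - A) * P z0 = 1"
  shows "((\<lambda>z. mexp \<phi> (P z) $ i $ j) has_field_derivative
    - (\<Sum>k\<in>UNIV. \<Sum>l\<in>UNIV. W' k l * \<phi> (mat_of (P z0) $ i $ k * mat_of (P z0) $ l $ j))) (at z0)"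
proof -
  have quot: "((\<lambda>z. (W z $ k $ l - W z0 $ k $ l) / (z - z0)) \<longlongrightarrow> W' k l) (at z0)" for k l
    using W by (simp add: has_field_derivative_iff)
  have "((\<lambda>z. W z $ k $ l) \<longlongrightarrow> W z0 $ k $ l) (at z0)" for k l
    using DERIV_isCont[OF W[of k l]] by (simp add: isCont_def)
  then have W_lim: "((\<lambda>z. W z $ k $ l - W z0 $ k $ l) \<longlongrightarrow> 0) (at z0)" for k l
    by (simp add: LIM_zero)
  have "((\<lambda>z. emb (W z - W z0) :: ('a, 'n) sqmat) \<longlongrightarrow> 0) (at z0)"
  proof (rule tendsto_sqmat)
    fix k l
    show "((\<lambda>z. mat_of (emb (W z - W z0) :: ('a, 'n) sqmat) $ k $ l) \<longlongrightarrow> mat_of 0 $ k $ l) (at z0)"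
      unfolding zero_sqmat.rep_eq zero_index mat_of_emb
      by (rule tendsto_norm_zero_cancel)
        (use tendsto_norm_zero[OF W_lim[of k l]] in \<open>simp add: norm_scaleC_one\<close>)
  qed
  then have "((\<lambda>z. emb (W z - W z0) + (emb (W z0) - A)) \<longlongrightarrow> 0 + (emb (W z0) - A)) (at z0)"
    by (intro tendsto_add tendsto_const)
  then have "((\<lambda>z. emb (W z) - A) \<longlongrightarrow> emb (W z0) - A) (at z0)" by (simp add: emb_diff)
  then have lim: "(P \<longlongrightarrow> P z0) (at z0)"
    using P P0(2,1) by (rule tendsto_inverse_in_banach_algebra)
  have "((\<lambda>z. - (\<Sum>k\<in>UNIV. \<Sum>l\<in>UNIV. (W z $ k $ l - W z0 $ k $ l) / (z - z0) *
          \<phi> (mat_of (P z) $ i $ k * mat_of (P z0) $ l $ j)))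
      \<longlongrightarrow> - (\<Sum>k\<in>UNIV. \<Sum>l\<in>UNIV. W' k l * \<phi> (mat_of (P z0) $ i $ k * mat_of (P z0) $ l $ j))) (at z0)"
    by (intro tendsto_intros quot bounded_linear.tendsto[OF bounded_linear_phi] tendsto_entry lim)
  moreover have "\<forall>\<^sub>F z in at z0. - (\<Sum>k\<in>UNIV. \<Sum>l\<in>UNIV. (W z $ k $ l - W z0 $ k $ l) / (z - z0) *
          \<phi> (mat_of (P z) $ i $ k * mat_of (P z0) $ l $ j)) =
      (mexp \<phi> (P z) $ i $ j - mexp \<phi> (P z0) $ i $ j) / (z - z0)"
    using P
  proof eventually_elim
    case (elim z)
    have "P z * emb (W z - W z0) * P z0 = (P z * (emb (W z) - A)) * P z0 - P z * ((emb (W z0) - A) * P z0)"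
      by (simp add: emb_diff algebra_simps)
    also have "\<dots> = P z0 - P z" using elim P0 by simp
    finally have "mexp \<phi> (P z * emb (W z - W z0) * P z0) $ i $ j = (mexp \<phi> (P z0) - mexp \<phi> (P z)) $ i $ j"
      by (simp add: mexp_diff)
    then have "mexp \<phi> (P z) $ i $ j - mexp \<phi> (P z0) $ i $ j = - mexp \<phi> (P z * emb (W z - W z0) * P z0) $ i $ j"
      by simp
    also have "mexp \<phi> (P z * emb (W z - W z0) * P z0) $ i $ j =
        (\<Sum>l\<in>UNIV. \<Sum>k\<in>UNIV. (W z $ k $ l - W z0 $ k $ l) * \<phi> (mat_of (P z) $ i $ k * mat_of (P z0) $ l $ j))"
      by (simp add: mexp_nth mat_of_times mat_of_emb phi_sum sum_distrib_right mult_scaleC_left mult_scaleC_right scaleC)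
    also have "\<dots> = (\<Sum>k\<in>UNIV. \<Sum>l\<in>UNIV. (W z $ k $ l - W z0 $ k $ l) * \<phi> (mat_of (P z) $ i $ k * mat_of (P z0) $ l $ j))"
      by (rule sum.swap)
    finally show ?case by (simp add: sum_divide_distrib)
  qed
  ultimately show ?thesis
    unfolding has_field_derivative_iff by (rule Lim_transform_eventually)
qed

lemma cauchy_transform_X_mat:
  assumes "selfadjoint x" "C \<in> \<H>\<^sub>2\<^sup>+"
  obtains P where "P * (emb C - of_mat (X_mat x)) = 1" "(emb C - of_mat (X_mat x)) * P = 1"
    "cauchy_transform \<phi> (X_mat x) C = mexp \<phi> P"
    "\<And>v. v \<noteq> 0 \<Longrightarrow> Im (quadratic_form (cauchy_transform \<phi> (X_mat x) C) v) < 0"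
proof -
  obtain P where P: "(emb C - of_mat (X_mat x)) * P = 1" "P * (emb C - of_mat (X_mat x)) = 1"
    using resolvent_X_mat_exists[OF assms] by blast
  then have "cauchy_transform \<phi> (X_mat x) C = mexp \<phi> P" by (intro cauchy_transform_eq_mexp)
  then show thesis using that P Im_quadratic_form_resolvent_neg[OF assms P(1)] by simp
qed

text \<open>The quadratic form of the selfadjoint matrix J is real, whereas that of the Cauchy
  transform has strictly negative imaginary part.\<close>

lemma invertible_J_minus_cauchy_transform:
  assumes "selfadjoint x" "C \<in> \<H>\<^sub>2\<^sup>+"
  shows "invertible (J_mat - cauchy_transform \<phi> (X_mat x) C)"
proof (rule invertible_if_quadratic_form_nonzero)
  fix v :: "complex^2"
  assume v: "v \<noteq> 0"
  have "Im (quadratic_form (cauchy_transform \<phi> (X_mat x) C) v) < 0"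
    using cauchy_transform_X_mat[OF assms] v by metis
  moreover have "Im (quadratic_form J_mat v) = 0"
    by (simp add: quadratic_form_2 J_mat_nth)
  ultimately show "quadratic_form (J_mat - cauchy_transform \<phi> (X_mat x) C) v \<noteq> 0"
    unfolding quadratic_form_diff by (metis less_irrefl right_minus_eq)
qed

lemma moments_of_free_poisson:
  assumes "free_poisson \<phi> p y"
  shows "\<phi> (y ^ n) = of_real (nc_weight p 0 n)"
  using assms by (intro moments_of_constant_free_cumulants)
    (auto simp: unital free_poisson_def free_cumulant_def)

text \<open>\<open>C i\<close> stands for the subordination value at \<open>B i\<close>. When both
  inverses tend to zero, the two Cauchy transforms are expectations of geometric series, and the
  Banach algebra result applies.\<close>

lemma eventually_left_inverse_identity:
  fixes C B :: "'i \<Rightarrow> complex^2^2"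
  assumes free: "freely_independent \<phi> x y" and y: "free_poisson \<phi> p y"
    and C: "((\<lambda>i. emb (matrix_inv (C i)) :: ('a, 2) sqmat) \<longlongrightarrow> 0) F" "\<forall>\<^sub>F i in F. invertible (C i)"
    and B: "((\<lambda>i. emb (matrix_inv (B i)) :: ('a, 2) sqmat) \<longlongrightarrow> 0) F" "\<forall>\<^sub>F i in F. invertible (B i)"
    and sub: "\<forall>\<^sub>F i in F. cauchy_transform \<phi> (X_mat x + Y_mat y) (B i) = cauchy_transform \<phi> (X_mat x) (C i)"
  shows "\<forall>\<^sub>F i in F. (B i - C i) ** (J_mat - cauchy_transform \<phi> (X_mat x) (C i)) = p *\<^sub>R mat 1"
proof -
  define X where "X = (of_mat (X_mat x) :: ('a, 2) sqmat)"
  define Y where "Y = (of_mat (mat y) :: ('a, 2) sqmat)"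
  define b where "b = (\<lambda>i. emb (matrix_inv (C i)) :: ('a, 2) sqmat)"
  define \<beta> where "\<beta> = (\<lambda>i. emb (matrix_inv (B i)) :: ('a, 2) sqmat)"
  define \<Omega> where "\<Omega> = (\<lambda>i. emb (C i) :: ('a, 2) sqmat)"
  define B' where "B' = (\<lambda>i. emb (B i) :: ('a, 2) sqmat)"
  interpret free_pair mE "entries_in (closure (unital_subalgebra {x}))"
    "entries_in (closure (unital_subalgebra {y})) :: ('a, 2) sqmat set"
    by (rule free_pair_of_freely_independent[OF free])
  have inv: "emb (matrix_inv A) * emb A = 1" "emb A * emb (matrix_inv A) = 1" if "invertible A" for A :: "complex^2^2"
  proof -
    have "A ** matrix_inv A = mat 1 \<and> matrix_inv A ** A = mat 1"
      using that unfolding invertible_def matrix_inv_def by (rule someI_ex)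
    then show "emb (matrix_inv A) * emb A = 1" "emb A * emb (matrix_inv A) = 1"
      by (simp_all add: emb_mult[symmetric] emb_one)
  qed
  have gens: "0 \<in> closure (unital_subalgebra {a})" "a \<in> closure (unital_subalgebra {a})"
    "c *\<^sub>C a \<in> closure (unital_subalgebra {a})" for a :: 'a and c
    using closure_subset[of "unital_subalgebra {a}"] unital_subalgebra.gen[of a "{a}"]
      unital_subalgebra.scaleC[of a "{a}" c] unital_subalgebra.scaleC[of a "{a}" 0] by auto
  have X_in: "X \<in> entries_in (closure (unital_subalgebra {x}))"
    unfolding entries_in_def X_def by (simp add: forall_2 X_mat_def vector_2 gens)
  have "Y * emb J_mat = of_mat (Y_mat y)" by (simp add: Y_def of_mat_Y_mat)
  then have Y_in: "Y * emb J_mat \<in> entries_in (closure (unital_subalgebra {y}))"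
    using gens(3)[of "-\<i>" y] unfolding entries_in_def by (simp add: forall_2 Y_mat_def vector_2 gens)
  have Y_mom: "mE (Y ^ n) = nc_weight p 0 n *\<^sub>R 1" for n
  proof (rule sqmat_eqI)
    fix i j
    show "mat_of (mE (Y ^ n)) $ i $ j = mat_of (nc_weight p 0 n *\<^sub>R 1 :: ('a, 2) sqmat) $ i $ j"
      unfolding Y_def of_mat_mat_power mE_def mat_of_emb mexp_nth mat_of_of_mat
      by (simp add: mat_def scaleR_sqmat.rep_eq one_sqmat.rep_eq
          moments_of_free_poisson[OF y] phi_zero scaleR_scaleC)
  qed
  have ev_inv: "\<forall>\<^sub>F i in F. b i * \<Omega> i = 1 \<and> \<Omega> i * b i = 1" "\<forall>\<^sub>F i in F. \<beta> i * B' i = 1 \<and> B' i * \<beta> i = 1"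
    by (rule eventually_mono[OF C(2)], simp add: b_def \<Omega>_def inv)
      (rule eventually_mono[OF B(2)], simp add: \<beta>_def B'_def inv)
  have tb: "(b \<longlongrightarrow> 0) F" "(\<beta> \<longlongrightarrow> 0) F" using C(1) B(1) by (simp_all add: b_def \<beta>_def)
  have ev_small: "\<forall>\<^sub>F i in F. norm (b i * X) < 1" "\<forall>\<^sub>F i in F. norm (\<beta> i * (X + Y * emb J_mat)) < 1"
    by (rule eventually_norm_less[OF tendsto_mult_left_zero[OF tb(1)] zero_less_one],
        rule eventually_norm_less[OF tendsto_mult_left_zero[OF tb(2)] zero_less_one])
  have ev_G: "\<forall>\<^sub>F i in F. mE (neumann (b i * X) * b i) = emb (cauchy_transform \<phi> (X_mat x) (C i))"
    using ev_inv(1) ev_small(1)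
  proof eventually_elim
    case (elim i)
    then have "cauchy_transform \<phi> (X_mat x) (C i) = mexp \<phi> (neumann (b i * X) * b i)"
      unfolding \<Omega>_def X_def by (intro cauchy_transform_eq_mexp neumann_resolvent) auto
    then show ?case by (simp add: mE_def)
  qed
  have ev_G': "\<forall>\<^sub>F i in F. mE (neumann (\<beta> i * (X + Y * emb J_mat)) * \<beta> i) =
      emb (cauchy_transform \<phi> (X_mat x + Y_mat y) (B i))"
    using ev_inv(2) ev_small(2)
  proof eventually_elim
    case (elim i)
    then have "cauchy_transform \<phi> (X_mat x + Y_mat y) (B i) = mexp \<phi> (neumann (\<beta> i * (X + Y * emb J_mat)) * \<beta> i)"
      unfolding B'_def X_def Y_def of_mat_X_plus_Y[symmetric]
      by (intro cauchy_transform_eq_mexp neumann_resolvent) auto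
    then show ?case by (simp add: mE_def)
  qed
  have "\<forall>\<^sub>F i in F. (B' i - \<Omega> i) * (emb J_mat - mE (neumann (b i * X) * b i)) = p *\<^sub>R 1"
  proof (rule eventually_left_inverse_of_subordination[OF X_in Y_in _ Y_mom _ _ _ _ tb(1) _ _ ev_inv(1) tb(2) _ ev_inv(2)])
    show "Y * mE a = mE a * Y" for a by (simp add: Y_def mE_def of_mat_mat_commute_emb)
    show "nc_weight p 0 0 = 1" by (rule nc_weight_diag)
    show "nc_weight p 0 (Suc n) = (\<Sum>i\<le>n. nc_weight p 0 i * nc_weight p 0 (n - i)) + (p - 1) * nc_weight p 0 n" for n
      by (rule nc_weight_recursion)
    show "mE (emb J_mat :: ('a, 2) sqmat) = emb J_mat" by (rule mE_emb)
    show "emb J_mat * emb J_mat = (1 :: ('a, 2) sqmat)"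
      by (simp add: emb_mult[symmetric] J_mat_squared emb_one)
    show "mE (b i) = b i" "mE (\<Omega> i) = \<Omega> i" "mE (\<beta> i) = \<beta> i" for i
      by (simp_all add: b_def \<Omega>_def \<beta>_def mE_emb)
    show "\<forall>\<^sub>F i in F. mE (neumann (b i * X) * b i) = mE (neumann (\<beta> i * (X + Y * emb J_mat)) * \<beta> i)"
      using ev_G ev_G' sub by eventually_elim simp
  qed
  then show ?thesis
    using ev_G
  proof eventually_elim
    case (elim i)
    then have "emb ((B i - C i) ** (J_mat - cauchy_transform \<phi> (X_mat x) (C i))) = (emb (p *\<^sub>R mat 1) :: ('a, 2) sqmat)"
      by (simp add: B'_def \<Omega>_def emb_mult emb_diff emb_scaleR emb_one)
    then show ?case by (rule emb_inj)
  qed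
qed

text \<open>The product form is continued rather than the formula for the left inverse: its entries
  are sums of products of holomorphic functions, with no inverse of J - G_X involved.\<close>

lemma subordination_left_inverse_identity:
  fixes x y :: 'a
  assumes x: "selfadjoint x" and free: "freely_independent \<phi> x y" and y: "free_poisson \<phi> p y"
    and sub: "subordination_function \<phi> (X_mat x) (Y_mat y) \<Omega>" and B: "B \<in> \<H>\<^sub>2\<^sup>+"
  shows "(B - \<Omega> B) ** (J_mat - cauchy_transform \<phi> (X_mat x) (\<Omega> B)) = p *\<^sub>R mat 1"
proof -
  obtain m where m: "m > 0" "\<And>v. Im (quadratic_form B v) \<ge> m * (norm v)\<^sup>2"
    using quadratic_form_coercive[OF B] by blast
  define Bz where "Bz = (\<lambda>z. B + mat z)"
  \<comment> \<open>The form of B + z I has coercivity constant m + Im z, so this half-plane is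
    mapped into the domain of \<Omega>, and 0 is an interior point of it.\<close>
  define S where "S = {z. Im z > - m}"
  define G where "G = (\<lambda>z. cauchy_transform \<phi> (X_mat x) (\<Omega> (Bz z)))"
  define f where "f = (\<lambda>z. (Bz z - \<Omega> (Bz z)) ** (J_mat - G z))"
  have \<Omega>: "\<And>A. A \<in> \<H>\<^sub>2\<^sup>+ \<Longrightarrow> \<Omega> A \<in> \<H>\<^sub>2\<^sup>+" "frechet_analytic_on \<H>\<^sub>2\<^sup>+ \<Omega>"
    "\<And>A. A \<in> \<H>\<^sub>2\<^sup>+ \<Longrightarrow> Im_mat A \<preceq> Im_mat (\<Omega> A)"
    "\<And>A. A \<in> \<H>\<^sub>2\<^sup>+ \<Longrightarrow> cauchy_transform \<phi> (X_mat x + Y_mat y) A = cauchy_transform \<phi> (X_mat x) (\<Omega> A)"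
    using sub by (auto simp: subordination_function_def)
  have coer: "Im (quadratic_form (Bz z) v) \<ge> (m + Im z) * (norm v)\<^sup>2" for z v
    using m(2)[of v] by (simp add: Bz_def quadratic_form_add quadratic_form_mat algebra_simps
        flip: of_real_power)
  have BzH: "Bz z \<in> \<H>\<^sub>2\<^sup>+" if z: "z \<in> S" for z
    unfolding upper_half_plane_iff
  proof (intro allI impI)
    fix v :: "complex^2" assume "v \<noteq> 0"
    then have "0 < (m + Im z) * (norm v)\<^sup>2" using z by (simp add: S_def)
    then show "0 < Im (quadratic_form (Bz z) v)" using coer[of z v] by linarith
  qed
  have openS: "open S" and connS: "connected S"
    unfolding S_def using open_halfspace_Im_gt convex_connected[OF convex_halfspace_Im_gt] by auto
  have \<Omega>_der: "\<exists>D. \<forall>k l. ((\<lambda>z. \<Omega> (Bz z) $ k $ l) has_field_derivative D k l) (at z)" if z: "z \<in> S" for z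
  proof -
    obtain D where D: "(\<Omega> has_derivative D) (at (Bz z))" "\<And>c M. D (map_matrix ((*) c) M) = map_matrix ((*) c) (D M)"
      using \<Omega>(2) BzH[OF z] unfolding frechet_analytic_on_def by blast
    have lin: "linear (mat :: complex \<Rightarrow> complex^2^2)"
      by (rule linearI) (simp_all add: vec_eq_iff mat_def)
    have "(Bz has_derivative (\<lambda>h. mat h)) (at z)"
      unfolding Bz_def using lin
      by (auto intro!: derivative_eq_intros bounded_linear_imp_has_derivative linear_linear[THEN iffD2] simp: linear_conv_bounded_linear)
    from has_derivative_compose[OF this D(1)]
    have "((\<lambda>z. \<Omega> (Bz z)) has_derivative (\<lambda>h. D (mat h))) (at z)" .
    then have "((\<lambda>z. \<Omega> (Bz z) $ k $ l) has_derivative (\<lambda>h. D (mat h) $ k $ l)) (at z)" for k l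
      by (intro bounded_linear.has_derivative[OF bounded_linear_vec_nth])
    \<comment> \<open>Complex homogeneity of D turns its restriction to multiples of the identity
      into multiplication by a number, so the derivative along this line is a complex one.\<close>
    moreover have "(\<lambda>h. D (mat h) $ k $ l) = (*) (D (mat 1) $ k $ l)" for k l
    proof
      fix h
      have "map_matrix ((*) h) (mat 1) = (mat h :: complex^2^2)" by (simp add: vec_eq_iff mat_def)
      then show "D (mat h) $ k $ l = D (mat 1) $ k $ l * h"
        using arg_cong[OF D(2)[of h "mat 1"], of "\<lambda>M. M $ k $ l"] by (simp only: nth_map_matrix mult.commute)
    qed
    ultimately have "((\<lambda>z. \<Omega> (Bz z) $ k $ l) has_field_derivative D (mat 1) $ k $ l) (at z)" for k l
      by (simp only: has_field_derivative_def)
    then show ?thesis by (intro exI[of _ "\<lambda>k l. D (mat 1) $ k $ l"]) simp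
  qed
  have "\<forall>z\<in>S. \<exists>P. P * (emb (\<Omega> (Bz z)) - of_mat (X_mat x)) = 1 \<and> (emb (\<Omega> (Bz z)) - of_mat (X_mat x)) * P = 1 \<and> G z = mexp \<phi> P"
  proof
    fix z assume z: "z \<in> S"
    show "\<exists>P. P * (emb (\<Omega> (Bz z)) - of_mat (X_mat x)) = 1 \<and> (emb (\<Omega> (Bz z)) - of_mat (X_mat x)) * P = 1 \<and> G z = mexp \<phi> P"
      unfolding G_def by (rule cauchy_transform_X_mat[OF x \<Omega>(1)[OF BzH[OF z]]]) blast
  qed
  then obtain P where P: "\<And>z. z \<in> S \<Longrightarrow> P z * (emb (\<Omega> (Bz z)) - of_mat (X_mat x)) = 1"
    "\<And>z. z \<in> S \<Longrightarrow> (emb (\<Omega> (Bz z)) - of_mat (X_mat x)) * P z = 1" "\<And>z. z \<in> S \<Longrightarrow> G z = mexp \<phi> (P z)"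
    by metis
  have evS: "\<forall>\<^sub>F w in at z. w \<in> S" if "z \<in> S" for z
    using eventually_at_in_open'[OF openS that] .
  have G_hol: "(\<lambda>z. G z $ i $ j) holomorphic_on S" for i j
    unfolding holomorphic_on_open[OF openS]
  proof
    fix z assume z: "z \<in> S"
    obtain D where D: "\<And>k l. ((\<lambda>z. \<Omega> (Bz z) $ k $ l) has_field_derivative D k l) (at z)"
      using \<Omega>_der[OF z] by blast
    have "\<forall>\<^sub>F w in at z. P w * (emb (\<Omega> (Bz w)) - of_mat (X_mat x)) = 1"
      using evS[OF z] by (rule eventually_mono) (rule P(1))
    from has_field_derivative_mexp_inverse[OF D this P(1)[OF z] P(2)[OF z]]
    obtain d where "((\<lambda>z. mexp \<phi> (P z) $ i $ j) has_field_derivative d) (at z)" by blast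
    then have "((\<lambda>z. G z $ i $ j) has_field_derivative d) (at z)"
      by (rule has_field_derivative_transform_within_open[OF _ openS z]) (simp add: P(3))
    then show "\<exists>d. ((\<lambda>z. G z $ i $ j) has_field_derivative d) (at z)" by blast
  qed
  have \<Omega>_hol: "(\<lambda>z. \<Omega> (Bz z) $ i $ j) holomorphic_on S" for i j
    unfolding holomorphic_on_open[OF openS] using \<Omega>_der by blast
  have Bz_hol: "(\<lambda>z. Bz z $ i $ j) holomorphic_on S" for i j
    unfolding Bz_def by (cases "i = j") (auto simp: mat_def intro!: holomorphic_intros)
  have f_hol: "(\<lambda>z. f z $ i $ j) holomorphic_on S" for i j
    unfolding f_def matrix_matrix_mult_def by (auto intro!: holomorphic_intros G_hol \<Omega>_hol Bz_hol)

  \<comment> \<open>Im z tends to infinity uniformly in Re z. An eventual identity thus holds on a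
    whole half-plane, an open set from which to continue.\<close>
  define F where "F = filtercomap Im at_top"
  have Im_lim: "filterlim Im at_top F" unfolding F_def by (rule filterlim_filtercomap)
  have inv_lim: "((\<lambda>z. emb (matrix_inv (A z)) :: ('a, 2) sqmat) \<longlongrightarrow> 0) F \<and> (\<forall>\<^sub>F z in F. invertible (A z))"
    if A: "\<And>z v. z \<in> S \<Longrightarrow> Im (quadratic_form (A z) v) \<ge> (m + Im z) * (norm v)\<^sup>2" for A :: "complex \<Rightarrow> complex^2^2"
  proof -
    have evS: "\<forall>\<^sub>F z in F. z \<in> S"
      using filterlim_at_top_dense[THEN iffD1, OF Im_lim] by (auto simp: S_def)
    have inv: "invertible (A z)" if z: "z \<in> S" for z
    proof (rule invertible_if_quadratic_form_nonzero)
      fix v :: "complex^2" assume "v \<noteq> 0"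
      then have "0 < (m + Im z) * (norm v)\<^sup>2" using z by (simp add: S_def)
      then show "quadratic_form (A z) v \<noteq> 0" using A[OF z, of v] by auto
    qed
    have "((\<lambda>z. emb (matrix_inv (A z)) :: ('a, 2) sqmat) \<longlongrightarrow> 0) F"
    proof (rule Lim_null_comparison)
      show "\<forall>\<^sub>F z in F. norm (emb (matrix_inv (A z)) :: ('a, 2) sqmat) \<le> CARD(2) / (m + Im z)"
        using evS
      proof eventually_elim
        case (elim z)
        have "A z ** matrix_inv (A z) = mat 1"
          using someI_ex[OF inv[OF elim, unfolded invertible_def]] by (simp add: matrix_inv_def)
        then show ?case using elim A by (intro norm_emb_inverse_le) (auto simp: S_def)
      qed
      have "filterlim (\<lambda>z. m + Im z) at_top F"
        by (rule filterlim_tendsto_add_at_top[OF tendsto_const Im_lim])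
      then show "((\<lambda>z. CARD(2) / (m + Im z)) \<longlongrightarrow> 0) F"
        by (intro tendsto_divide_0[OF tendsto_const] filterlim_at_top_imp_at_infinity)
    qed
    then show ?thesis using evS inv by (auto elim: eventually_mono)
  qed
  have evS': "\<forall>\<^sub>F z in F. z \<in> S"
    using filterlim_at_top_dense[THEN iffD1, OF Im_lim] by (auto simp: S_def)
  \<comment> \<open>Im Omega(B) >= Im B hands the lower bound for B + z I on to its image, whose
    inverse therefore also tends to zero.\<close>
  have coer': "Im (quadratic_form (\<Omega> (Bz z)) v) \<ge> (m + Im z) * (norm v)\<^sup>2" if "z \<in> S" for z v
    using coer[of z v] loewner_le_Im_mat[OF \<Omega>(3)[OF BzH[OF that]], of v] by linarith
  have "\<forall>\<^sub>F z in F. f z = p *\<^sub>R mat 1"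
    unfolding f_def G_def
  proof (rule eventually_left_inverse_identity[OF free y])
    show "((\<lambda>z. emb (matrix_inv (\<Omega> (Bz z))) :: ('a, 2) sqmat) \<longlongrightarrow> 0) F" "\<forall>\<^sub>F z in F. invertible (\<Omega> (Bz z))"
      using inv_lim[OF coer'] by blast+
    show "((\<lambda>z. emb (matrix_inv (Bz z)) :: ('a, 2) sqmat) \<longlongrightarrow> 0) F" "\<forall>\<^sub>F z in F. invertible (Bz z)"
      using inv_lim[OF coer] by blast+
    show "\<forall>\<^sub>F z in F. cauchy_transform \<phi> (X_mat x + Y_mat y) (Bz z) = cauchy_transform \<phi> (X_mat x) (\<Omega> (Bz z))"
      using evS' by eventually_elim (rule \<Omega>(4)[OF BzH])
  qed
  then obtain r where r: "\<And>z. Im z \<ge> r \<Longrightarrow> f z = p *\<^sub>R mat 1"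
    unfolding F_def eventually_filtercomap eventually_at_top_linorder by metis
  have "f 0 $ i $ j = (p *\<^sub>R mat 1 :: complex^2^2) $ i $ j" for i j
  \<comment> \<open>\<open>max r 0\<close> keeps the starting half-plane inside \<open>S\<close>
    whatever the sign of r.\<close>
  proof (rule analytic_continuation_open[where s = "{z. Im z > max r 0}" and s' = S and z = 0
        and f = "\<lambda>z. f z $ i $ j" and g = "\<lambda>_. (p *\<^sub>R mat 1 :: complex^2^2) $ i $ j"])
    show "open {z. Im z > max r 0}" by (rule open_halfspace_Im_gt)
    show "{z. Im z > max r 0} \<noteq> {}"
    proof -
      have "Complex 0 (max r 0 + 1) \<in> {z. Im z > max r 0}" by (auto simp: max_def)
      then show ?thesis by blast
    qed
    show "{z. Im z > max r 0} \<subseteq> S" using m(1) by (auto simp: S_def)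
    show "0 \<in> S" using m(1) by (simp add: S_def)
    show "f z $ i $ j = (p *\<^sub>R mat 1 :: complex^2^2) $ i $ j" if "z \<in> {z. Im z > max r 0}" for z
      using r[of z] that by simp
  qed (use openS connS f_hol in simp_all)
  then have "f 0 = p *\<^sub>R mat 1" by (simp add: vec_eq_iff)
  moreover have "Bz 0 = B" by (simp add: Bz_def)
  ultimately show ?thesis by (simp add: f_def G_def)
qed

end

theorem mainTheorem2:
  fixes \<phi> :: "'a::cstar_algebra \<Rightarrow> complex"
    and x y :: 'a
    and p :: real
    and \<Omega> :: "complex^2^2 \<Rightarrow> complex^2^2"
  assumes "tracial_wstar_probability_space \<phi>"
    and "selfadjoint x" and "selfadjoint y"
    and "freely_independent \<phi> x y"
    and "p > 0" and "free_poisson \<phi> p y"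
    and "subordination_function \<phi> (X_mat x) (Y_mat y) \<Omega>"
  shows "\<exists>H :: complex^2^2 \<Rightarrow> complex^2^2.
           (\<forall>B\<in>\<H>\<^sub>2\<^sup>+. invertible (J_mat - cauchy_transform \<phi> (X_mat x) B) \<and>
              H B = B + p *\<^sub>R matrix_inv (J_mat - cauchy_transform \<phi> (X_mat x) B)) \<and>
           (\<forall>B\<in>\<H>\<^sub>2\<^sup>+. H (\<Omega> B) = B)"
proof -
  interpret tracial_wstar_probability_space \<phi> by fact
  \<comment> \<open>The formula defines H on all matrices; it is evaluated at \<Omega> B, which lies
    in the upper half-plane, where \<open>inv\<close> makes \<open>matrix_inv\<close> a true
    inverse.\<close>
  define H where "H = (\<lambda>B. B + p *\<^sub>R matrix_inv (J_mat - cauchy_transform \<phi> (X_mat x) B))"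
  have inv: "invertible (J_mat - cauchy_transform \<phi> (X_mat x) B)" if "B \<in> \<H>\<^sub>2\<^sup>+" for B
    using invertible_J_minus_cauchy_transform[OF assms(2) that] .
  have "H (\<Omega> B) = B" if B: "B \<in> \<H>\<^sub>2\<^sup>+" for B
  proof -
    let ?K = "J_mat - cauchy_transform \<phi> (X_mat x) (\<Omega> B)"
    have "\<Omega> B \<in> \<H>\<^sub>2\<^sup>+" using assms(7) B by (auto simp: subordination_function_def)
    then have K: "?K ** matrix_inv ?K = mat 1"
      using someI_ex[OF inv[unfolded invertible_def]] by (simp add: matrix_inv_def)
    have "(B - \<Omega> B) ** ?K = p *\<^sub>R mat 1"
      by (rule subordination_left_inverse_identity[OF assms(2,4,6,7) B])
    then have "(B - \<Omega> B) ** ?K ** matrix_inv ?K = p *\<^sub>R matrix_inv ?K"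
      by (simp add: scalar_matrix_assoc[symmetric])
    then have "B - \<Omega> B = p *\<^sub>R matrix_inv ?K" using K by (simp add: matrix_mul_assoc[symmetric])
    then show ?thesis by (simp add: H_def algebra_simps)
  qed
  then show ?thesis using inv by (intro exI[of _ H]) (simp add: H_def)
qed

end
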